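(* Let $2<p\le\infty$ and let $B_1^c=\mathbb{R}^2\setminus B_1$. Let $u$ be a real-valued solution of $$\Delta u-W\cdot\nabla u=0\quad\text{in } B_1^c,$$ where $W=(W_1,W_2)$ is a real vector-valued function satisfying $\|W\|_{L^p(B_1^c)}\le 1$. Assume moreover that $\|\nabla u\|_{L^\infty(B_1^c)}\le 1$ and that there exists $C_0>0$ such that $$\inf_{|z_0|=3}\int_{B_1(z_0)}|\nabla u|^2\ge C_0 .$$ Then there exist positive constants $C_1$ and $C_2$ depending on $p$ and $C_0$ such that $$\inf_{|z_0|=R}\ \sup_{|z-z_0|<1}|u(z)|\ge C_2\exp\left(-C_1R\log^2R\right)$$ for all sufficiently large $R$.
   Context: $B_r(z_0)$ denotes the open ball in $\mathbb{R}^2$ of radius $r$ centered at $z_0$, and $B_1=\{x\in\mathbb{R}^2:|x|<1\}$. $\log^2 R$ means $(\log R)^2$. *)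

theory Defs
  imports "HOL-Analysis.Analysis" "HOL-Probability.Essential_Supremum"
begin

(* Differentiability (not just existence of partial derivatives) is required at every order, so
   that frechet_derivative is always the actual derivative. *)
primrec Ck :: "nat \<Rightarrow> ('a::euclidean_space \<Rightarrow> real) \<Rightarrow> bool" where
  "Ck 0 f \<longleftrightarrow> continuous_on UNIV f"
| "Ck (Suc k) f \<longleftrightarrow>
     (\<forall>x. f differentiable (at x)) \<and>
     (\<forall>b\<in>Basis. Ck k (\<lambda>x. frechet_derivative f (at x) b))"

definition test_function :: "'a::euclidean_space set \<Rightarrow> ('a \<Rightarrow> real) \<Rightarrow> bool" where
  "test_function \<Omega> \<phi> \<longleftrightarrow>
     (\<forall>k. Ck k \<phi>) \<and> compact (closure {x. \<phi> x \<noteq> 0}) \<and> closure {x. \<phi> x \<noteq> 0} \<subseteq> \<Omega>"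

definition grad :: "('a::euclidean_space \<Rightarrow> real) \<Rightarrow> 'a \<Rightarrow> 'a" where
  "grad \<phi> x = (\<Sum>b\<in>Basis. frechet_derivative \<phi> (at x) b *\<^sub>R b)"

definition locally_integrable_on ::
    "('a::euclidean_space \<Rightarrow> 'b::euclidean_space) \<Rightarrow> 'a set \<Rightarrow> bool" where
  "locally_integrable_on f \<Omega> \<longleftrightarrow>
     (\<forall>K. compact K \<and> K \<subseteq> \<Omega> \<longrightarrow> set_integrable lebesgue K f)"

definition weak_gradient_on ::
    "'a::euclidean_space set \<Rightarrow> ('a \<Rightarrow> real) \<Rightarrow> ('a \<Rightarrow> 'a) \<Rightarrow> bool" where
  "weak_gradient_on \<Omega> u G \<longleftrightarrow>
     locally_integrable_on u \<Omega> \<and> locally_integrable_on G \<Omega> \<and>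
     (\<forall>\<phi>. test_function \<Omega> \<phi> \<longrightarrow>
        (LINT x:\<Omega>|lebesgue. u x *\<^sub>R grad \<phi> x) = - (LINT x:\<Omega>|lebesgue. \<phi> x *\<^sub>R G x))"

(* u lies in W^{1,2}_loc of the open set \<Omega>, with weak gradient G *)
definition H1_loc_on ::
    "'a::euclidean_space set \<Rightarrow> ('a \<Rightarrow> real) \<Rightarrow> ('a \<Rightarrow> 'a) \<Rightarrow> bool" where
  "H1_loc_on \<Omega> u G \<longleftrightarrow>
     weak_gradient_on \<Omega> u G \<and>
     locally_integrable_on (\<lambda>x. (u x)\<^sup>2) \<Omega> \<and>
     locally_integrable_on (\<lambda>x. (norm (G x))\<^sup>2) \<Omega>"

(* u is a weak solution of \<Delta>u - W \<bullet> \<nabla>u = 0 in the open set \<Omega>, with weak gradient G;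
   the equation is tested against -\<phi>. The term (W \<bullet> G) \<phi> is integrable as soon as
   W is locally square integrable. *)
definition weak_drift_solution ::
    "'a::euclidean_space set \<Rightarrow> ('a \<Rightarrow> 'a) \<Rightarrow> ('a \<Rightarrow> real) \<Rightarrow> ('a \<Rightarrow> 'a) \<Rightarrow> bool" where
  "weak_drift_solution \<Omega> W u G \<longleftrightarrow>
     H1_loc_on \<Omega> u G \<and>
     (\<forall>\<phi>. test_function \<Omega> \<phi> \<longrightarrow>
        (LINT x:\<Omega>|lebesgue. G x \<bullet> grad \<phi> x + (W x \<bullet> G x) * \<phi> x) = 0)"

(* Meaningful for measurable f and 1 \<le> p \<le> \<infinity>. The powers are taken in the reals, so
   the case of an infinite integral is treated separately. *)
definition Lp_norm ::
    "ennreal \<Rightarrow> 'a measure \<Rightarrow> ('a \<Rightarrow> 'b::real_normed_vector) \<Rightarrow> ennreal" where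
  "Lp_norm p M f =
     (if p = \<infinity> then esssup M (\<lambda>x. ennreal (norm (f x)))
      else let I = (\<integral>\<^sup>+x. ennreal (norm (f x) powr enn2real p) \<partial>M)
           in if I = \<infinity> then \<infinity> else ennreal (enn2real I powr (1 / enn2real p)))"

end

theory Submission
  imports
    Defs
    "HOL-Complex_Analysis.Complex_Analysis"
    "HOL-Real_Asymp.Real_Asymp"
    "HOL-Probability.Sinc_Integral"
begin

text \<open>
  Write \<open>f = \<partial>\<^sub>1 u - \<i> \<partial>\<^sub>2 u\<close> and \<open>D = \<partial>\<^sub>1 + \<i> \<partial>\<^sub>2\<close>. The equation and the vanishing of the curl of \<open>\<nabla>u\<close> say that
  \<open>D f = a f\<close> weakly, with \<open>norm a \<le> norm W\<close>. In the ball of radius \<open>6 R\<close> the equation \<open>D w = a\<close> has a solution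
  with \<open>norm w \<le> C R\<close>, the Cauchy transform of \<open>a\<close> (this uses \<open>p > 2\<close>), and \<open>f = F exp w\<close> with \<open>F\<close> holomorphic in the
  annulus. The maximum principle for \<open>F\<close>, on the annulus without a small disc about \<open>z\<^sub>0\<close>, bounds \<open>F\<close> near the circle of
  radius 3 by its size near \<open>z\<^sub>0\<close>: since the Green function with pole \<open>z\<^sub>0\<close> is at least \<open>c / log R\<close> near that circle
  and at most \<open>C log R\<close> next to the pole, the bound \<open>norm w \<le> C R\<close> costs a factor \<open>exp (- C R (log R)\<^sup>2)\<close>.
  Testing the equation against \<open>u\<close> times a cutoff function finally bounds \<open>\<integral> (norm (\<nabla>u))\<^sup>2\<close> near \<open>z\<^sub>0\<close> linearly by
  \<open>sup (abs u)\<close>, because \<open>\<nabla>u\<close> is bounded.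
\<close>

section \<open>Continuously differentiable functions\<close>

text \<open>All data are weak: the drift is only \<open>L^p\<close>, and neither \<open>w\<close>
  nor \<open>u\<close> need be \<open>C^1\<close>, so test functions containing
  \<open>exp (- w)\<close> or \<open>u\<close> are not admissible as they stand. One explicit
  regularisation meets both obstacles: \<open>1 / z\<close> becomes
  \<open>cnj z / (|z|^2 + \<delta>^2)\<close>, which \<open>D\<close> maps to a positive approximate
  identity of mass \<open>kap\<close> (that is, 2 pi), and the limits reduce to L1 continuity of
  translations and dominated convergence. The condition \<open>p > 2\<close> says that the conjugate
  exponent \<open>q\<close> is below 2, so that \<open>|z| powr (- q)\<close> is locally integrable
  in the plane; the constants depend on \<open>p\<close> through \<open>q\<close> alone. The Green
  function takes the form of integer powers of a rational function: about \<open>R\<close> factors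
  beat a ratio \<open>exp (C R)\<close>, each brings about \<open>log R\<close> auxiliary factors
  that control the outer circle, and near the pole every factor costs another \<open>log R\<close>.
  At the end the integral of \<open>norm (\<nabla>u)\<close> has a lower bound \<open>e\<close>,
  while the square is controlled by \<open>sup (abs u)\<close>. Splitting at a level proportional to
  \<open>e\<close> yields \<open>e^2\<close>, which only doubles the constant in the
  exponent.\<close>

lemma linear_Basis_expand:
  fixes L :: "'a::euclidean_space \<Rightarrow> 'b::real_vector"
  assumes "linear L"
  shows "L h = (\<Sum>b\<in>Basis. (h \<bullet> b) *\<^sub>R L b)"
proof -
  have "L h = L (\<Sum>b\<in>Basis. (h \<bullet> b) *\<^sub>R b)"
    by (simp add: euclidean_representation)
  also have "\<dots> = (\<Sum>b\<in>Basis. (h \<bullet> b) *\<^sub>R L b)"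
    by (simp add: linear_sum[OF assms] linear_cmul[OF assms])
  finally show ?thesis .
qed

text \<open>The derivative is an explicit argument, so that concrete formulas for products, kernels
  and convolutions can be substituted directly. In finite dimension continuity in each fixed
  direction amounts to continuity of the differential.\<close>

definition C1_deriv :: "('a::euclidean_space \<Rightarrow> 'b::euclidean_space) \<Rightarrow> ('a \<Rightarrow> 'a \<Rightarrow> 'b) \<Rightarrow> bool"
  where "C1_deriv \<phi> \<phi>' \<longleftrightarrow> (\<forall>x. (\<phi> has_derivative \<phi>' x) (at x)) \<and> (\<forall>h. continuous_on UNIV (\<lambda>x. \<phi>' x h))"

lemma C1_derivD:
  assumes "C1_deriv \<phi> \<phi>'"
  shows "(\<phi> has_derivative \<phi>' x) (at x)" "continuous_on S (\<lambda>x. \<phi>' x h)"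
    "linear (\<phi>' x)" "continuous_on S \<phi>"
proof -
  show *: "(\<phi> has_derivative \<phi>' x) (at x)" for x
    using assms by (auto simp: C1_deriv_def)
  show "continuous_on S (\<lambda>x. \<phi>' x h)"
    using assms continuous_on_subset by (fastforce simp: C1_deriv_def)
  show "linear (\<phi>' x)"
    using * has_derivative_linear by blast
  show "continuous_on S \<phi>"
    using * by (meson continuous_at_imp_continuous_on has_derivative_continuous)
qed

lemma C1_derivI:
  assumes "\<And>x. (\<phi> has_derivative \<phi>' x) (at x)"
    and "\<And>b. b \<in> Basis \<Longrightarrow> continuous_on UNIV (\<lambda>x. \<phi>' x b)"
  shows "C1_deriv \<phi> \<phi>'"
proof -
  have "continuous_on UNIV (\<lambda>x. \<phi>' x h)" for h
  proof -
    have "linear (\<phi>' x)" for x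
      using assms(1) has_derivative_linear by blast
    then have "(\<lambda>x. \<phi>' x h) = (\<lambda>x. \<Sum>b\<in>Basis. (h \<bullet> b) *\<^sub>R \<phi>' x b)"
      by (intro ext linear_Basis_expand)
    then show ?thesis
      using assms(2) by (simp only:) (intro continuous_on_sum continuous_on_scaleR continuous_on_const)
  qed
  then show ?thesis
    using assms(1) by (auto simp: C1_deriv_def)
qed

lemma linear_norm_le_Basis:
  fixes L :: "'a::euclidean_space \<Rightarrow> 'b::real_normed_vector"
  assumes "linear L" "\<And>b. b \<in> Basis \<Longrightarrow> norm (L b) \<le> B"
  shows "norm (L h) \<le> real DIM('a) * B * norm h"
proof -
  have "L h = (\<Sum>b\<in>Basis. (h \<bullet> b) *\<^sub>R L b)"
    by (rule linear_Basis_expand[OF assms(1)])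
  also have "norm \<dots> \<le> (\<Sum>b\<in>(Basis::'a set). norm h * B)"
  proof (rule order_trans[OF norm_sum], rule sum_mono)
    fix b :: 'a assume "b \<in> Basis"
    then show "norm ((h \<bullet> b) *\<^sub>R L b) \<le> norm h * B"
      using assms(2) Basis_le_norm by (auto intro!: mult_mono)
  qed
  finally show ?thesis
    by (simp add: mult_ac)
qed

text \<open>Uniform continuity of the derivative on a compact neighbourhood of \<open>S\<close>, fed
  into the mean value inequality. Uniformity in \<open>z\<close> is what allows the remainder to be
  integrated against a merely integrable density in \<open>conv_C1_deriv\<close>.\<close>

lemma C1_deriv_uniform:
  fixes K :: "'a::euclidean_space \<Rightarrow> 'b::euclidean_space"
  assumes K: "C1_deriv K K'" and S: "compact S" and "e > 0"
  shows "\<exists>d>0. \<forall>z\<in>S. \<forall>h. norm h < d \<longrightarrow> norm (K (z + h) - K z - K' z h) \<le> e * norm h"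
proof -
  \<comment> \<open>The unit thickening of \<open>S\<close>: a compact set that still contains
    \<open>z + k\<close> for \<open>z\<close> in \<open>S\<close> and all small
    \<open>k\<close>.\<close>
  define S' where "S' = (\<lambda>(a,b). a + b) ` (S \<times> cball 0 (1::real))"
  have cS': "compact S'"
    unfolding S'_def split_beta
    by (intro compact_continuous_image compact_Times S compact_cball continuous_intros)
  \<comment> \<open>Passing from basis vectors to the operator norm costs the factor
    \<open>DIM('a)\<close> of \<open>linear_norm_le_Basis\<close>.\<close>
  define e' where "e' = e / real DIM('a)"
  have e': "e' > 0" using \<open>e > 0\<close> by (auto simp: e'_def)
  have "\<forall>b\<in>(Basis::'a set). \<exists>d>0. \<forall>x\<in>S'. \<forall>y\<in>S'. dist y x < d \<longrightarrow> dist (K' y b) (K' x b) < e'"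
    using compact_uniformly_continuous[OF C1_derivD(2)[OF K] cS'] e'
    by (auto simp: uniformly_continuous_on_def)
  then obtain d where d: "\<And>b. b \<in> (Basis::'a set) \<Longrightarrow> d b > (0::real)"
    "\<And>b x y. b \<in> (Basis::'a set) \<Longrightarrow> x \<in> S' \<Longrightarrow> y \<in> S' \<Longrightarrow> dist y x < d b \<Longrightarrow> dist (K' y b) (K' x b) < e'"
    by metis
  define \<delta> where "\<delta> = min 1 (Min (d ` Basis))"
  have \<delta>: "\<delta> > 0" "\<delta> \<le> 1" "\<And>b. b \<in> (Basis::'a set) \<Longrightarrow> \<delta> \<le> d b"
    using d(1) by (auto simp: \<delta>_def min_le_iff_disj)
  have "norm (K (z + h) - K z - K' z h) \<le> e * norm h" if z: "z \<in> S" and h: "norm h < \<delta>" for z h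
  proof -
    have in_S': "z + k \<in> S'" if "norm k < \<delta>" for k
      using z that \<delta>(2) by (force simp: S'_def)
    have zS': "z \<in> S'" using in_S'[of 0] \<delta>(1) by auto
    have "norm (K (z + h) - K z - K' z (z + h - z)) \<le> norm (z + h - z) * e"
    proof (rule differentiable_bound_linearization[where S="ball z \<delta>" and f'=K'])
      show "z + t *\<^sub>R (z + h - z) \<in> ball z \<delta>" if "t \<in> {0..1}" for t
      proof -
        have "\<bar>t\<bar> * norm h \<le> 1 * norm h"
          using that by (intro mult_right_mono) auto
        then show ?thesis
          using h by (simp add: dist_norm)
      qed
      show "(K has_derivative K' x) (at x within ball z \<delta>)" for x
        using C1_derivD(1)[OF K] has_derivative_at_withinI by blast
      show "z \<in> ball z \<delta>" using \<delta> by auto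
      show "onorm (K' x - K' z) \<le> e" if "x \<in> ball z \<delta>" for x
      proof (rule onorm_le)
        fix v
        have lin: "linear (K' x - K' z)"
          using linear_compose_sub[OF C1_derivD(3)[OF K] C1_derivD(3)[OF K]] by (simp add: fun_diff_def)
        have "norm ((K' x - K' z) v) \<le> real DIM('a) * e' * norm v"
        proof (rule linear_norm_le_Basis[OF lin])
          fix b :: 'a assume b: "b \<in> Basis"
          have "x \<in> S'" using in_S'[of "x - z"] that by (auto simp: dist_norm norm_minus_commute)
          then show "norm ((K' x - K' z) b) \<le> e'"
            using d(2)[OF b zS' \<open>x \<in> S'\<close>] that \<delta>(3)[OF b]
            by (auto simp: dist_norm norm_minus_commute)
        qed
        then show "norm ((K' x - K' z) v) \<le> e * norm v"
          by (simp add: e'_def)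
      qed
    qed
    then show ?thesis by (simp add: mult.commute)
  qed
  then show ?thesis using \<delta>(1) by blast
qed

section \<open>Convolutions\<close>

lemma conv_integrable:
  fixes g k :: "'a::euclidean_space \<Rightarrow> 'b::{real_normed_field, euclidean_space}"
  assumes g: "integrable lborel g" and S: "compact S" "\<And>y. y \<notin> S \<Longrightarrow> g y = 0"
    and k: "continuous_on UNIV k"
  shows "integrable lborel (\<lambda>y. g y * k (x - y))"
proof -
  have "compact ((\<lambda>y. k (x - y)) ` S)"
    by (intro compact_continuous_image S continuous_on_compose2[OF k] continuous_intros) auto
  then obtain B where B: "\<And>y. y \<in> S \<Longrightarrow> norm (k (x - y)) \<le> B"
    by (meson bounded_iff compact_imp_bounded imageI)
  have km: "(\<lambda>y. k (x - y)) \<in> borel_measurable lborel"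
    by (simp, intro borel_measurable_continuous_onI continuous_on_compose2[OF k] continuous_intros) auto
  show ?thesis
  proof (rule Bochner_Integration.integrable_bound[where f="\<lambda>y. B * norm (g y)"])
    show "integrable lborel (\<lambda>y. B * norm (g y))"
      using g by auto
    show "(\<lambda>y. g y * k (x - y)) \<in> borel_measurable lborel"
      using km g by auto
    show "AE y in lborel. norm (g y * k (x - y)) \<le> norm (B * norm (g y))"
    proof (rule AE_I2)
      fix y
      show "norm (g y * k (x - y)) \<le> norm (B * norm (g y))"
      proof (cases "y \<in> S")
        case True
        then have "norm (k (x - y)) \<le> \<bar>B\<bar>" using B by force
        then show ?thesis
          by (simp add: norm_mult abs_mult) (metis mult.commute mult_left_mono norm_ge_zero)
      qed (simp add: S)
    qed
  qed
qed

lemma conv_continuous: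
  fixes g k :: "'a::euclidean_space \<Rightarrow> 'b::{real_normed_field, euclidean_space}"
  assumes g: "integrable lborel g" and S: "compact S" "\<And>y. y \<notin> S \<Longrightarrow> g y = 0"
    and k: "continuous_on UNIV k"
  shows "continuous_on UNIV (\<lambda>x. LINT y|lborel. g y * k (x - y))"
  unfolding continuous_on_sequentially
proof (intro allI impI ballI, elim conjE)
  fix X :: "nat \<Rightarrow> 'a" and x assume X: "X \<longlonglongrightarrow> x"
  then have "bounded (range X)"
    using convergent_imp_bounded by blast
  then obtain r where r: "\<And>n. X n \<in> cball 0 r"
    unfolding bounded_iff by auto
  have "compact ((\<lambda>(a,b). k (a - b)) ` (cball 0 r \<times> S))"
    unfolding split_beta
    by (intro compact_continuous_image compact_Times S compact_cball continuous_on_compose2[OF k] continuous_intros) auto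
  then have "bounded ((\<lambda>(a,b). k (a - b)) ` (cball 0 r \<times> S))"
    by (rule compact_imp_bounded)
  then obtain B where B: "\<And>a b. a \<in> cball 0 r \<Longrightarrow> b \<in> S \<Longrightarrow> norm (k (a - b)) \<le> B"
    unfolding bounded_iff by fastforce
  show "((\<lambda>x. LINT y|lborel. g y * k (x - y)) \<circ> X) \<longlonglongrightarrow> (LINT y|lborel. g y * k (x - y))"
    unfolding o_def
  proof (rule integral_dominated_convergence[where w="\<lambda>y. B * norm (g y)"])
    show "integrable lborel (\<lambda>y. B * norm (g y))"
      using g by auto
    show "(\<lambda>y. g y * k (x - y)) \<in> borel_measurable lborel" "(\<lambda>y. g y * k (X i - y)) \<in> borel_measurable lborel" for i
      by (rule borel_measurable_integrable, rule conv_integrable[OF g S(1) _ k], erule S(2))+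
    show "AE y in lborel. (\<lambda>i. g y * k (X i - y)) \<longlonglongrightarrow> g y * k (x - y)"
    proof (intro AE_I2 tendsto_mult tendsto_const)
      fix y
      have "isCont k (x - y)" using k by (simp add: continuous_on_eq_continuous_at)
      then show "(\<lambda>i. k (X i - y)) \<longlonglongrightarrow> k (x - y)"
        by (rule isCont_tendsto_compose) (intro tendsto_intros X)
    qed
    show "AE y in lborel. norm (g y * k (X i - y)) \<le> B * norm (g y)" for i
    proof (rule AE_I2)
      fix y show "norm (g y * k (X i - y)) \<le> B * norm (g y)"
      proof (cases "y \<in> S")
        case True
        then show ?thesis
          using mult_left_mono[OF B[OF r[of i] True] norm_ge_zero[of "g y"]]
          by (simp add: norm_mult mult.commute)
      qed (simp add: S)
    qed
  qed
qed

text \<open>All smoothness comes from the kernel: \<open>C1_deriv_uniform\<close> on the compact set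
  of all \<open>x - y\<close> with \<open>y\<close> in \<open>S\<close> bounds the Taylor remainder
  of \<open>K\<close> uniformly, and the remainder of the convolution is at most this bound times
  the L1 norm of \<open>g\<close>.\<close>

lemma conv_C1_deriv:
  fixes g K :: "'a::euclidean_space \<Rightarrow> 'b::{real_normed_field, euclidean_space}"
  assumes g: "integrable lborel g" and S: "compact S" "\<And>y. y \<notin> S \<Longrightarrow> g y = 0"
    and K: "C1_deriv K K'"
  shows "C1_deriv (\<lambda>x. LINT y|lborel. g y * K (x - y)) (\<lambda>x h. LINT y|lborel. g y * K' (x - y) h)"
proof (rule C1_derivI)
  note Kc = C1_derivD(4)[OF K] and K'c = C1_derivD(2)[OF K]
  note int1 = conv_integrable[OF g S Kc] and int2 = conv_integrable[OF g S K'c]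
  show "continuous_on UNIV (\<lambda>x. LINT y|lborel. g y * K' (x - y) b)" for b
    by (rule conv_continuous[OF g S K'c])
  fix x
  let ?F = "\<lambda>x. LINT y|lborel. g y * K (x - y)" and ?F' = "\<lambda>h. LINT y|lborel. g y * K' (x - y) h"
  note lin = C1_derivD(3)[OF K]
  have linF: "linear ?F'"
  proof (rule linearI)
    show "?F' (h1 + h2) = ?F' h1 + ?F' h2" for h1 h2
      by (simp add: linear_add[OF lin] distrib_left int2)
    show "?F' (c *\<^sub>R h) = c *\<^sub>R ?F' h" for c h
      by (simp add: linear_cmul[OF lin] int2)
  qed
  show "(?F has_derivative ?F') (at x)"
    unfolding has_derivative_at_alt
  proof (intro conjI allI impI)
    show "bounded_linear ?F'" using linF linear_conv_bounded_linear by blast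
    fix e :: real assume "e > 0"
    \<comment> \<open>The summand 1 keeps \<open>I\<close> positive even if \<open>g\<close>
      vanishes almost everywhere, so that \<open>e / I\<close> is a legitimate tolerance.\<close>
    define I where "I = (LINT y|lborel. norm (g y)) + 1"
    have I: "I > 0" unfolding I_def by (smt (verit) Bochner_Integration.integral_nonneg norm_ge_zero)
    define S' where "S' = (\<lambda>y. x - y) ` S"
    have "compact S'"
      unfolding S'_def by (intro compact_continuous_image S continuous_intros)
    from C1_deriv_uniform[OF K this, of "e / I"] obtain d where d: "d > 0"
      "\<And>z h. z \<in> S' \<Longrightarrow> norm h < d \<Longrightarrow> norm (K (z + h) - K z - K' z h) \<le> e / I * norm h"
      using I \<open>e > 0\<close> by auto
    have "norm (?F y - ?F x - ?F' (y - x)) \<le> e * norm (y - x)" if "norm (y - x) < d" for y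
    proof -
      have eq: "?F y - ?F x - ?F' (y - x) = (LINT t|lborel. g t * (K (y - t) - K (x - t) - K' (x - t) (y - x)))"
        by (simp add: int1 int2 right_diff_distrib)
      have "norm (?F y - ?F x - ?F' (y - x)) \<le> (LINT t|lborel. norm (g t * (K (y - t) - K (x - t) - K' (x - t) (y - x))))"
        unfolding eq by (rule integral_norm_bound)
      also have "\<dots> \<le> (LINT t|lborel. norm (g t) * (e / I * norm (y - x)))"
      proof (rule integral_mono)
        show "integrable lborel (\<lambda>t. norm (g t * (K (y - t) - K (x - t) - K' (x - t) (y - x))))"
          by (rule integrable_norm) (simp add: right_diff_distrib int1 int2)
        show "integrable lborel (\<lambda>t. norm (g t) * (e / I * norm (y - x)))"
          using g by auto
        fix t
        show "norm (g t * (K (y - t) - K (x - t) - K' (x - t) (y - x))) \<le> norm (g t) * (e / I * norm (y - x))"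
        proof (cases "t \<in> S")
          case True
          have "norm (K ((x - t) + (y - x)) - K (x - t) - K' (x - t) (y - x)) \<le> e / I * norm (y - x)"
            using True that by (intro d) (auto simp: S'_def)
          then show ?thesis
            unfolding norm_mult by (intro mult_left_mono) auto
        qed (simp add: S)
      qed
      also have "\<dots> = (LINT y|lborel. norm (g y)) * (e / I * norm (y - x))"
        by simp
      also have "\<dots> \<le> I * (e / I * norm (y - x))"
        using I \<open>e > 0\<close> by (intro mult_right_mono) (auto simp: I_def)
      finally show ?thesis using I by simp
    qed
    then show "\<exists>d>0. \<forall>y. norm (y - x) < d \<longrightarrow> norm (?F y - ?F x - ?F' (y - x)) \<le> e * norm (y - x)"
      using d(1) by blast
  qed
qed

lemma nn_integral_lborel_affine:
  fixes t :: "'a::euclidean_space"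
  assumes [measurable]: "f \<in> borel_measurable borel" and "c \<noteq> 0"
  shows "(\<integral>\<^sup>+x. f x \<partial>lborel) = ennreal (\<bar>c\<bar> ^ DIM('a)) * (\<integral>\<^sup>+x. f (t + c *\<^sub>R x) \<partial>lborel)"
  by (subst lborel_affine[OF \<open>c \<noteq> 0\<close>, of t])
     (simp add: nn_integral_density nn_integral_distr nn_integral_cmult)

lemma lborel_distr_reflect: "distr lborel borel (\<lambda>y. x - y) = (lborel :: 'a::euclidean_space measure)"
  using lborel_affine[of "-1" x] by (simp add: density_1)

lemma lborel_integral_reflect:
  fixes f :: "'a::euclidean_space \<Rightarrow> 'b::{banach, second_countable_topology}"
  assumes [measurable]: "f \<in> borel_measurable borel"
  shows "(LINT y|lborel. f (x - y)) = (LINT y|lborel. f y)"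
  by (subst (2) lborel_distr_reflect[of x, symmetric]) (simp add: integral_distr)

section \<open>Test functions\<close>

lemma Ck_SucI:
  assumes "\<And>x. (f has_derivative f' x) (at x)" "\<And>b. b \<in> Basis \<Longrightarrow> Ck k (\<lambda>x. f' x b)"
  shows "Ck (Suc k) f"
proof -
  have "frechet_derivative f (at x) = f' x" for x
    using assms(1) frechet_derivative_at by metis
  then show ?thesis
    using assms by (auto simp: differentiable_def)
qed

lemma Ck_SucD:
  assumes "Ck (Suc k) f"
  shows "(f has_derivative frechet_derivative f (at x)) (at x)"
    "b \<in> Basis \<Longrightarrow> Ck k (\<lambda>x. frechet_derivative f (at x) b)"
  using assms frechet_derivative_works by auto

lemma Ck_Suc_imp: "Ck (Suc k) f \<Longrightarrow> Ck k f"
proof (induction k arbitrary: f)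
  case 0
  then show ?case
    by (simp add: continuous_at_imp_continuous_on differentiable_imp_continuous_within)
next
  case (Suc k)
  then show ?case by (metis Ck.simps(2))
qed

lemma Ck_const: "Ck k (\<lambda>x. c)"
proof (induction k arbitrary: c)
  case (Suc k)
  show ?case by (rule Ck_SucI[where f'="\<lambda>x h. 0"]) (auto intro: Suc)
qed simp

lemma Ck_inner: "Ck k (\<lambda>x. x \<bullet> b)"
proof (cases k)
  case (Suc j)
  show ?thesis unfolding Suc
    by (rule Ck_SucI[where f'="\<lambda>x h. h \<bullet> b"]) (auto intro!: derivative_eq_intros Ck_const)
qed (auto intro!: continuous_intros)

lemma Ck_add: "Ck k f \<Longrightarrow> Ck k g \<Longrightarrow> Ck k (\<lambda>x. f x + g x)"
proof (induction k arbitrary: f g)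
  case (Suc k)
  show ?case
    by (rule Ck_SucI[where f'="\<lambda>x h. frechet_derivative f (at x) h + frechet_derivative g (at x) h"])
      (auto intro!: has_derivative_add Ck_SucD Suc simp del: Ck.simps intro: Suc.prems)
qed (auto intro!: continuous_intros)

lemma Ck_mult: "Ck k f \<Longrightarrow> Ck k g \<Longrightarrow> Ck k (\<lambda>x. f x * g x)"
proof (induction k arbitrary: f g)
  case (Suc k)
  show ?case
  proof (rule Ck_SucI)
    show "((\<lambda>x. f x * g x) has_derivative (\<lambda>h. f x * frechet_derivative g (at x) h + frechet_derivative f (at x) h * g x)) (at x)" for x
      by (rule has_derivative_mult) (rule Ck_SucD(1)[OF Suc.prems(1)] Ck_SucD(1)[OF Suc.prems(2)])+
    show "Ck k (\<lambda>x. f x * frechet_derivative g (at x) b + frechet_derivative f (at x) b * g x)" if "b \<in> Basis" for b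
      using that by (intro Ck_add Suc.IH Ck_SucD(2)[OF Suc.prems(1)] Ck_SucD(2)[OF Suc.prems(2)] Ck_Suc_imp[OF Suc.prems(1)] Ck_Suc_imp[OF Suc.prems(2)])
  qed
qed (auto intro!: continuous_intros)

text \<open>The classical flat function with a power in the denominator. The power makes the family
  closed under differentiation, up to linear combinations, so smoothness of all members can be
  proved in one induction.\<close>

definition flat_exp :: "nat \<Rightarrow> real \<Rightarrow> real" where
  "flat_exp m t = (if t > 0 then exp (- 1 / t) / t ^ m else 0)"

text \<open>From \<open>exp x \<ge> (x / n) ^ n\<close> with \<open>x = 1 / t\<close> and
  \<open>n = m + 2\<close>. A quadratic bound at 0 is what forces the derivative at 0 to exist and
  vanish.\<close>

lemma flat_exp_le: "flat_exp m t \<le> real (m + 2) ^ (m + 2) * t\<^sup>2"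
proof (cases "t > 0")
  case True
  define n where "n = m + 2"
  have "n > 0" by (simp add: n_def)
  have "(1 / (t * n)) ^ n \<le> (1 + (1/t) / n) ^ n"
    using True by (intro power_mono) auto
  also have "\<dots> \<le> exp (1/t)"
    using True \<open>n > 0\<close> by (intro exp_ge_one_plus_x_over_n_power_n) (auto intro: order_trans[of _ 0])
  finally have "inverse (exp (1/t)) \<le> inverse ((1 / (t * n)) ^ n)"
    using True \<open>n > 0\<close> by (intro le_imp_inverse_le) auto
  also have "\<dots> = (t * n) ^ n"
    by (simp add: power_divide)
  finally have "exp (- 1/t) \<le> t ^ n * n ^ n"
    by (simp add: exp_minus power_mult_distrib)
  then have "exp (- 1/t) / t ^ m \<le> t ^ n * n ^ n / t ^ m"
    using True by (intro divide_right_mono) auto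
  also have "\<dots> = n ^ n * t\<^sup>2"
    using True by (simp add: n_def power_add power2_eq_square)
  finally show ?thesis
    using True unfolding flat_exp_def n_def[symmetric] by simp
qed (auto simp: flat_exp_def)

lemma flat_exp_nonneg: "flat_exp m t \<ge> 0"
  by (simp add: flat_exp_def)

lemma flat_exp_deriv: "(flat_exp m has_real_derivative flat_exp (m + 2) t - m * flat_exp (m + 1) t) (at t)"
proof -
  consider "t > 0" | "t < 0" | "t = 0" by linarith
  then show ?thesis
  proof cases
    case 1
    have A: "((\<lambda>t. exp (- 1 / t)) has_real_derivative exp (- 1 / t) / t\<^sup>2) (at t)"
      using 1 by (auto intro!: derivative_eq_intros simp: power2_eq_square)
    have "((\<lambda>t. exp (- 1 / t) / t ^ m) has_real_derivative flat_exp (m + 2) t - m * flat_exp (m + 1) t) (at t)"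
      by (rule DERIV_cong[OF DERIV_divide[OF A DERIV_pow]])
        (use 1 in \<open>cases m; simp add: flat_exp_def field_simps power2_eq_square\<close>)+
    then show ?thesis
      by (rule has_field_derivative_transform_within_open[where S="{0<..}"]) (use 1 in \<open>auto simp: flat_exp_def\<close>)
  next
    case 2
    have "((\<lambda>t. 0) has_real_derivative flat_exp (m + 2) t - m * flat_exp (m + 1) t) (at t)"
      using 2 by (auto simp: flat_exp_def)
    then show ?thesis
      by (rule has_field_derivative_transform_within_open[where S="{..<0}"]) (use 2 in \<open>auto simp: flat_exp_def\<close>)
  next
    case 3
    have "((\<lambda>h. (flat_exp m (0 + h) - flat_exp m 0) / h) \<longlongrightarrow> 0) (at 0)"
    proof (rule tendsto_0_le[where K=1])
      show "((\<lambda>h. real (m + 2) ^ (m + 2) * h) \<longlongrightarrow> 0) (at 0)"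
        by (intro tendsto_eq_intros) auto
      show "\<forall>\<^sub>F h in at 0. norm ((flat_exp m (0 + h) - flat_exp m 0) / h) \<le> norm (real (m + 2) ^ (m + 2) * h) * 1"
      proof (rule always_eventually, rule allI)
        fix h :: real
        have "\<bar>flat_exp m h\<bar> \<le> real (m + 2) ^ (m + 2) * h\<^sup>2"
          using flat_exp_le[of m h] flat_exp_nonneg[of m h] by simp
        then show "norm ((flat_exp m (0 + h) - flat_exp m 0) / h) \<le> norm (real (m + 2) ^ (m + 2) * h) * 1"
          by (cases "h = 0")
            (simp_all add: flat_exp_def[of m 0] abs_mult pos_divide_le_eq power2_eq_square del: power_Suc of_nat_add)
      qed
    qed
    then show ?thesis
      using 3 by (simp add: DERIV_def flat_exp_def)
  qed
qed

text \<open>The induction runs over all \<open>m\<close> at once: differentiation produces members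
  of the family with larger index, multiplied by a linear function, and \<open>Ck\<close> is closed
  under sums and products.\<close>

lemma Ck_flat_exp: "Ck k (\<lambda>x. flat_exp m (r - x \<bullet> x))"
proof (induction k arbitrary: m)
  case 0
  have "continuous_on UNIV (flat_exp m)"
    using flat_exp_deriv by (meson DERIV_isCont continuous_at_imp_continuous_on)
  then show ?case
    by (auto intro!: continuous_intros intro: continuous_on_compose2)
next
  case (Suc k)
  let ?f' = "\<lambda>t. flat_exp (m + 2) t + (- real m) * flat_exp (m + 1) t"
  show ?case
  proof (rule Ck_SucI)
    show "((\<lambda>x. flat_exp m (r - x \<bullet> x)) has_derivative (\<lambda>h. ?f' (r - x \<bullet> x) * (-2 * (x \<bullet> h)))) (at x)" for x :: 'a
    proof -
      have 1: "((\<lambda>x. r - x \<bullet> x) has_derivative (\<lambda>h. -2 * (x \<bullet> h))) (at x)"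
        by (auto intro!: derivative_eq_intros simp: inner_commute)
      have 2: "(flat_exp m has_derivative (\<lambda>h. ?f' (r - x \<bullet> x) * h)) (at (r - x \<bullet> x))"
        using flat_exp_deriv[of m "r - x \<bullet> x"] by (simp add: has_field_derivative_def)
      show ?thesis
        using has_derivative_compose[OF 1 2] by simp
    qed
    show "Ck k (\<lambda>x. ?f' (r - x \<bullet> x) * (-2 * (x \<bullet> b)))" for b :: 'a
      by (intro Ck_mult Ck_add Suc Ck_const Ck_inner)
  qed
qed

lemma smooth_C1_deriv:
  assumes "\<And>k. Ck k f"
  shows "C1_deriv f (\<lambda>x. frechet_derivative f (at x))"
  using assms[of "Suc 0"] by (intro C1_derivI Ck_SucD(1)[of 0]) auto

lemma smooth_partial:
  assumes "\<And>k. Ck k f" "b \<in> Basis"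
  shows "Ck k (\<lambda>x. frechet_derivative f (at x) b)"
  using assms(1)[of "Suc k"] assms(2) by auto

lemma integrable_continuous_compact_support:
  fixes f :: "'a::euclidean_space \<Rightarrow> 'b::euclidean_space"
  assumes "continuous_on UNIV f" "compact S" "\<And>x. x \<notin> S \<Longrightarrow> f x = 0"
  shows "integrable lborel f"
proof -
  have "integrable lborel (\<lambda>x. indicator S x *\<^sub>R f x)"
    using assms by (intro borel_integrable_compact) (auto intro: continuous_on_subset)
  moreover have "(\<lambda>x. indicator S x *\<^sub>R f x) = f"
    using assms(3) by (auto simp: indicator_def)
  ultimately show ?thesis by simp
qed

lemma bump_exists:
  assumes "d > 0"
  shows "\<exists>\<eta>::'a::euclidean_space \<Rightarrow> real. (\<forall>k. Ck k \<eta>) \<and> (\<forall>x. \<eta> x \<ge> 0) \<and> (\<forall>x. norm x > d \<longrightarrow> \<eta> x = 0) \<and>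
    (LINT x|lborel. \<eta> x) = 1"
proof -
  define f :: "'a \<Rightarrow> real" where "f x = flat_exp 0 (d\<^sup>2 - x \<bullet> x)" for x
  have sm: "Ck k f" for k
    unfolding f_def by (rule Ck_flat_exp)
  have nn: "f x \<ge> 0" for x by (simp add: f_def flat_exp_nonneg)
  have z: "f x = 0" if "norm x > d" for x
  proof -
    have "d\<^sup>2 \<le> (norm x)\<^sup>2" using that assms by (intro power_mono) auto
    then show ?thesis by (simp add: f_def flat_exp_def power2_norm_eq_inner)
  qed
  have pos: "f x > 0" if "norm x < d" for x
  proof -
    have "(norm x)\<^sup>2 < d\<^sup>2" using that assms by (intro power_strict_mono) auto
    then show ?thesis by (simp add: f_def flat_exp_def power2_norm_eq_inner)
  qed
  have int: "integrable lborel f"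
    using sm[of 0] z by (intro integrable_continuous_compact_support[where S="cball 0 d"]) auto
  define I where "I = (LINT x|lborel. f x)"
  have "I \<noteq> 0"
  proof
    assume "I = 0"
    then have "AE x in lborel. f x = 0"
      using integral_nonneg_eq_0_iff_AE[OF int] nn by (auto simp: I_def)
    then have "AE x in lborel. x \<notin> ball (0::'a) d"
      by eventually_elim (use pos in force)
    then have "emeasure lborel (ball (0::'a) d) = 0"
      by (subst (asm) AE_iff_measurable[of "ball (0::'a) d"]) auto
    then show False
      using content_ball_pos[OF assms, of "0::'a"] by (simp add: measure_def)
  qed
  moreover have "I \<ge> 0" unfolding I_def using nn by auto
  ultimately have "I > 0" by auto
  show ?thesis
  proof (intro exI[where x="\<lambda>x. (1 / I) * f x"] conjI allI impI)
    show "Ck k (\<lambda>x. 1 / I * f x)" for k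
      by (intro Ck_mult Ck_const sm)
    show "(LINT x|lborel. 1 / I * f x) = 1"
      using \<open>I > 0\<close> by (simp add: I_def)
  qed (use nn z \<open>I > 0\<close> in auto)
qed

text \<open>Every derivative falls on \<open>\<eta>\<close>; the function \<open>g\<close>
  contributes only integrability and a compact support.\<close>

lemma Ck_conv:
  fixes g \<eta> :: "'a::euclidean_space \<Rightarrow> real"
  assumes g: "integrable lborel g" "compact S" "\<And>y. y \<notin> S \<Longrightarrow> g y = 0"
    and \<eta>: "\<And>k. Ck k \<eta>"
  shows "Ck k (\<lambda>x. LINT y|lborel. g y * \<eta> (x - y))"
  using \<eta>
proof (induction k arbitrary: \<eta>)
  case 0
  show ?case using conv_continuous[OF g(1,2,3)] 0[of 0] by simp
next
  case (Suc k)
  note C = conv_C1_deriv[OF g(1,2) _ smooth_C1_deriv[OF Suc.prems], OF g(3)]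
  show ?case
  proof (rule Ck_SucI)
    show "((\<lambda>x. LINT y|lborel. g y * \<eta> (x - y)) has_derivative (\<lambda>h. LINT y|lborel. g y * frechet_derivative \<eta> (at (x - y)) h)) (at x)" for x
      using C1_derivD(1)[OF C] by auto
    show "Ck k (\<lambda>x. LINT y|lborel. g y * frechet_derivative \<eta> (at (x - y)) b)" if "b \<in> Basis" for b
      by (rule Suc.IH[OF smooth_partial[OF Suc.prems that]])
  qed
qed

lemma has_derivative_zero_outside:
  fixes \<phi> :: "'a::euclidean_space \<Rightarrow> 'b::real_normed_vector"
  assumes "(\<phi> has_derivative L) (at x)" "closed S" "\<And>x. x \<notin> S \<Longrightarrow> \<phi> x = 0" "x \<notin> S"
  shows "L h = 0"
proof -
  have "((\<lambda>_. 0) has_derivative L) (at x)"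
    using assms by (intro has_derivative_transform_within_open[OF assms(1), of "- S"]) auto
  then have "L = (\<lambda>h. 0)"
    using has_derivative_unique has_derivative_const by blast
  then show ?thesis by simp
qed

lemma continuous_compact_support_bounded:
  fixes f :: "'a::euclidean_space \<Rightarrow> 'b::real_normed_vector"
  assumes "continuous_on UNIV f" "compact S" "\<And>x. x \<notin> S \<Longrightarrow> f x = 0"
  obtains B where "B \<ge> 0" "\<And>x. norm (f x) \<le> B"
proof -
  have "bounded (f ` S)"
    using assms by (intro compact_imp_bounded compact_continuous_image) (auto intro: continuous_on_subset)
  then obtain B where B: "\<And>x. x \<in> S \<Longrightarrow> norm (f x) \<le> B" "B > 0"
    unfolding bounded_pos by auto
  show ?thesis
  proof (rule that)
    show "norm (f x) \<le> B" for x
      using B assms(3)[of x] by (cases "x \<in> S") auto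
  qed (use B in auto)
qed

text \<open>An average against a probability density inherits any bound that holds where the density
  is nonzero. With \<open>v = 0\<close> this gives sup bounds for mollified functions, with
  \<open>v = c x\<close> their pointwise convergence.\<close>

lemma average_bound:
  fixes \<eta> c :: "'a::euclidean_space \<Rightarrow> real"
  assumes "integrable lborel \<eta>" "\<And>y. \<eta> y \<ge> 0" "(LINT y|lborel. \<eta> y) = 1"
    and c: "c \<in> borel_measurable borel" "\<And>y. \<eta> y \<noteq> 0 \<Longrightarrow> \<bar>c y - v\<bar> \<le> e"
  shows "integrable lborel (\<lambda>y. \<eta> y * c y)" "\<bar>(LINT y|lborel. \<eta> y * c y) - v\<bar> \<le> e"
proof -
  have cm [measurable]: "c \<in> borel_measurable borel" by fact
  have i: "integrable lborel (\<lambda>y. \<eta> y * (c y - v))"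
  proof (rule Bochner_Integration.integrable_bound[where f="\<lambda>y. e * \<eta> y"])
    show "AE y in lborel. norm (\<eta> y * (c y - v)) \<le> norm (e * \<eta> y)"
    proof (rule AE_I2)
      fix y show "norm (\<eta> y * (c y - v)) \<le> norm (e * \<eta> y)"
        using c(2)[of y] assms(2)[of y]
        by (cases "\<eta> y = 0") (auto simp: abs_mult mult.commute intro!: mult_right_mono)
    qed
  qed (use assms(1) borel_measurable_integrable[OF assms(1)] in auto)
  have "integrable lborel (\<lambda>y. \<eta> y * (c y - v) + v * \<eta> y)"
    using i assms(1) by auto
  then show i2: "integrable lborel (\<lambda>y. \<eta> y * c y)"
    by (simp add: algebra_simps)
  have "(LINT y|lborel. \<eta> y * c y) - v = (LINT y|lborel. \<eta> y * c y) - (LINT y|lborel. v * \<eta> y)"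
    using assms(3) by simp
  also have "\<dots> = (LINT y|lborel. \<eta> y * (c y - v))"
    using i2 assms(1) by (subst Bochner_Integration.integral_diff[symmetric]) (auto simp: algebra_simps)
  finally have eq: "(LINT y|lborel. \<eta> y * c y) - v = (LINT y|lborel. \<eta> y * (c y - v))" .
  have "norm (LINT y|lborel. \<eta> y * (c y - v)) \<le> (LINT y|lborel. norm (\<eta> y * (c y - v)))"
    by (rule integral_norm_bound)
  also have "\<dots> \<le> (LINT y|lborel. e * \<eta> y)"
  proof (rule integral_mono)
    fix y show "norm (\<eta> y * (c y - v)) \<le> e * \<eta> y"
      using c(2)[of y] assms(2)[of y]
      by (cases "\<eta> y = 0") (auto simp: abs_mult mult.commute intro!: mult_right_mono)
  qed (use i assms(1) in auto)
  finally show "\<bar>(LINT y|lborel. \<eta> y * c y) - v\<bar> \<le> e"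
    using assms(3) eq by simp
qed

lemma conv_swap:
  fixes g k :: "'a::euclidean_space \<Rightarrow> real"
  assumes [measurable]: "g \<in> borel_measurable borel" "k \<in> borel_measurable borel"
  shows "(LINT y|lborel. g y * k (x - y)) = (LINT y|lborel. k y * g (x - y))"
  using lborel_integral_reflect[of "\<lambda>y. g y * k (x - y)" x] by (simp add: mult.commute)

text \<open>
  The second derivatives of the mollified functions are symmetric because one derivative can be put on
  each factor of the convolution; no general theorem on mixed partial derivatives is needed.
\<close>

lemma C1_approx_test:
  fixes \<phi> :: "'a::euclidean_space \<Rightarrow> real"
  assumes \<phi>: "C1_deriv \<phi> \<phi>'" and \<Omega>: "open \<Omega>" and S: "compact S" "S \<subseteq> \<Omega>" "\<And>x. x \<notin> S \<Longrightarrow> \<phi> x = 0"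
  obtains K B \<psi> where "compact K" "K \<subseteq> \<Omega>" "B \<ge> 0"
    "\<And>n. test_function \<Omega> (\<psi> n)"
    "\<And>(n::nat) x. x \<notin> K \<Longrightarrow> \<psi> n x = 0"
    "\<And>n x. \<bar>\<psi> n x\<bar> \<le> B"
    "\<And>n x b. b \<in> Basis \<Longrightarrow> \<bar>frechet_derivative (\<psi> n) (at x) b\<bar> \<le> B"
    "\<And>x. (\<lambda>n. \<psi> n x) \<longlonglongrightarrow> \<phi> x"
    "\<And>x b. b \<in> Basis \<Longrightarrow> (\<lambda>n. frechet_derivative (\<psi> n) (at x) b) \<longlonglongrightarrow> \<phi>' x b"
    "\<And>n x b c. b \<in> Basis \<Longrightarrow> c \<in> Basis \<Longrightarrow>
       frechet_derivative (\<lambda>y. frechet_derivative (\<psi> n) (at y) b) (at x) c =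
       frechet_derivative (\<lambda>y. frechet_derivative (\<psi> n) (at y) c) (at x) b"
proof -
  note \<phi>c = C1_derivD(4)[OF \<phi>] and \<phi>'c = C1_derivD(2)[OF \<phi>]
  have \<phi>'0: "\<phi>' x h = 0" if "x \<notin> S" for x h
    by (rule has_derivative_zero_outside[OF C1_derivD(1)[OF \<phi>] compact_imp_closed[OF S(1)] S(3) that])
  obtain d where d: "d > 0" "\<And>x y. x \<in> S \<Longrightarrow> y \<in> - \<Omega> \<Longrightarrow> d \<le> dist x y"
    using separate_compact_closed[OF S(1), of "- \<Omega>"] \<Omega> S(2) by (force simp: closed_def)
  \<comment> \<open>Half of a separation constant, so that the \<open>e\<close>-neighbourhood
    \<open>K\<close> of \<open>S\<close>, which carries all approximants, stays inside
    \<open>\<Omega>\<close>.\<close>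
  define e where "e = d / 2"
  have e: "e > 0" using d by (simp add: e_def)
  define K where "K = (\<lambda>(a,b). a + b) ` (S \<times> cball 0 e)"
  have cK: "compact K"
    unfolding K_def split_beta
    by (intro compact_continuous_image compact_Times S compact_cball continuous_intros)
  have K\<Omega>: "K \<subseteq> \<Omega>"
  proof
    fix x assume "x \<in> K"
    then obtain a b where "x = a + b" "a \<in> S" "norm b \<le> e" by (auto simp: K_def)
    then have "dist a x < d" using d(1) by (simp add: e_def dist_norm)
    then show "x \<in> \<Omega>" using d(2)[OF \<open>a \<in> S\<close>, of x] by auto
  qed
  have inK: "x \<in> K" if "x - y \<in> S" "norm y \<le> e" for x y
    unfolding K_def using that by (intro image_eqI[where x="(x - y, y)"]) auto
  have "\<forall>n. \<exists>\<eta>::'a \<Rightarrow> real. (\<forall>k. Ck k \<eta>) \<and> (\<forall>x. \<eta> x \<ge> 0) \<and> (\<forall>x. norm x > e / real (Suc n) \<longrightarrow> \<eta> x = 0) \<and>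
    (LINT x|lborel. \<eta> x) = 1"
    using e by (intro allI bump_exists) auto
  then obtain \<eta> :: "nat \<Rightarrow> 'a \<Rightarrow> real" where \<eta>: "\<And>n k. Ck k (\<eta> n)" "\<And>n x. \<eta> n x \<ge> 0"
    "\<And>n x. norm x > e / real (Suc n) \<Longrightarrow> \<eta> n x = 0" "\<And>n. (LINT x|lborel. \<eta> n x) = 1"
    by metis
  have small: "norm x \<le> e / real (Suc n)" if "\<eta> n x \<noteq> 0" for n x
    using \<eta>(3) that by (meson not_le)
  have le_e: "e / real (Suc n) \<le> e" for n
    using e by (simp add: divide_le_eq)
  have \<eta>c: "continuous_on UNIV (\<eta> n)" for n
    using \<eta>(1)[of 0] by simp
  have \<eta>0: "\<eta> n x = 0" if "x \<notin> cball 0 e" for n x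
    using small[of n x] le_e[of n] that by (cases "\<eta> n x = 0") auto
  have \<eta>int: "integrable lborel (\<eta> n)" for n
    by (rule integrable_continuous_compact_support[OF \<eta>c compact_cball \<eta>0])
  have \<phi>int: "integrable lborel \<phi>"
    by (rule integrable_continuous_compact_support[OF \<phi>c S(1,3)])
  have \<phi>'int: "integrable lborel (\<lambda>x. \<phi>' x h)" for h
    by (rule integrable_continuous_compact_support[OF \<phi>'c S(1) \<phi>'0])
  note meas = borel_measurable_continuous_onI[OF \<phi>c] borel_measurable_continuous_onI[OF \<phi>'c]
    borel_measurable_continuous_onI[OF \<eta>c] borel_measurable_continuous_onI[OF C1_derivD(2)[OF smooth_C1_deriv[OF \<eta>(1)]]]
  define \<psi> where "\<psi> n x = (LINT y|lborel. \<phi> y * \<eta> n (x - y))" for n x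
  have \<psi>2: "\<psi> n x = (LINT y|lborel. \<eta> n y * \<phi> (x - y))" for n x
    unfolding \<psi>_def by (rule conv_swap[OF meas(1,3)])
  have \<psi>sm: "Ck k (\<psi> n)" for n k
    unfolding \<psi>_def[abs_def] by (rule Ck_conv[OF \<phi>int S(1) S(3) \<eta>(1)])
  \<comment> \<open>The derivative of \<open>\<psi> n\<close> is needed in two forms: on
    \<open>\<phi>\<close>, where bounds uniform in \<open>n\<close> and limits are available, and on
    \<open>\<eta> n\<close> (fact \<open>C1\<close>), which leaves \<open>\<phi>\<close> free for a
    second differentiation.\<close>
  have C2: "C1_deriv (\<psi> n) (\<lambda>x h. LINT y|lborel. \<eta> n y * \<phi>' (x - y) h)" for n
    unfolding \<psi>2[abs_def] by (rule conv_C1_deriv[OF \<eta>int compact_cball \<eta>0 \<phi>])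
  have C1: "C1_deriv (\<psi> n) (\<lambda>x h. LINT y|lborel. \<phi> y * frechet_derivative (\<eta> n) (at (x - y)) h)" for n
    unfolding \<psi>_def[abs_def] by (rule conv_C1_deriv[OF \<phi>int S(1) S(3) smooth_C1_deriv[OF \<eta>(1)]])
  have fr2: "frechet_derivative (\<psi> n) (at x) h = (LINT y|lborel. \<eta> n y * \<phi>' (x - y) h)" for n x h
    using frechet_derivative_at[OF C1_derivD(1)[OF C2]] by metis
  have fr1: "frechet_derivative (\<psi> n) (at x) h = (LINT y|lborel. \<phi> y * frechet_derivative (\<eta> n) (at (x - y)) h)" for n x h
    using frechet_derivative_at[OF C1_derivD(1)[OF C1]] by metis
  have avg: "(\<lambda>n. LINT y|lborel. \<eta> n y * c (x - y)) \<longlonglongrightarrow> c x" "\<bar>LINT y|lborel. \<eta> n y * c (x - y)\<bar> \<le> C"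
    if c: "continuous_on UNIV c" and C: "\<And>x. \<bar>c x\<bar> \<le> C" for c :: "'a \<Rightarrow> real" and C x n
  proof -
    have cm [measurable]: "c \<in> borel_measurable borel"
      by (rule borel_measurable_continuous_onI[OF c])
    show "\<bar>LINT y|lborel. \<eta> n y * c (x - y)\<bar> \<le> C"
      using average_bound(2)[OF \<eta>int[of n] \<eta>(2) \<eta>(4), of "\<lambda>y. c (x - y)" 0 C] C by simp
    show "(\<lambda>n. LINT y|lborel. \<eta> n y * c (x - y)) \<longlonglongrightarrow> c x"
    proof (rule LIMSEQ_I)
      fix r :: real assume "r > 0"
      have "isCont c x" using c by (simp add: continuous_on_eq_continuous_at)
      then obtain s where s: "s > 0" "\<And>y. norm (y - x) < s \<Longrightarrow> norm (c y - c x) < r / 2"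
        using \<open>r > 0\<close> unfolding continuous_at_eps_delta dist_norm by (meson half_gt_zero)
      obtain N where N: "e / s < real (Suc N)"
        by (meson lessI less_trans of_nat_less_iff reals_Archimedean2)
      show "\<exists>no. \<forall>n\<ge>no. norm ((LINT y|lborel. \<eta> n y * c (x - y)) - c x) < r"
      proof (intro exI[of _ N] allI impI)
        fix n assume "N \<le> n"
        then have "e / s < real (Suc n)" using N by (auto intro: less_le_trans)
        then have "e / real (Suc n) < s" using s(1) by (simp add: field_simps)
        then have "\<bar>(LINT y|lborel. \<eta> n y * c (x - y)) - c x\<bar> \<le> r / 2"
        proof (intro average_bound(2)[OF \<eta>int[of n] \<eta>(2) \<eta>(4)])
          fix y assume "\<eta> n y \<noteq> 0"
          then have "norm (x - y - x) < s"
            using small[of n y] \<open>e / real (Suc n) < s\<close> by simp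
          then show "\<bar>c (x - y) - c x\<bar> \<le> r / 2"
            using s(2)[of "x - y"] by simp
        qed measurable
        then show "norm ((LINT y|lborel. \<eta> n y * c (x - y)) - c x) < r"
          using \<open>r > 0\<close> by simp
      qed
    qed
  qed
  obtain B0 where B0: "B0 \<ge> 0" "\<And>x. norm (\<phi> x) \<le> B0"
    using continuous_compact_support_bounded[OF \<phi>c S(1,3)] by metis
  have "\<forall>b. \<exists>B. B \<ge> 0 \<and> (\<forall>x. norm (\<phi>' x b) \<le> B)"
    using continuous_compact_support_bounded[OF \<phi>'c S(1) \<phi>'0] by metis
  then obtain B1 :: "'a \<Rightarrow> real" where B1: "\<And>b. B1 b \<ge> 0" "\<And>b x. norm (\<phi>' x b) \<le> B1 b" by metis
  define B where "B = B0 + (\<Sum>b\<in>Basis. B1 b)"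
  have BB: "B0 \<le> B" "\<And>b. b \<in> Basis \<Longrightarrow> B1 b \<le> B"
    using B0(1) B1(1) by (auto simp: B_def intro!: sum_nonneg add_increasing member_le_sum)
  have \<psi>0: "\<psi> n x = 0" if "x \<notin> K" for n x
  proof -
    have "\<eta> n y * \<phi> (x - y) = 0" for y
      using inK[of x y] small[of n y] order_trans[OF _ le_e[of n], of "norm y"] S(3)[of "x - y"] that
      by (cases "\<eta> n y = 0") auto
    then have "(LINT y|lborel. \<eta> n y * \<phi> (x - y)) = (LINT y|(lborel :: 'a measure). (0::real))"
      by (intro Bochner_Integration.integral_cong refl)
    then show ?thesis unfolding \<psi>2 by simp
  qed
  show ?thesis
  proof (rule that)
    show "compact K" "K \<subseteq> \<Omega>" by fact+
    show "\<psi> n x = 0" if "x \<notin> K" for n x by (rule \<psi>0[OF that])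
    show "B \<ge> 0" using BB(1) B0(1) by simp
    have "closure {x. \<psi> n x \<noteq> 0} \<subseteq> K" for n
      using \<psi>0 by (intro closure_minimal compact_imp_closed cK) auto
    moreover from this have "compact (closure {x. \<psi> n x \<noteq> 0})" for n
      using compact_Int_closed[OF cK closed_closure[of "{x. \<psi> n x \<noteq> 0}"]] by (simp add: inf.absorb2)
    ultimately show "test_function \<Omega> (\<psi> n)" for n
      unfolding test_function_def using \<psi>sm K\<Omega> by blast
    show "\<bar>\<psi> n x\<bar> \<le> B" for n x
      unfolding \<psi>2 using B0 BB(1) by (intro avg(2)[OF \<phi>c]) (auto intro: order_trans)
    show "\<bar>frechet_derivative (\<psi> n) (at x) b\<bar> \<le> B" if "b \<in> Basis" for n x b
      unfolding fr2 using B1 BB(2)[OF that] by (intro avg(2)[OF \<phi>'c]) (auto intro: order_trans)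
    show "(\<lambda>n. \<psi> n x) \<longlonglongrightarrow> \<phi> x" for x
      unfolding \<psi>2 using B0 by (intro avg(1)[OF \<phi>c, of B0]) auto
    show "(\<lambda>n. frechet_derivative (\<psi> n) (at x) b) \<longlonglongrightarrow> \<phi>' x b" for x and b :: 'a
      unfolding fr2 using B1 by (intro avg(1)[OF \<phi>'c, where C="B1 b"]) auto
    show "frechet_derivative (\<lambda>y. frechet_derivative (\<psi> n) (at y) b) (at x) c =
       frechet_derivative (\<lambda>y. frechet_derivative (\<psi> n) (at y) c) (at x) b"
      if bc: "b \<in> Basis" "c \<in> Basis" for n x b c
    proof -
      have eq1: "(\<lambda>y. frechet_derivative (\<psi> n) (at y) b) = (\<lambda>y. LINT t|lborel. \<phi>' t b * \<eta> n (y - t))"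
        unfolding fr2 by (intro ext conv_swap meas)
      have "C1_deriv (\<lambda>y. LINT t|lborel. \<phi>' t b * \<eta> n (y - t))
          (\<lambda>y h. LINT t|lborel. \<phi>' t b * frechet_derivative (\<eta> n) (at (y - t)) h)"
        by (rule conv_C1_deriv[OF \<phi>'int S(1) \<phi>'0 smooth_C1_deriv[OF \<eta>(1)]])
      note 1 = fun_cong[OF frechet_derivative_at[OF C1_derivD(1)[OF this, of x], symmetric], of c]
      have d0: "frechet_derivative (\<eta> n) (at x) c = 0" if "x \<notin> cball 0 e" for x
        by (rule has_derivative_zero_outside[OF C1_derivD(1)[OF smooth_C1_deriv[OF \<eta>(1)]] closed_cball \<eta>0 that])
      have eq2: "(\<lambda>y. frechet_derivative (\<psi> n) (at y) c) = (\<lambda>y. LINT t|lborel. frechet_derivative (\<eta> n) (at t) c * \<phi> (y - t))"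
        unfolding fr1 by (intro ext conv_swap meas)
      have "C1_deriv (\<lambda>y. LINT t|lborel. frechet_derivative (\<eta> n) (at t) c * \<phi> (y - t))
          (\<lambda>y h. LINT t|lborel. frechet_derivative (\<eta> n) (at t) c * \<phi>' (y - t) h)"
        by (rule conv_C1_deriv[OF integrable_continuous_compact_support[OF C1_derivD(2)[OF smooth_C1_deriv[OF \<eta>(1)]] compact_cball d0] compact_cball d0 \<phi>])
      note 2 = fun_cong[OF frechet_derivative_at[OF C1_derivD(1)[OF this, of x], symmetric], of b]
      show ?thesis
        unfolding eq1 eq2 1 2 by (rule conv_swap[OF meas(2,4)])
    qed
  qed
qed

lemma frechet_derivative_eq_sum:
  fixes f :: "'a::euclidean_space \<Rightarrow> real"
  assumes "f differentiable (at x)"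
  shows "frechet_derivative f (at x) h = (\<Sum>b\<in>Basis. (h \<bullet> b) * frechet_derivative f (at x) b)"
  using linear_Basis_expand[OF linear_frechet_derivative[OF assms], of h] by (simp only: real_scaleR_def)

lemma inner_grad:
  assumes "f differentiable (at x)"
  shows "v \<bullet> grad f x = frechet_derivative f (at x) v"
  unfolding grad_def inner_sum_right inner_scaleR_right frechet_derivative_eq_sum[OF assms, of v]
  by (intro sum.cong refl mult.commute)

text \<open>Recorded as a property of the test function because the curl identity is obtained by
  exchanging two derivatives of it; the approximants of \<open>C1_approx_test\<close> have this
  property.\<close>

definition symmetric_hessian :: "('a::euclidean_space \<Rightarrow> real) \<Rightarrow> bool" where
  "symmetric_hessian \<psi> \<longleftrightarrow> (\<forall>x. \<forall>b\<in>Basis. \<forall>c\<in>Basis.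
     frechet_derivative (\<lambda>y. frechet_derivative \<psi> (at y) b) (at x) c =
     frechet_derivative (\<lambda>y. frechet_derivative \<psi> (at y) c) (at x) b)"

text \<open>Dominated convergence along the approximants of \<open>C1_approx_test\<close>, which
  have a common compact support and common bounds; hence local integrability of \<open>V\<close> and
  \<open>q\<close> suffices. The pair \<open>V\<close>, \<open>q\<close> is kept general so that the
  gradient, divergence and curl identities are all extended to \<open>C^1\<close> functions by the
  same argument.\<close>

lemma weak_identity_C1:
  fixes V :: "'a::euclidean_space \<Rightarrow> 'a" and q \<phi> :: "'a \<Rightarrow> real"
  assumes \<Omega>: "open \<Omega>" and [measurable]: "V \<in> borel_measurable borel" "q \<in> borel_measurable borel"
    and Vi: "\<And>K. compact K \<Longrightarrow> K \<subseteq> \<Omega> \<Longrightarrow> set_integrable lborel K V"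
    and qi: "\<And>K. compact K \<Longrightarrow> K \<subseteq> \<Omega> \<Longrightarrow> set_integrable lborel K q"
    and test: "\<And>\<psi>. test_function \<Omega> \<psi> \<Longrightarrow> symmetric_hessian \<psi> \<Longrightarrow>
      (LINT x|lborel. frechet_derivative \<psi> (at x) (V x) + q x * \<psi> x) = 0"
    and \<phi>: "C1_deriv \<phi> \<phi>'" and S: "compact S" "S \<subseteq> \<Omega>" "\<And>x. x \<notin> S \<Longrightarrow> \<phi> x = 0"
  shows "integrable lborel (\<lambda>x. \<phi>' x (V x) + q x * \<phi> x)" "(LINT x|lborel. \<phi>' x (V x) + q x * \<phi> x) = 0"
proof -
  obtain K B \<psi> where K: "compact K" "K \<subseteq> \<Omega>" "B \<ge> 0"
    and \<psi>: "\<And>n. test_function \<Omega> (\<psi> n)"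
    "\<And>(n::nat) x. x \<notin> K \<Longrightarrow> \<psi> n x = 0"
    "\<And>n x. \<bar>\<psi> n x\<bar> \<le> B"
    "\<And>n x b. b \<in> Basis \<Longrightarrow> \<bar>frechet_derivative (\<psi> n) (at x) b\<bar> \<le> B"
    "\<And>x. (\<lambda>n. \<psi> n x) \<longlonglongrightarrow> \<phi> x"
    "\<And>x b. b \<in> Basis \<Longrightarrow> (\<lambda>n. frechet_derivative (\<psi> n) (at x) b) \<longlonglongrightarrow> \<phi>' x b"
    "\<And>n x b c. b \<in> Basis \<Longrightarrow> c \<in> Basis \<Longrightarrow>
       frechet_derivative (\<lambda>y. frechet_derivative (\<psi> n) (at y) b) (at x) c =
       frechet_derivative (\<lambda>y. frechet_derivative (\<psi> n) (at y) c) (at x) b"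
    proof (rule C1_approx_test[OF \<phi> \<Omega> S(1,2)])
      show "\<phi> x = 0" if "x \<notin> S" for x by (rule S(3)[OF that])
    next
      fix K B \<psi>
      assume h0: "compact K"
      and h1: "K \<subseteq> \<Omega>"
      and h2: "B \<ge> 0"
      and h3: "\<And>n. test_function \<Omega> (\<psi> n)"
      and h4: "\<And>(n::nat) x. x \<notin> K \<Longrightarrow> \<psi> n x = 0"
      and h5: "\<And>n x. \<bar>\<psi> n x\<bar> \<le> B"
      and h6: "\<And>n x b. b \<in> Basis \<Longrightarrow> \<bar>frechet_derivative (\<psi> n) (at x) b\<bar> \<le> B"
      and h7: "\<And>x. (\<lambda>n. \<psi> n x) \<longlonglongrightarrow> \<phi> x"
      and h8: "\<And>x b. b \<in> Basis \<Longrightarrow> (\<lambda>n. frechet_derivative (\<psi> n) (at x) b) \<longlonglongrightarrow> \<phi>' x b"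
      and h9: "\<And>n x b c. b \<in> Basis \<Longrightarrow> c \<in> Basis \<Longrightarrow>
       frechet_derivative (\<lambda>y. frechet_derivative (\<psi> n) (at y) b) (at x) c =
       frechet_derivative (\<lambda>y. frechet_derivative (\<psi> n) (at y) c) (at x) b"
      show thesis
        by (rule that[OF h0 h1 h2 h3 h4 h5 h6 h7 h8 h9])
    qed
  have C\<psi>: "C1_deriv (\<psi> n) (\<lambda>x. frechet_derivative (\<psi> n) (at x))" for n
    using \<psi>(1) by (intro smooth_C1_deriv) (auto simp: test_function_def)
  note D\<psi> = C1_derivD(1)[OF C\<psi>]
  have [measurable]: "(\<lambda>x. frechet_derivative (\<psi> n) (at x) b) \<in> borel_measurable borel" "\<psi> n \<in> borel_measurable borel" for n b
    using C1_derivD(2,4)[OF C\<psi>] borel_measurable_continuous_onI by blast+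
  have [measurable]: "(\<lambda>x. \<phi>' x b) \<in> borel_measurable borel" "\<phi> \<in> borel_measurable borel" for b
    using C1_derivD(2,4)[OF \<phi>] borel_measurable_continuous_onI by blast+
  have e1: "frechet_derivative (\<psi> n) (at x) (V x) = (\<Sum>b\<in>Basis. (V x \<bullet> b) * frechet_derivative (\<psi> n) (at x) b)" for n x
    using D\<psi> by (intro frechet_derivative_eq_sum) (auto simp: differentiable_def)
  have e2: "\<phi>' x (V x) = (\<Sum>b\<in>Basis. (V x \<bullet> b) * \<phi>' x b)" for x
    using linear_Basis_expand[OF C1_derivD(3)[OF \<phi>], of x "V x"] by (simp only: real_scaleR_def)
  have z: "frechet_derivative (\<psi> n) (at x) h = 0" if "x \<notin> K" for n x h
    by (rule has_derivative_zero_outside[OF D\<psi> compact_imp_closed[OF K(1)] \<psi>(2) that])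
  define w where "w x = real DIM('a) * B * norm (indicator K x *\<^sub>R V x) + B * norm (indicator K x *\<^sub>R q x)" for x
  have w: "integrable lborel w"
    unfolding w_def using Vi[OF K(1,2)] qi[OF K(1,2)] unfolding set_integrable_def
    by (intro Bochner_Integration.integrable_add integrable_mult_right integrable_norm)
  have m1: "(\<lambda>x. \<phi>' x (V x) + q x * \<phi> x) \<in> borel_measurable lborel"
    unfolding e2 by measurable
  have m2: "(\<lambda>x. frechet_derivative (\<psi> n) (at x) (V x) + q x * \<psi> n x) \<in> borel_measurable lborel" for n
    unfolding e1 by measurable
  have lim: "AE x in lborel. (\<lambda>n. frechet_derivative (\<psi> n) (at x) (V x) + q x * \<psi> n x) \<longlonglongrightarrow> \<phi>' x (V x) + q x * \<phi> x"
    unfolding e1 e2 by (intro AE_I2 tendsto_add tendsto_sum tendsto_mult tendsto_const \<psi>(5,6))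
  have bd: "AE x in lborel. norm (frechet_derivative (\<psi> n) (at x) (V x) + q x * \<psi> n x) \<le> w x" for n
  proof (rule AE_I2)
    fix x
    show "norm (frechet_derivative (\<psi> n) (at x) (V x) + q x * \<psi> n x) \<le> w x"
    proof (cases "x \<in> K")
      case True
      have "norm (frechet_derivative (\<psi> n) (at x) (V x)) \<le> real DIM('a) * B * norm (V x)"
        by (rule linear_norm_le_Basis[OF C1_derivD(3)[OF C\<psi>]]) (use \<psi>(4) in auto)
      moreover have "\<bar>q x * \<psi> n x\<bar> \<le> B * \<bar>q x\<bar>"
        using mult_right_mono[OF \<psi>(3)[of n x], of "\<bar>q x\<bar>"] by (simp add: abs_mult mult.commute)
      ultimately show ?thesis using True by (simp add: w_def)
    qed (simp add: z \<psi>(2) w_def)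
  qed
  have "(\<lambda>n. LINT x|lborel. frechet_derivative (\<psi> n) (at x) (V x) + q x * \<psi> n x) \<longlonglongrightarrow> (LINT x|lborel. \<phi>' x (V x) + q x * \<phi> x)"
    by (rule integral_dominated_convergence[OF m1 m2 w lim bd])
  moreover have "(LINT x|lborel. frechet_derivative (\<psi> n) (at x) (V x) + q x * \<psi> n x) = 0" for n
    using \<psi>(7) by (intro test \<psi>(1)) (simp add: symmetric_hessian_def)
  ultimately show "(LINT x|lborel. \<phi>' x (V x) + q x * \<phi> x) = 0"
    by (simp add: LIMSEQ_const_iff)
  show "integrable lborel (\<lambda>x. \<phi>' x (V x) + q x * \<phi> x)"
    by (rule integrable_dominated_convergence[OF m1 m2 w lim bd])
qed

section \<open>Approximation of the identity\<close>

lemma lborel_integral_translate: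
  fixes f :: "'a::euclidean_space \<Rightarrow> 'b::{banach, second_countable_topology}"
  assumes [measurable]: "f \<in> borel_measurable borel"
  shows "(LINT x|lborel. f (x - t)) = (LINT x|lborel. f x)"
proof -
  have "(LINT x|lborel. f (- t + x)) = (LINT x|distr lborel borel ((+) (- t)). f x)"
    by (subst integral_distr) auto
  then show ?thesis
    unfolding lborel_distr_plus by simp
qed

lemma lborel_integrable_translate:
  fixes f :: "'a::euclidean_space \<Rightarrow> 'b::{banach, second_countable_topology}"
  assumes "integrable lborel f"
  shows "integrable lborel (\<lambda>x. f (x - t))"
proof -
  have [measurable]: "f \<in> borel_measurable borel" using assms by auto
  have "integrable (distr lborel borel ((+) (- t))) f"
    using assms unfolding lborel_distr_plus .
  then show ?thesis by (subst (asm) integrable_distr_eq) auto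
qed

text \<open>Induction over integrable functions. The indicator of an open set is treated directly, a
  Borel set is approximated by an open superset, sums use the triangle inequality, and for limits
  the approximation error is translation invariant.\<close>

lemma L1_translation_continuous:
  fixes g :: "'a::euclidean_space \<Rightarrow> 'b::{banach, second_countable_topology}"
  assumes "integrable lborel g" "t \<longlonglongrightarrow> 0"
  shows "(\<lambda>n. LINT x|lborel. norm (g (x - t n) - g x)) \<longlonglongrightarrow> 0"
  using assms(1)
proof (induction rule: integrable_induct)
  case (base A c)
  have A [measurable]: "A \<in> sets borel" using base by simp
  define a where "a S x = indicat_real S x" for S and x :: 'a
  have ia: "integrable lborel (a S)" if "S \<in> sets borel" "emeasure lborel S < \<infinity>" for S
    unfolding a_def using that by (auto simp: integrable_indicator_iff)
  have open_case: "(\<lambda>n. LINT x|lborel. \<bar>a U (x - t n) - a U x\<bar>) \<longlonglongrightarrow> 0"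
    if U: "open U" "emeasure lborel U < \<infinity>" for U
  proof -
    have [measurable]: "U \<in> sets borel" using U by auto
    have iU: "integrable lborel (a U)" by (rule ia) (use U in auto)
    have am [measurable]: "a U \<in> borel_measurable borel" using iU by auto
    have ineq: "integrable lborel (\<lambda>x. max 0 (a U x - a U (x - s)))" for s
      by (rule Bochner_Integration.integrable_bound[OF iU]) (auto simp: a_def indicator_def)
    \<comment> \<open>Both indicators have the same integral, so the positive and negative parts of
      their difference have equal mass. The part retained tends to 0 pointwise because a point of
      the open set stays inside it under small translations; boundary points cause no
      trouble.\<close>
    have "(LINT x|lborel. \<bar>a U (x - s) - a U x\<bar>) = 2 * (LINT x|lborel. max 0 (a U x - a U (x - s)))" for s
    proof -
      have "(LINT x|lborel. \<bar>a U (x - s) - a U x\<bar>) =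
          (LINT x|lborel. 2 * max 0 (a U x - a U (x - s)) + (a U (x - s) - a U x))"
        by (intro Bochner_Integration.integral_cong) (auto simp: max_def)
      also have "\<dots> = 2 * (LINT x|lborel. max 0 (a U x - a U (x - s))) + ((LINT x|lborel. a U (x - s)) - (LINT x|lborel. a U x))"
        using ineq iU lborel_integrable_translate[OF iU, of s] by simp
      finally show ?thesis
        by (simp add: lborel_integral_translate)
    qed
    moreover have "(\<lambda>n. LINT x|lborel. max 0 (a U x - a U (x - t n))) \<longlonglongrightarrow> (LINT x|(lborel :: 'a measure). 0)"
    proof (rule integral_dominated_convergence[OF _ _ iU])
      show "AE x in lborel. (\<lambda>n. max 0 (a U x - a U (x - t n))) \<longlonglongrightarrow> 0"
      proof (rule AE_I2)
        fix x
        show "(\<lambda>n. max 0 (a U x - a U (x - t n))) \<longlonglongrightarrow> 0"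
        proof (cases "x \<in> U")
          case True
          have "(\<lambda>n. x - t n) \<longlonglongrightarrow> x - 0" by (intro tendsto_intros assms(2))
          then have "\<forall>\<^sub>F n in sequentially. x - t n \<in> U"
            using U(1) True by (simp add: topological_tendstoD)
          then show ?thesis
            by (intro tendsto_eventually) (auto elim!: eventually_mono simp: a_def True)
        qed (simp add: a_def)
      qed
    qed (auto simp: a_def indicator_def)
    ultimately show ?thesis
      using tendsto_mult_right_zero by auto
  qed
  have "(\<lambda>n. LINT x|lborel. \<bar>a A (x - t n) - a A x\<bar>) \<longlonglongrightarrow> 0"
  proof (rule LIMSEQ_I)
    fix r :: real assume "r > 0"
    \<comment> \<open>The tolerance \<open>r / 4\<close> is spent twice, on \<open>U - A\<close> and
      on its translate; the remaining \<open>r / 2\<close> goes to the open set.\<close>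
    obtain U where U: "open U" "A \<subseteq> U" "emeasure lborel (U - A) < ennreal (r / 4)"
      using outer_regular_lborel[OF A, of "r/4"] \<open>r > 0\<close> by auto
    have [measurable]: "U \<in> sets borel" using U by auto
    have finD: "emeasure lborel (U - A) < \<infinity>"
      using U(3) by (auto intro: less_trans)
    have "emeasure lborel U \<le> emeasure lborel A + emeasure lborel (U - A)"
      using U(2) by (intro order_trans[OF _ emeasure_subadditive] emeasure_mono) auto
    also have "\<dots> < \<infinity>" using base finD by auto
    finally have finU: "emeasure lborel U < \<infinity>" .
    have iU: "integrable lborel (a U)" and iA: "integrable lborel (a A)" and iD: "integrable lborel (a (U - A))"
      using finU finD base by (auto intro!: ia)
    have am [measurable]: "a U \<in> borel_measurable borel" "a A \<in> borel_measurable borel" "a (U - A) \<in> borel_measurable borel"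
      using iU iA iD by auto
    have D: "(LINT x|lborel. a (U - A) x) < r / 4"
    proof -
      have "measure lborel (U - A) < r / 4"
        using U(3) \<open>r > 0\<close> finD by (simp add: emeasure_eq_ennreal_measure ennreal_less_iff)
      then show ?thesis by (simp add: a_def)
    qed
    obtain N where N: "\<And>n. n \<ge> N \<Longrightarrow> \<bar>LINT x|lborel. \<bar>a U (x - t n) - a U x\<bar>\<bar> < r / 2"
      using LIMSEQ_D[OF open_case[OF U(1) finU], of "r/2"] \<open>r > 0\<close> by auto
    note tr = lborel_integrable_translate
    show "\<exists>no. \<forall>n\<ge>no. norm ((LINT x|lborel. \<bar>a A (x - t n) - a A x\<bar>) - 0) < r"
    proof (intro exI[of _ N] allI impI)
      fix n assume "n \<ge> N"
      have "(LINT x|lborel. \<bar>a A (x - t n) - a A x\<bar>) \<le>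
        (LINT x|lborel. \<bar>a U (x - t n) - a U x\<bar> + (a (U - A) (x - t n) + a (U - A) x))"
      proof (rule integral_mono)
        show "integrable lborel (\<lambda>x. \<bar>a A (x - t n) - a A x\<bar>)"
          by (intro integrable_abs Bochner_Integration.integrable_diff tr iA)
        show "integrable lborel (\<lambda>x. \<bar>a U (x - t n) - a U x\<bar> + (a (U - A) (x - t n) + a (U - A) x))"
          by (intro integrable_abs Bochner_Integration.integrable_diff Bochner_Integration.integrable_add tr iA iU iD)
      qed (use U(2) in \<open>auto simp: a_def indicator_def\<close>)
      also have "\<dots> = (LINT x|lborel. \<bar>a U (x - t n) - a U x\<bar>) + ((LINT x|lborel. a (U - A) (x - t n)) + (LINT x|lborel. a (U - A) x))"
        using tr[OF iU, of "t n"] tr[OF iD, of "t n"] iU iD by simp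
      also have "(LINT x|lborel. a (U - A) (x - t n)) = (LINT x|lborel. a (U - A) x)"
        by (simp add: lborel_integral_translate)
      finally have "(LINT x|lborel. \<bar>a A (x - t n) - a A x\<bar>) < r"
        using N[OF \<open>n \<ge> N\<close>] D by linarith
      moreover have "(LINT x|lborel. \<bar>a A (x - t n) - a A x\<bar>) \<ge> 0" by simp
      ultimately show "norm ((LINT x|lborel. \<bar>a A (x - t n) - a A x\<bar>) - 0) < r" by simp
    qed
  qed
  then have "(\<lambda>n. (LINT x|lborel. \<bar>a A (x - t n) - a A x\<bar>) * norm c) \<longlonglongrightarrow> 0"
    by (rule tendsto_mult_left_zero)
  moreover have "norm (indicat_real A (x - t n) *\<^sub>R c - indicat_real A x *\<^sub>R c) = \<bar>a A (x - t n) - a A x\<bar> * norm c" for x n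
    by (simp add: a_def scaleR_diff_left[symmetric])
  ultimately show ?case by simp
next
  case (add f g)
  note tr = lborel_integrable_translate
  show ?case
  proof (rule tendsto_sandwich[OF _ _ tendsto_const])
    show "(\<lambda>n. (LINT x|lborel. norm (f (x - t n) - f x)) + (LINT x|lborel. norm (g (x - t n) - g x))) \<longlonglongrightarrow> 0"
      using tendsto_add[OF add(3,4)] by simp
    show "\<forall>\<^sub>F n in sequentially. (LINT x|lborel. norm (f (x - t n) + g (x - t n) - (f x + g x)))
      \<le> (LINT x|lborel. norm (f (x - t n) - f x)) + (LINT x|lborel. norm (g (x - t n) - g x))"
    proof (intro always_eventually allI)
      fix n
      have i: "integrable lborel (\<lambda>x. f (x - t n) - f x)" "integrable lborel (\<lambda>x. g (x - t n) - g x)"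
        by (intro Bochner_Integration.integrable_diff tr add(1,2))+
      have "(LINT x|lborel. norm (f (x - t n) + g (x - t n) - (f x + g x))) =
        (LINT x|lborel. norm ((f (x - t n) - f x) + (g (x - t n) - g x)))"
        by (simp add: algebra_simps)
      also have "\<dots> \<le> (LINT x|lborel. norm (f (x - t n) - f x) + norm (g (x - t n) - g x))"
        using i by (intro integral_mono norm_triangle_ineq) auto
      finally show "(LINT x|lborel. norm (f (x - t n) + g (x - t n) - (f x + g x)))
        \<le> (LINT x|lborel. norm (f (x - t n) - f x)) + (LINT x|lborel. norm (g (x - t n) - g x))"
        using i by simp
    qed
  qed (auto intro!: always_eventually)
next
  case (lim f s)
  note tr = lborel_integrable_translate
  have [measurable]: "f \<in> borel_measurable borel" "s i \<in> borel_measurable borel" for i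
    using lim(1)[of i] lim.hyps(4) by auto
  have conv: "(\<lambda>i. LINT x|lborel. norm (s i x - f x)) \<longlonglongrightarrow> (LINT x|(lborel::'a measure). 0)"
  proof (rule integral_dominated_convergence[where w="\<lambda>x. 3 * norm (f x)"])
    show "AE x in lborel. (\<lambda>i. norm (s i x - f x)) \<longlonglongrightarrow> 0"
      using lim.hyps(2) by (intro AE_I2) (simp add: LIM_zero tendsto_norm_zero)
    show "AE x in lborel. norm (norm (s i x - f x)) \<le> 3 * norm (f x)" for i
    proof (rule AE_I2)
      fix x show "norm (norm (s i x - f x)) \<le> 3 * norm (f x)"
        using norm_triangle_ineq4[of "s i x" "f x"] lim.hyps(3)[of x i] by simp
    qed
  qed (use lim.hyps(4) in auto)
  show ?case
  proof (rule LIMSEQ_I)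
    fix r :: real assume "r > 0"
    obtain i where i: "(LINT x|lborel. norm (s i x - f x)) < r / 4"
      using LIMSEQ_D[OF conv, of "r/4"] \<open>r > 0\<close> by auto
    obtain N where N: "\<And>n. n \<ge> N \<Longrightarrow> \<bar>LINT x|lborel. norm (s i (x - t n) - s i x)\<bar> < r / 2"
      using LIMSEQ_D[OF lim.IH[of i], of "r/2"] \<open>r > 0\<close> by auto
    show "\<exists>no. \<forall>n\<ge>no. norm ((LINT x|lborel. norm (f (x - t n) - f x)) - 0) < r"
    proof (intro exI[of _ N] allI impI)
      fix n assume "n \<ge> N"
      have i1: "integrable lborel (\<lambda>x. norm (s i (x - t n) - s i x))"
        "integrable lborel (\<lambda>x. norm (s i x - f x))"
        by (intro integrable_norm Bochner_Integration.integrable_diff tr lim(1) lim.hyps(4))+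
      note i2 = tr[OF i1(2), of "t n"]
      have "(LINT x|lborel. norm (f (x - t n) - f x)) \<le>
        (LINT x|lborel. norm (s i (x - t n) - s i x) + (norm (s i (x - t n) - f (x - t n)) + norm (s i x - f x)))"
      proof (rule integral_mono)
        show "integrable lborel (\<lambda>x. norm (f (x - t n) - f x))"
          by (intro integrable_norm Bochner_Integration.integrable_diff tr lim.hyps(4))
        show "integrable lborel (\<lambda>x. norm (s i (x - t n) - s i x) + (norm (s i (x - t n) - f (x - t n)) + norm (s i x - f x)))"
          using i1 i2 by auto
        fix x
        have "f (x - t n) - f x = (s i (x - t n) - s i x) - (s i (x - t n) - f (x - t n)) + (s i x - f x)"
          by simp
        then show "norm (f (x - t n) - f x) \<le> norm (s i (x - t n) - s i x) + (norm (s i (x - t n) - f (x - t n)) + norm (s i x - f x))"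
          by (smt (verit) norm_triangle_ineq norm_triangle_ineq4)
      qed
      also have "\<dots> = (LINT x|lborel. norm (s i (x - t n) - s i x)) + ((LINT x|lborel. norm (s i (x - t n) - f (x - t n))) + (LINT x|lborel. norm (s i x - f x)))"
        using i1 i2 by simp
      also have "(LINT x|lborel. norm (s i (x - t n) - f (x - t n))) = (LINT x|lborel. norm (s i x - f x))"
        by (rule lborel_integral_translate[of "\<lambda>x. norm (s i x - f x)"]) measurable
      finally have "(LINT x|lborel. norm (f (x - t n) - f x)) < r"
        using N[OF \<open>n \<ge> N\<close>] i by linarith
      then show "norm ((LINT x|lborel. norm (f (x - t n) - f x)) - 0) < r" by simp
    qed
  qed
qed

section \<open>Lebesgue measure on the complex plane as a product measure\<close>

lemma lborel_complex_eq: "(lborel :: complex measure) = distr lborel borel (\<lambda>(x, y). Complex x y)"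
proof (rule lborel_eqI)
  have c: "continuous_on UNIV (\<lambda>p. Complex (fst p) (snd p))"
    unfolding Complex_eq by (intro continuous_intros)
  have [measurable]: "(\<lambda>(x, y). Complex x y) \<in> borel_measurable (borel :: (real \<times> real) measure)"
    using borel_measurable_continuous_onI[OF c] by (simp add: case_prod_beta')
  fix l u :: complex
  assume le: "\<And>b. b \<in> Basis \<Longrightarrow> l \<bullet> b \<le> u \<bullet> b"
  have "(\<lambda>(x, y). Complex x y) -` box l u = box (Re l, Im l) (Re u, Im u)"
    by (auto simp: box_def Basis_prod_def Basis_complex_def)
  then have "emeasure (distr lborel borel (\<lambda>(x, y). Complex x y)) (box l u) = emeasure lborel (box (Re l, Im l) (Re u, Im u))"
    by (subst emeasure_distr) (auto simp: space_lborel)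
  also have "\<dots> = ennreal ((Re u - Re l) * (Im u - Im l))"
    using le[of 1] le[of \<i>]
    by (simp add: emeasure_lborel_box_eq Basis_prod_def Basis_complex_def prod.union_disjoint)
  finally show "emeasure (distr lborel borel (\<lambda>(x, y). Complex x y)) (box l u) = (\<Prod>b\<in>Basis. (u - l) \<bullet> b)"
    by (simp add: Basis_complex_def)
qed simp

text \<open>The substitute for polar coordinates: radial integrals below are dominated by products
  of one-dimensional ones.\<close>

lemma nn_integral_complex_product:
  assumes [measurable]: "a \<in> borel_measurable borel" "b \<in> borel_measurable borel"
  shows "(\<integral>\<^sup>+z. a (Re z) * b (Im z) \<partial>lborel) = (\<integral>\<^sup>+x. a x \<partial>lborel) * (\<integral>\<^sup>+y. b y \<partial>lborel)"
proof -
  have c: "continuous_on UNIV (\<lambda>p. Complex (fst p) (snd p))"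
    unfolding Complex_eq by (intro continuous_intros)
  note [measurable] = borel_measurable_continuous_onI[OF c]
  have "(\<integral>\<^sup>+z. a (Re z) * b (Im z) \<partial>lborel) = (\<integral>\<^sup>+p. a (fst p) * b (snd p) \<partial>(lborel :: (real \<times> real) measure))"
    unfolding lborel_complex_eq case_prod_beta' by (subst nn_integral_distr) auto
  also have "\<dots> = (\<integral>\<^sup>+x. \<integral>\<^sup>+y. a x * b y \<partial>lborel \<partial>lborel)"
    unfolding lborel_prod[symmetric] by (subst lborel.nn_integral_fst[symmetric]) auto
  also have "\<dots> = (\<integral>\<^sup>+x. a x \<partial>lborel) * (\<integral>\<^sup>+y. b y \<partial>lborel)"
    by (simp add: nn_integral_cmult nn_integral_multc)
  finally show ?thesis .
qed

section \<open>The regularised Cauchy kernel\<close>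

text \<open>Twice the Wirtinger derivative with respect to the conjugate variable, as a functional
  of the real-linear differential \<open>L\<close>; it vanishes exactly when \<open>L\<close> is
  complex linear.\<close>

definition dbar :: "(complex \<Rightarrow> complex) \<Rightarrow> complex" where
  "dbar L = L 1 + \<i> * L \<i>"

text \<open>Since \<open>1 / z = cnj z / |z|^2\<close>, adding \<open>\<delta>\<^sup>2\<close> to
  the denominator gives a kernel that is \<open>C^1\<close> on the whole plane and never larger than
  \<open>1 / |z|\<close>.\<close>

definition reg_cauchy :: "real \<Rightarrow> complex \<Rightarrow> complex" where
  "reg_cauchy \<delta> z = cnj z * of_real (inverse (z \<bullet> z + \<delta>\<^sup>2))"

definition reg_cauchy' :: "real \<Rightarrow> complex \<Rightarrow> complex \<Rightarrow> complex" where
  "reg_cauchy' \<delta> z h = cnj z * of_real (- (inverse (z \<bullet> z + \<delta>\<^sup>2) * (2 * (z \<bullet> h)) * inverse (z \<bullet> z + \<delta>\<^sup>2)))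
     + cnj h * of_real (inverse (z \<bullet> z + \<delta>\<^sup>2))"

text \<open>The image of \<open>reg_cauchy \<delta>\<close> under \<open>dbar\<close>. It is
  positive and scales like an approximate identity: its value at \<open>\<delta> *\<^sub>R t\<close>
  is \<open>poisson2 1 t / \<delta>\<^sup>2\<close>.\<close>

definition poisson2 :: "real \<Rightarrow> complex \<Rightarrow> real" where
  "poisson2 \<delta> z = 2 * \<delta>\<^sup>2 * (inverse (z \<bullet> z + \<delta>\<^sup>2))\<^sup>2"

definition poisson2' :: "real \<Rightarrow> complex \<Rightarrow> complex \<Rightarrow> real" where
  "poisson2' \<delta> z h = - 8 * \<delta>\<^sup>2 * (z \<bullet> h) * (inverse (z \<bullet> z + \<delta>\<^sup>2)) ^ 3"

text \<open>The total mass, 2 pi in closed form, common to all \<open>poisson2 \<delta>\<close>. It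
  stays symbolic; positivity is what permits the division by it.\<close>

definition kap :: real where "kap = (LINT z|lborel. poisson2 1 z)"

lemma reg_pos: "\<delta> > 0 \<Longrightarrow> z \<bullet> z + \<delta>\<^sup>2 > (0::real)" for z :: complex
  by (simp add: add_nonneg_pos)

lemma inverse_sq_deriv:
  fixes z :: complex
  assumes "\<delta> > 0"
  shows "((\<lambda>z. inverse (z \<bullet> z + \<delta>\<^sup>2)) has_derivative
    (\<lambda>h. - (inverse (z \<bullet> z + \<delta>\<^sup>2) * (2 * (z \<bullet> h)) * inverse (z \<bullet> z + \<delta>\<^sup>2)))) (at z)"
  using reg_pos[OF assms, of z]
  by (intro Deriv.has_derivative_inverse) (auto intro!: derivative_eq_intros simp: inner_commute)

lemma reg_cauchy_C1:
  assumes "\<delta> > 0"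
  shows "C1_deriv (reg_cauchy \<delta>) (reg_cauchy' \<delta>)"
proof (rule C1_derivI)
  have ne: "z \<bullet> z + \<delta>\<^sup>2 \<noteq> 0" for z :: complex using reg_pos[OF assms, of z] by simp
  show "(reg_cauchy \<delta> has_derivative reg_cauchy' \<delta> z) (at z)" for z
    unfolding reg_cauchy_def[abs_def] reg_cauchy'_def
    by (rule has_derivative_mult bounded_linear.has_derivative[OF bounded_linear_cnj]
          bounded_linear.has_derivative[OF bounded_linear_of_real] inverse_sq_deriv[OF assms] has_derivative_ident)+
  show "continuous_on UNIV (\<lambda>z. reg_cauchy' \<delta> z b)" for b
    unfolding reg_cauchy'_def using ne by (intro continuous_intros) auto
qed

lemma poisson2_C1:
  assumes "\<delta> > 0"
  shows "C1_deriv (poisson2 \<delta>) (poisson2' \<delta>)"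
proof (rule C1_derivI)
  have ne: "z \<bullet> z + \<delta>\<^sup>2 \<noteq> 0" for z :: complex using reg_pos[OF assms, of z] by simp
  show "(poisson2 \<delta> has_derivative poisson2' \<delta> z) (at z)" for z
    unfolding poisson2_def[abs_def]
    by (rule has_derivative_eq_rhs, (rule derivative_eq_intros inverse_sq_deriv[OF assms] refl)+)
      (auto simp: poisson2'_def fun_eq_iff power2_eq_square power3_eq_cube)
  show "continuous_on UNIV (\<lambda>z. poisson2' \<delta> z b)" for b
    unfolding poisson2'_def using ne by (intro continuous_intros) auto
qed

text \<open>With \<open>m = |z|^2 + \<delta>^2\<close> the product rule gives
  \<open>2 / m - 2 |z|^2 / m^2\<close>, and \<open>|z|^2 = m - \<delta>^2\<close> leaves
  \<open>2 \<delta>^2 / m^2\<close>.\<close>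

lemma dbar_reg_cauchy:
  assumes "\<delta> > 0"
  shows "dbar (reg_cauchy' \<delta> z) = of_real (poisson2 \<delta> z)"
proof -
  define m where "m = z \<bullet> z + \<delta>\<^sup>2"
  have m: "m > 0" unfolding m_def by (rule reg_pos[OF assms])
  have zz: "z * cnj z = of_real (m - \<delta>\<^sup>2)"
    by (simp add: m_def complex_norm_square[symmetric] power2_norm_eq_inner[symmetric])
  have "dbar (reg_cauchy' \<delta> z) = 2 * of_real (inverse m) - 2 * (z * cnj z) * of_real (inverse m) ^ 2"
    unfolding dbar_def reg_cauchy'_def m_def[symmetric]
    by (simp add: algebra_simps power2_eq_square complex_eq_iff inner_complex_def)
  also have "\<dots> = of_real (2 * inverse m - 2 * (m - \<delta>\<^sup>2) * (inverse m)\<^sup>2)"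
    unfolding zz by simp
  also have "2 * inverse m - 2 * (m - \<delta>\<^sup>2) * (inverse m)\<^sup>2 = poisson2 \<delta> z"
    unfolding poisson2_def m_def[symmetric] using m by (simp add: field_simps power2_eq_square)
  finally show ?thesis .
qed

text \<open>The bound is uniform in \<open>\<delta>\<close> and serves as the dominating function
  for \<open>\<delta> \<longlonglongrightarrow> 0\<close>. At \<open>z = 0\<close> both sides are 0
  because \<open>inverse 0 = 0\<close>; the same convention makes \<open>reg_cauchy_tendsto\<close>
  true at the origin.\<close>

lemma norm_reg_cauchy_le: "norm (reg_cauchy \<delta> z) \<le> inverse (norm z)"
proof (cases "z = 0")
  case False
  have "norm (reg_cauchy \<delta> z) = norm z * inverse ((norm z)\<^sup>2 + \<delta>\<^sup>2)"
    unfolding reg_cauchy_def norm_mult norm_of_real complex_mod_cnj power2_norm_eq_inner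
    by (subst abs_of_nonneg) auto
  also have "\<dots> \<le> norm z * inverse ((norm z)\<^sup>2)"
    using False by (intro mult_left_mono le_imp_inverse_le) auto
  also have "\<dots> = inverse (norm z)"
    using False by (simp add: power2_eq_square)
  finally show ?thesis .
qed (simp add: reg_cauchy_def)

lemma reg_cauchy_tendsto:
  assumes "\<delta> \<longlonglongrightarrow> 0"
  shows "(\<lambda>n. reg_cauchy (\<delta> n) z) \<longlonglongrightarrow> inverse z"
proof (cases "z = 0")
  case False
  have "(\<lambda>n. reg_cauchy (\<delta> n) z) \<longlonglongrightarrow> cnj z * of_real (inverse (z \<bullet> z + 0\<^sup>2))"
    unfolding reg_cauchy_def by (intro tendsto_intros assms) (use False in auto)
  also have "cnj z * of_real (inverse (z \<bullet> z + 0\<^sup>2)) = inverse z"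
  proof -
    have "z * cnj z = of_real (z \<bullet> z)"
      by (simp add: complex_norm_square[symmetric] power2_norm_eq_inner[symmetric])
    moreover have "complex_of_real (z \<bullet> z) \<noteq> 0" using False by simp
    ultimately show ?thesis using False by (simp add: field_simps)
  qed
  finally show ?thesis .
qed (simp add: reg_cauchy_def)

lemma poisson2_bounds:
  assumes "\<delta> > 0"
  shows "0 \<le> poisson2 \<delta> z" "poisson2 \<delta> z \<le> 2 / \<delta>\<^sup>2"
proof -
  show "0 \<le> poisson2 \<delta> z" by (simp add: poisson2_def)
  have "inverse (z \<bullet> z + \<delta>\<^sup>2) \<le> inverse (\<delta>\<^sup>2)"
    using assms by (intro le_imp_inverse_le) auto
  then have "(inverse (z \<bullet> z + \<delta>\<^sup>2))\<^sup>2 \<le> (inverse (\<delta>\<^sup>2))\<^sup>2"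
    by (intro power_mono) auto
  then have "poisson2 \<delta> z \<le> 2 * \<delta>\<^sup>2 * (inverse (\<delta>\<^sup>2))\<^sup>2"
    unfolding poisson2_def by (intro mult_left_mono) auto
  then show "poisson2 \<delta> z \<le> 2 / \<delta>\<^sup>2"
    using assms by (simp add: power2_eq_square field_simps)
qed

lemma poisson2_measurable [measurable]: "poisson2 \<delta> \<in> borel_measurable borel"
  unfolding poisson2_def[abs_def] by measurable

lemma reg_cauchy_measurable [measurable]: "reg_cauchy \<delta> \<in> borel_measurable borel"
proof -
  have "continuous_on UNIV cnj" by (intro continuous_intros)
  note [measurable] = borel_measurable_continuous_onI[OF this]
  show ?thesis unfolding reg_cauchy_def[abs_def] by measurable
qed

text \<open>With \<open>x\<close> and \<open>y\<close> the real and imaginary parts,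
  \<open>(1 + x^2 + y^2)^2 \<ge> (1 + x^2) (1 + y^2)\<close> reduces the claim to the
  one-dimensional integral of \<open>1 / (1 + x^2)\<close>.\<close>

lemma integrable_poisson2_1: "integrable lborel (poisson2 1)"
proof -
  define b where "b x = ennreal (inverse (1 + x\<^sup>2))" for x :: real
  have [measurable]: "b \<in> borel_measurable borel" unfolding b_def by measurable
  have "einterval (-\<infinity>) \<infinity> = UNIV" by (auto simp: einterval_def)
  then have "integrable lborel (\<lambda>x::real. inverse (1 + x\<^sup>2))"
    using integrable_inverse_1_plus_square by (simp add: set_integrable_def)
  then have bfin: "(\<integral>\<^sup>+x. b x \<partial>lborel) < \<infinity>"
    by (simp add: b_def integrable_iff_bounded abs_of_nonneg)
  have "(\<integral>\<^sup>+z. poisson2 1 z \<partial>lborel) \<le> (\<integral>\<^sup>+z. 2 * (b (Re z) * b (Im z)) \<partial>lborel)"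
  proof (rule nn_integral_mono)
    fix z
    have pos: "0 < (1 + (Re z)\<^sup>2) * (1 + (Im z)\<^sup>2)"
      by (intro mult_pos_pos add_pos_nonneg) auto
    have "(1 + (Re z)\<^sup>2) * (1 + (Im z)\<^sup>2) \<le> (z \<bullet> z + 1\<^sup>2)\<^sup>2"
    proof -
      have "0 \<le> (Re z)\<^sup>2 + (Im z)\<^sup>2 + (Re z)\<^sup>2 * (Im z)\<^sup>2 + ((Re z)\<^sup>2)\<^sup>2 + ((Im z)\<^sup>2)\<^sup>2"
        by (intro add_nonneg_nonneg) auto
      then show ?thesis
        by (simp add: inner_complex_def power2_eq_square algebra_simps)
    qed
    then have "inverse ((z \<bullet> z + 1\<^sup>2)\<^sup>2) \<le> inverse ((1 + (Re z)\<^sup>2) * (1 + (Im z)\<^sup>2))"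
      using pos by (intro le_imp_inverse_le) auto
    then have "poisson2 1 z \<le> 2 * (inverse (1 + (Re z)\<^sup>2) * inverse (1 + (Im z)\<^sup>2))"
      by (simp add: poisson2_def power_inverse)
    then have "ennreal (poisson2 1 z) \<le> ennreal (2 * (inverse (1 + (Re z)\<^sup>2) * inverse (1 + (Im z)\<^sup>2)))"
      by (rule ennreal_leI)
    also have "\<dots> = 2 * (b (Re z) * b (Im z))"
      unfolding b_def by (subst ennreal_mult) (auto simp: ennreal_mult[symmetric])
    finally show "ennreal (poisson2 1 z) \<le> 2 * (b (Re z) * b (Im z))" .
  qed
  also have "\<dots> = 2 * ((\<integral>\<^sup>+x. b x \<partial>lborel) * (\<integral>\<^sup>+x. b x \<partial>lborel))"
    by (subst nn_integral_cmult) (simp_all add: nn_integral_complex_product)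
  also have "\<dots> < \<infinity>"
    using bfin by (simp add: ennreal_mult_less_top)
  finally show ?thesis
    using poisson2_bounds(1)[of 1] by (simp add: integrable_iff_bounded)
qed

lemma nn_kap: "(\<integral>\<^sup>+z. poisson2 1 z \<partial>lborel) = ennreal kap"
  unfolding kap_def using poisson2_bounds(1)[of 1]
  by (intro nn_integral_eq_integral integrable_poisson2_1) auto

lemma kap_pos: "kap > 0"
proof -
  have "kap \<noteq> 0"
  proof
    assume "kap = 0"
    then have "AE z in lborel. poisson2 1 z = 0"
      using integral_nonneg_eq_0_iff_AE[OF integrable_poisson2_1] poisson2_bounds(1)[of 1] by (auto simp: kap_def)
    moreover have "poisson2 1 z \<noteq> 0" for z
      using reg_pos[of 1 z] by (auto simp: poisson2_def)
    ultimately have "AE z in (lborel :: complex measure). False"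
      by (auto elim!: eventually_mono)
    then have "ae_filter (lborel :: complex measure) = bot"
      by (simp only: eventually_False)
    then show False
      by (simp add: ae_filter_eq_bot_iff)
  qed
  moreover have "kap \<ge> 0" unfolding kap_def using poisson2_bounds(1)[of 1] by auto
  ultimately show ?thesis by simp
qed

text \<open>The substitution \<open>y = x - \<delta> *\<^sub>R t\<close>. With \<open>F = 1\<close>
  it shows that the mass does not depend on \<open>\<delta>\<close>; with \<open>F\<close> a
  difference of translates it feeds \<open>mollify_L1\<close>.\<close>

lemma nn_integral_poisson2_scale:
  fixes F :: "complex \<Rightarrow> ennreal"
  assumes [measurable]: "F \<in> borel_measurable borel" and "\<delta> > 0"
  shows "(\<integral>\<^sup>+y. F y * poisson2 \<delta> (x - y) \<partial>lborel) = (\<integral>\<^sup>+t. F (x - \<delta> *\<^sub>R t) * poisson2 1 t \<partial>lborel)"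
proof -
  have s: "\<delta>\<^sup>2 * poisson2 \<delta> (\<delta> *\<^sub>R t) = poisson2 1 t" for t
  proof -
    have "(\<delta> *\<^sub>R t) \<bullet> (\<delta> *\<^sub>R t) + \<delta>\<^sup>2 = \<delta>\<^sup>2 * (t \<bullet> t + 1)"
      by (simp add: power2_eq_square algebra_simps)
    then have "\<delta>\<^sup>2 * poisson2 \<delta> (\<delta> *\<^sub>R t) = 2 * (\<delta>\<^sup>2 * inverse (\<delta>\<^sup>2))\<^sup>2 * (inverse (t \<bullet> t + 1))\<^sup>2"
      unfolding poisson2_def by (simp only: inverse_mult_distrib power_mult_distrib) (simp add: power2_eq_square)
    then show ?thesis
      using \<open>\<delta> > 0\<close> by (simp add: poisson2_def)
  qed
  have "(\<integral>\<^sup>+y. F y * poisson2 \<delta> (x - y) \<partial>lborel) =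
      ennreal (\<delta>\<^sup>2) * (\<integral>\<^sup>+t. F (x - \<delta> *\<^sub>R t) * poisson2 \<delta> (\<delta> *\<^sub>R t) \<partial>lborel)"
    using \<open>\<delta> > 0\<close> by (subst nn_integral_lborel_affine[of _ "- \<delta>" x]) auto
  also have "\<dots> = (\<integral>\<^sup>+t. F (x - \<delta> *\<^sub>R t) * ennreal (\<delta>\<^sup>2 * poisson2 \<delta> (\<delta> *\<^sub>R t)) \<partial>lborel)"
    using \<open>\<delta> > 0\<close> by (subst nn_integral_cmult[symmetric]) (auto simp: ennreal_mult poisson2_bounds mult_ac)
  finally show ?thesis unfolding s .
qed

lemma nn_integral_poisson2:
  assumes "\<delta> > 0"
  shows "(\<integral>\<^sup>+y. poisson2 \<delta> (x - y) \<partial>lborel) = ennreal kap"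
  using nn_integral_poisson2_scale[of "\<lambda>_. 1" \<delta> x] assms nn_kap by simp

lemma integral_poisson2:
  assumes "\<delta> > 0"
  shows "integrable lborel (\<lambda>y. poisson2 \<delta> (x - y))" "(LINT y|lborel. poisson2 \<delta> (x - y)) = kap"
proof -
  show "integrable lborel (\<lambda>y. poisson2 \<delta> (x - y))"
    using nn_integral_poisson2[OF assms, of x] poisson2_bounds(1)[OF assms] by (simp add: integrable_iff_bounded)
  show "(LINT y|lborel. poisson2 \<delta> (x - y)) = kap"
    using nn_integral_poisson2[OF assms, of x] poisson2_bounds(1)[OF assms] kap_pos
    by (simp add: integral_eq_nn_integral)
qed

lemma integrable_mult_poisson2:
  fixes g :: "complex \<Rightarrow> complex"
  assumes "integrable lborel g" "\<delta> > 0"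
  shows "integrable lborel (\<lambda>y. g y * of_real (poisson2 \<delta> (x - y)))"
proof (rule Bochner_Integration.integrable_bound[where f="\<lambda>y. (2 / \<delta>\<^sup>2) * norm (g y)"])
  have [measurable]: "g \<in> borel_measurable borel" using assms by auto
  show "(\<lambda>y. g y * of_real (poisson2 \<delta> (x - y))) \<in> borel_measurable lborel" by measurable
  show "AE y in lborel. norm (g y * of_real (poisson2 \<delta> (x - y))) \<le> norm ((2 / \<delta>\<^sup>2) * norm (g y))"
  proof (rule AE_I2)
    fix y
    show "norm (g y * of_real (poisson2 \<delta> (x - y))) \<le> norm ((2 / \<delta>\<^sup>2) * norm (g y))"
      using mult_left_mono[OF poisson2_bounds(2)[OF assms(2), of "x - y"] norm_ge_zero[of "g y"]] poisson2_bounds(1)[OF assms(2), of "x - y"]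
      by (simp add: norm_mult abs_mult mult_ac)
  qed
qed (use assms in auto)

text \<open>By Tonelli the error is at most the integral of \<open>T (\<delta> t)\<close> against
  \<open>poisson2 1 t\<close>, where \<open>T s\<close> is the L1 distance of \<open>g\<close> to
  its translate by \<open>s\<close>. Here \<open>T\<close> tends to 0 at 0 and is bounded by twice
  the L1 norm of \<open>g\<close>, so dominated convergence applies although the kernel has
  unbounded support.\<close>

lemma mollify_L1:
  fixes g :: "complex \<Rightarrow> complex"
  assumes g: "integrable lborel g" and \<delta>: "\<And>n. \<delta> n > 0" "\<delta> \<longlonglongrightarrow> 0"
  shows "(\<lambda>n. \<integral>\<^sup>+x. norm ((LINT y|lborel. g y * of_real (poisson2 (\<delta> n) (x - y))) - of_real kap * g x) \<partial>lborel) \<longlonglongrightarrow> 0"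
proof (rule tendsto_sandwich[OF _ _ tendsto_const])
  have gm [measurable]: "g \<in> borel_measurable borel" using g by auto
  define T where "T s = (\<integral>\<^sup>+x. norm (g (x - s) - g x) \<partial>lborel)" for s
  have [measurable]: "T \<in> borel_measurable borel" unfolding T_def by measurable
  have Tint: "T s = ennreal (LINT x|lborel. norm (g (x - s) - g x))" for s
    unfolding T_def using lborel_integrable_translate[OF g, of s] g by (intro nn_integral_eq_integral) auto
  have "(\<lambda>n. \<integral>\<^sup>+t. T (\<delta> n *\<^sub>R t) * poisson2 1 t \<partial>lborel) \<longlonglongrightarrow> (\<integral>\<^sup>+t. 0 \<partial>(lborel :: complex measure))"
  proof (rule nn_integral_dominated_convergence[where w="\<lambda>t. ennreal (2 * (LINT x|lborel. norm (g x))) * poisson2 1 t"])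
    show "AE t in lborel. T (\<delta> j *\<^sub>R t) * ennreal (poisson2 1 t) \<le> ennreal (2 * (LINT x|lborel. norm (g x))) * ennreal (poisson2 1 t)" for j
    proof (intro AE_I2 mult_right_mono)
      fix t :: complex
      let ?s = "\<delta> j *\<^sub>R t"
      note tr = lborel_integrable_translate[OF g, of ?s]
      have "(LINT x|lborel. norm (g (x - ?s) - g x)) \<le> (LINT x|lborel. norm (g (x - ?s)) + norm (g x))"
        using tr g by (intro integral_mono norm_triangle_ineq4) auto
      also have "\<dots> = 2 * (LINT x|lborel. norm (g x))"
        using tr g lborel_integral_translate[of "\<lambda>x. norm (g x)" ?s] by simp
      finally show "T ?s \<le> ennreal (2 * (LINT x|lborel. norm (g x)))"
        unfolding Tint by (rule ennreal_leI)
    qed simp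
    show "(\<integral>\<^sup>+t. ennreal (2 * (LINT x|lborel. norm (g x))) * poisson2 1 t \<partial>lborel) < \<infinity>"
      by (subst nn_integral_cmult) (auto simp: nn_kap ennreal_mult_less_top)
    show "AE t in lborel. (\<lambda>n. T (\<delta> n *\<^sub>R t) * ennreal (poisson2 1 t)) \<longlonglongrightarrow> 0"
    proof (rule AE_I2)
      fix t :: complex
      have "(\<lambda>n. \<delta> n *\<^sub>R t) \<longlonglongrightarrow> 0"
        using tendsto_scaleR[OF \<delta>(2) tendsto_const, of t] by simp
      from L1_translation_continuous[OF g this] have "(\<lambda>n. T (\<delta> n *\<^sub>R t)) \<longlonglongrightarrow> 0"
        unfolding Tint using tendsto_ennrealI by fastforce
      then have "(\<lambda>n. T (\<delta> n *\<^sub>R t) * ennreal (poisson2 1 t)) \<longlonglongrightarrow> 0 * ennreal (poisson2 1 t)"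
        by (intro tendsto_mult_ennreal tendsto_const) auto
      then show "(\<lambda>n. T (\<delta> n *\<^sub>R t) * ennreal (poisson2 1 t)) \<longlonglongrightarrow> 0" by simp
    qed
  qed measurable
  then show "(\<lambda>n. \<integral>\<^sup>+t. T (\<delta> n *\<^sub>R t) * poisson2 1 t \<partial>lborel) \<longlonglongrightarrow> 0" by simp
  show "\<forall>\<^sub>F n in sequentially. 0 \<le> (\<integral>\<^sup>+x. norm ((LINT y|lborel. g y * of_real (poisson2 (\<delta> n) (x - y))) - of_real kap * g x) \<partial>lborel)"
    by simp
  show "\<forall>\<^sub>F n in sequentially. (\<integral>\<^sup>+x. norm ((LINT y|lborel. g y * of_real (poisson2 (\<delta> n) (x - y))) - of_real kap * g x) \<partial>lborel)
      \<le> (\<integral>\<^sup>+t. T (\<delta> n *\<^sub>R t) * poisson2 1 t \<partial>lborel)"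
  proof (intro always_eventually allI)
    fix n
    note d = \<delta>(1)[of n]
    have "(\<integral>\<^sup>+x. norm ((LINT y|lborel. g y * of_real (poisson2 (\<delta> n) (x - y))) - of_real kap * g x) \<partial>lborel)
      \<le> (\<integral>\<^sup>+x. \<integral>\<^sup>+t. norm (g (x - \<delta> n *\<^sub>R t) - g x) * poisson2 1 t \<partial>lborel \<partial>lborel)"
    proof (rule nn_integral_mono)
      fix x
      have i1: "integrable lborel (\<lambda>y. g y * of_real (poisson2 (\<delta> n) (x - y)))"
        by (rule integrable_mult_poisson2[OF g d])
      have i2: "integrable lborel (\<lambda>y. g x * of_real (poisson2 (\<delta> n) (x - y)))"
        using integral_poisson2(1)[OF d, of x] by auto
      have "(LINT y|lborel. g x * of_real (poisson2 (\<delta> n) (x - y))) = of_real kap * g x"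
        using integral_poisson2[OF d, of x] by simp
      then have "(LINT y|lborel. g y * of_real (poisson2 (\<delta> n) (x - y))) - of_real kap * g x =
         (LINT y|lborel. g y * of_real (poisson2 (\<delta> n) (x - y))) - (LINT y|lborel. g x * of_real (poisson2 (\<delta> n) (x - y)))"
        by (simp only:)
      also have "\<dots> = (LINT y|lborel. (g y - g x) * of_real (poisson2 (\<delta> n) (x - y)))"
        by (subst Bochner_Integration.integral_diff[OF i1 i2, symmetric]) (simp add: left_diff_distrib)
      finally have "(LINT y|lborel. g y * of_real (poisson2 (\<delta> n) (x - y))) - of_real kap * g x =
         (LINT y|lborel. (g y - g x) * of_real (poisson2 (\<delta> n) (x - y)))" .
      moreover have "integrable lborel (\<lambda>y. (g y - g x) * of_real (poisson2 (\<delta> n) (x - y)))"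
        using Bochner_Integration.integrable_diff[OF i1 i2] by (simp only: left_diff_distrib)
      ultimately have "ennreal (norm ((LINT y|lborel. g y * of_real (poisson2 (\<delta> n) (x - y))) - of_real kap * g x))
        \<le> (\<integral>\<^sup>+y. norm ((g y - g x) * of_real (poisson2 (\<delta> n) (x - y))) \<partial>lborel)"
        using integral_norm_bound_ennreal by (simp only:)
      also have "\<dots> = (\<integral>\<^sup>+y. ennreal (norm (g y - g x)) * poisson2 (\<delta> n) (x - y) \<partial>lborel)"
        by (intro nn_integral_cong) (simp add: norm_mult ennreal_mult poisson2_bounds[OF d] abs_of_nonneg)
      also have "\<dots> = (\<integral>\<^sup>+t. norm (g (x - \<delta> n *\<^sub>R t) - g x) * poisson2 1 t \<partial>lborel)"
        by (subst nn_integral_poisson2_scale[OF _ d]) (auto simp: ennreal_mult poisson2_bounds)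
      finally show "ennreal (norm ((LINT y|lborel. g y * of_real (poisson2 (\<delta> n) (x - y))) - of_real kap * g x))
        \<le> (\<integral>\<^sup>+t. norm (g (x - \<delta> n *\<^sub>R t) - g x) * poisson2 1 t \<partial>lborel)" .
    qed
    also have "\<dots> = (\<integral>\<^sup>+t. \<integral>\<^sup>+x. norm (g (x - \<delta> n *\<^sub>R t) - g x) * poisson2 1 t \<partial>lborel \<partial>lborel)"
      by (rule lborel_pair.Fubini'[symmetric]) measurable
    also have "\<dots> = (\<integral>\<^sup>+t. T (\<delta> n *\<^sub>R t) * poisson2 1 t \<partial>lborel)"
      unfolding T_def
      by (intro nn_integral_cong, subst nn_integral_multc[symmetric]) (auto simp: ennreal_mult poisson2_bounds)
    finally show "(\<integral>\<^sup>+x. norm ((LINT y|lborel. g y * of_real (poisson2 (\<delta> n) (x - y))) - of_real kap * g x) \<partial>lborel)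
      \<le> (\<integral>\<^sup>+t. T (\<delta> n *\<^sub>R t) * poisson2 1 t \<partial>lborel)" .
  qed
qed

section \<open>Integrability of the Cauchy kernel\<close>

lemma nn_integral_powr_interval:
  assumes "a > - 1"
  shows "(\<integral>\<^sup>+x. indicator {-1<..<1} x * ennreal (\<bar>x\<bar> powr a) \<partial>lborel) < \<infinity>"
proof -
  define f where "f x = (if x \<in> {0..1} then x powr a else 0)" for x :: real
  have [measurable]: "f \<in> borel_measurable borel" unfolding f_def by measurable
  have f0: "f x \<ge> 0" for x by (simp add: f_def)
  have "(f has_integral (1 / (a + 1))) UNIV"
    unfolding f_def has_integral_restrict_UNIV using has_integral_powr_from_0[OF assms, of 1] by simp
  then have fin: "(\<integral>\<^sup>+x. f x \<partial>lborel) = ennreal (1 / (a + 1))"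
    by (intro nn_integral_has_integral_lborel f0) auto
  have "(\<integral>\<^sup>+x. f (- x) \<partial>lborel) = (\<integral>\<^sup>+x. f x \<partial>lborel)"
    by (subst (2) nn_integral_real_affine[of _ "-1" 0]) auto
  moreover have "(\<integral>\<^sup>+x. indicator {-1<..<1} x * ennreal (\<bar>x\<bar> powr a) \<partial>lborel) \<le> (\<integral>\<^sup>+x. ennreal (f x) + ennreal (f (- x)) \<partial>lborel)"
    by (rule nn_integral_mono) (auto simp: f_def indicator_def)
  moreover have "(\<integral>\<^sup>+x. ennreal (f x) + ennreal (f (- x)) \<partial>lborel) = (\<integral>\<^sup>+x. f x \<partial>lborel) + (\<integral>\<^sup>+x. f (- x) \<partial>lborel)"
    by (rule nn_integral_add) auto
  ultimately show ?thesis
    using fin by (auto intro: le_less_trans)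
qed

text \<open>For \<open>z = x + \<i> y\<close> one has \<open>|x| |y| \<le> |z|^2\<close>, hence
  \<open>|z| powr (- q) \<le> |x| powr (- q / 2) * |y| powr (- q / 2)\<close>; each factor is
  integrable near 0 exactly because \<open>q < 2\<close>.\<close>

lemma nn_integral_norm_powr_ball:
  assumes "0 \<le> q" "q < 2"
  shows "(\<integral>\<^sup>+z. indicator (ball 0 1) z * ennreal (norm z powr (- q)) \<partial>(lborel :: complex measure)) < \<infinity>"
proof -
  \<comment> \<open>On the coordinate axes \<open>0 powr a = 0\<close> would break the pointwise
    comparison; the value \<open>\<infinity>\<close> on this null set repairs it without changing
    the integral.\<close>
  define b where "b x = (if x = 0 then \<infinity> else indicator {-1<..<1} x * ennreal (\<bar>x\<bar> powr (- q / 2)))" for x :: real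
  have [measurable]: "b \<in> borel_measurable borel" unfolding b_def by measurable
  have "AE x::real in lborel. x \<noteq> 0"
    by (rule AE_I[where N="{0}"]) auto
  then have "AE x in lborel. b x = indicator {-1<..<1} x * ennreal (\<bar>x\<bar> powr (- q / 2))"
    by eventually_elim (auto simp: b_def)
  then have "(\<integral>\<^sup>+x. b x \<partial>lborel) = (\<integral>\<^sup>+x. indicator {-1<..<1} x * ennreal (\<bar>x\<bar> powr (- q / 2)) \<partial>lborel)"
    by (rule nn_integral_cong_AE)
  also have "\<dots> < \<infinity>" by (rule nn_integral_powr_interval) (use assms in auto)
  finally have bfin: "(\<integral>\<^sup>+x. b x \<partial>lborel) < \<infinity>" .
  have "(\<integral>\<^sup>+z. indicator (ball 0 1) z * ennreal (norm z powr (- q)) \<partial>(lborel :: complex measure)) \<le> (\<integral>\<^sup>+z. b (Re z) * b (Im z) \<partial>lborel)"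
  proof (rule nn_integral_mono)
    fix z :: complex
    show "indicator (ball 0 1) z * ennreal (norm z powr (- q)) \<le> b (Re z) * b (Im z)"
    proof (cases "z \<in> ball 0 1")
      case True
      then have z: "norm z < 1" by simp
      have x: "\<bar>Re z\<bar> < 1" "\<bar>Im z\<bar> < 1"
        using abs_Re_le_cmod[of z] abs_Im_le_cmod[of z] z by linarith+
      have b0: "b y \<noteq> 0" if "\<bar>y\<bar> < 1" for y
        using that by (auto simp: b_def indicator_def)
      show ?thesis
      proof (cases "Re z = 0 \<or> Im z = 0")
        case True
        then have "b (Re z) * b (Im z) = \<infinity>"
          using b0[OF x(1)] b0[OF x(2)] by (auto simp: b_def[of 0] ennreal_top_mult ennreal_mult_top)
        then show ?thesis by simp
      next
        case False
        have "(\<bar>Re z\<bar> * \<bar>Im z\<bar>) \<le> (norm z)\<^sup>2"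
        proof -
          have "0 \<le> (\<bar>Re z\<bar> - \<bar>Im z\<bar>)\<^sup>2" by simp
          then have "2 * (\<bar>Re z\<bar> * \<bar>Im z\<bar>) \<le> (norm z)\<^sup>2"
            by (simp add: cmod_power2 power2_diff)
          moreover have "0 \<le> \<bar>Re z\<bar> * \<bar>Im z\<bar>" by simp
          ultimately show ?thesis by linarith
        qed
        then have "((norm z)\<^sup>2) powr (- q / 2) \<le> (\<bar>Re z\<bar> * \<bar>Im z\<bar>) powr (- q / 2)"
          using False assms by (intro powr_mono2') auto
        moreover have "((norm z)\<^sup>2) powr (- q / 2) = norm z powr (- q)"
        proof -
          have "norm z > 0" using False by auto
          then have "(norm z)\<^sup>2 = norm z powr 2" by (simp add: powr_numeral)
          then show ?thesis by (simp only: powr_powr) simp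
        qed
        ultimately have "norm z powr (- q) \<le> \<bar>Re z\<bar> powr (- q / 2) * \<bar>Im z\<bar> powr (- q / 2)"
          by (simp add: powr_mult)
        then show ?thesis
          using False x True by (auto simp: b_def indicator_def ennreal_mult[symmetric] abs_less_iff intro!: ennreal_leI)
      qed
    qed auto
  qed
  also have "\<dots> = (\<integral>\<^sup>+x. b x \<partial>lborel) * (\<integral>\<^sup>+x. b x \<partial>lborel)"
    by (rule nn_integral_complex_product) auto
  also have "\<dots> < \<infinity>" using bfin by (simp add: ennreal_mult_less_top)
  finally show ?thesis .
qed

text \<open>The case \<open>q = 1\<close> rescaled. The linear growth in \<open>r\<close> is the
  origin of the bound \<open>C R\<close> for the potential \<open>w\<close>.\<close>

lemma nn_integral_inverse_norm_ball:
  obtains C where "C \<ge> 0"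
    "\<And>r z. r > 0 \<Longrightarrow> (\<integral>\<^sup>+y. indicator (ball z r) y * ennreal (inverse (norm (z - y))) \<partial>(lborel :: complex measure)) \<le> ennreal (C * r)"
proof -
  define I where "I = (\<integral>\<^sup>+z. indicator (ball 0 1) z * ennreal (norm z powr (- 1)) \<partial>(lborel :: complex measure))"
  have "I < \<infinity>" unfolding I_def by (rule nn_integral_norm_powr_ball) auto
  then obtain C where C: "C \<ge> 0" "I = ennreal C" by (cases I) auto
  show ?thesis
  proof (rule that[OF C(1)])
    fix r :: real and z :: complex
    assume r: "r > 0"
    have [measurable]: "ball z r \<in> sets borel" "ball (0::complex) 1 \<in> sets borel" by simp_all
    have [measurable]: "(\<lambda>y. indicator (ball z r) y * ennreal (inverse (norm (z - y)))) \<in> borel_measurable borel"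
      by measurable
    have "(\<integral>\<^sup>+y. indicator (ball z r) y * ennreal (inverse (norm (z - y))) \<partial>lborel)
      = ennreal (r\<^sup>2) * (\<integral>\<^sup>+t. indicator (ball z r) (z + r *\<^sub>R t) * ennreal (inverse (norm (z - (z + r *\<^sub>R t)))) \<partial>lborel)"
      using r by (subst nn_integral_lborel_affine[of _ r z]) auto
    also have "\<dots> = ennreal (r\<^sup>2) * (\<integral>\<^sup>+t. ennreal (inverse r) * (indicator (ball 0 1) t * ennreal (cmod t powr (- 1))) \<partial>lborel)"
    proof (rule arg_cong2[where f=times, OF refl], rule nn_integral_cong)
      fix t :: complex
      show "indicator (ball z r) (z + r *\<^sub>R t) * ennreal (inverse (norm (z - (z + r *\<^sub>R t)))) =
        ennreal (inverse r) * (indicator (ball 0 1) t * ennreal (cmod t powr (- 1)))"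
        using r by (auto simp: indicator_def dist_norm ennreal_mult[symmetric] powr_minus)
    qed
    also have "\<dots> = ennreal (r\<^sup>2) * (ennreal (inverse r) * I)"
      unfolding I_def by (rule arg_cong2[where f=times, OF refl], rule nn_integral_cmult) measurable
    also have "\<dots> = ennreal (r\<^sup>2 * (inverse r * C))"
      using r C by (simp add: ennreal_mult)
    also have "r\<^sup>2 * (inverse r * C) = C * r"
      using r by (simp add: power2_eq_square)
    finally show "(\<integral>\<^sup>+y. indicator (ball z r) y * ennreal (inverse (norm (z - y))) \<partial>lborel) \<le> ennreal (C * r)" by simp
  qed
qed

section \<open>Cutoff functions\<close>

lemma C1_mult:
  fixes f g :: "'a::euclidean_space \<Rightarrow> 'b::{real_normed_field, euclidean_space}"
  assumes "C1_deriv f f'" "C1_deriv g g'"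
  shows "C1_deriv (\<lambda>x. f x * g x) (\<lambda>x h. f x * g' x h + f' x h * g x)"
proof (rule C1_derivI)
  show "((\<lambda>x. f x * g x) has_derivative (\<lambda>h. f x * g' x h + f' x h * g x)) (at x)" for x
    by (intro has_derivative_mult C1_derivD(1)[OF assms(1)] C1_derivD(1)[OF assms(2)])
  show "continuous_on UNIV (\<lambda>x. f x * g' x b + f' x b * g x)" for b
    by (intro continuous_intros C1_derivD(2,4)[OF assms(1)] C1_derivD(2,4)[OF assms(2)])
qed

lemma C1_diff:
  assumes "C1_deriv f f'" "C1_deriv g g'"
  shows "C1_deriv (\<lambda>x. f x - g x) (\<lambda>x h. f' x h - g' x h)"
proof (rule C1_derivI)
  show "((\<lambda>x. f x - g x) has_derivative (\<lambda>h. f' x h - g' x h)) (at x)" for x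
    by (intro has_derivative_diff C1_derivD(1)[OF assms(1)] C1_derivD(1)[OF assms(2)])
  show "continuous_on UNIV (\<lambda>x. f' x b - g' x b)" for b
    by (intro continuous_intros C1_derivD(2)[OF assms(1)] C1_derivD(2)[OF assms(2)])
qed

lemma C1_const: "C1_deriv (\<lambda>x. c) (\<lambda>x h. 0)"
  by (rule C1_derivI) auto

lemma C1_translate:
  assumes "C1_deriv f f'"
  shows "C1_deriv (\<lambda>x. f (x - z)) (\<lambda>x. f' (x - z))"
proof (rule C1_derivI)
  show "((\<lambda>x. f (x - z)) has_derivative f' (x - z)) (at x)" for x
    by (rule has_derivative_compose[OF _ C1_derivD(1)[OF assms], of "\<lambda>x. x - z" "\<lambda>h. h"])
      (auto intro!: derivative_eq_intros)
  show "continuous_on UNIV (\<lambda>x. f' (x - z) b)" for b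
    by (rule continuous_on_compose2[OF C1_derivD(2)[OF assms, of UNIV]]) (auto intro!: continuous_intros)
qed

lemma C1_reflect:
  assumes "C1_deriv f f'"
  shows "C1_deriv (\<lambda>x. f (z - x)) (\<lambda>x h. - f' (z - x) h)"
proof (rule C1_derivI)
  show "((\<lambda>x. f (z - x)) has_derivative (\<lambda>h. - f' (z - x) h)) (at x)" for x
  proof -
    have "((\<lambda>x. f (z - x)) has_derivative (\<lambda>h. f' (z - x) (- h))) (at x)"
      by (rule has_derivative_compose[OF _ C1_derivD(1)[OF assms]]) (auto intro!: derivative_eq_intros)
    then show ?thesis using linear_neg[OF C1_derivD(3)[OF assms]] by simp
  qed
  show "continuous_on UNIV (\<lambda>x. - f' (z - x) b)" for b
    by (intro continuous_intros continuous_on_compose2[OF C1_derivD(2)[OF assms, of UNIV]]) (auto intro!: continuous_intros)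
qed

lemma C1_of_real:
  assumes "C1_deriv f f'"
  shows "C1_deriv (\<lambda>x. of_real (f x) :: complex) (\<lambda>x h. of_real (f' x h))"
  by (rule C1_derivI)
    (auto intro!: bounded_linear.has_derivative[OF bounded_linear_of_real] C1_derivD(1,2)[OF assms] continuous_intros)

definition sq_plus :: "real \<Rightarrow> real" where "sq_plus t = (max 0 t)\<^sup>2"

lemma sq_plus_deriv: "(sq_plus has_real_derivative 2 * max 0 t) (at t)"
proof -
  consider "t > 0" | "t < 0" | "t = 0" by linarith
  then show ?thesis
  proof cases
    case 1
    have "((\<lambda>t. t\<^sup>2) has_real_derivative 2 * max 0 t) (at t)"
      using 1 by (auto intro!: derivative_eq_intros)
    then show ?thesis
      by (rule has_field_derivative_transform_within_open[where S="{0<..}"]) (use 1 in \<open>auto simp: sq_plus_def\<close>)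
  next
    case 2
    have "((\<lambda>t. 0) has_real_derivative 2 * max 0 t) (at t)"
      using 2 by auto
    then show ?thesis
      by (rule has_field_derivative_transform_within_open[where S="{..<0}"]) (use 2 in \<open>auto simp: sq_plus_def\<close>)
  next
    case 3
    have "((\<lambda>h. (sq_plus (0 + h) - sq_plus 0) / h) \<longlongrightarrow> 0) (at 0)"
    proof (rule tendsto_0_le[where K=1])
      show "((\<lambda>h::real. h) \<longlongrightarrow> 0) (at 0)" by (rule tendsto_ident_at)
      show "\<forall>\<^sub>F h in at 0. norm ((sq_plus (0 + h) - sq_plus 0) / h) \<le> norm h * 1"
        by (intro always_eventually allI) (auto simp: sq_plus_def power2_eq_square max_def)
    qed
    then show ?thesis
      using 3 by (simp add: DERIV_def)
  qed
qed

text \<open>The function \<open>1 - sq_plus (1 - sq_plus t)\<close> is a \<open>C\<^sup>1\<close> step from 0 (for \<open>t \<le> 0\<close>) to 1 (for \<open>t \<ge> 1\<close>).\<close>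

definition cutoff :: "real \<Rightarrow> real \<Rightarrow> complex \<Rightarrow> real" where
  "cutoff r s z = 1 - sq_plus (1 - sq_plus ((s\<^sup>2 - z \<bullet> z) / (s\<^sup>2 - r\<^sup>2)))"

definition cutoff' :: "real \<Rightarrow> real \<Rightarrow> complex \<Rightarrow> complex \<Rightarrow> real" where
  "cutoff' r s z h = (let t = (s\<^sup>2 - z \<bullet> z) / (s\<^sup>2 - r\<^sup>2) in
     - (2 * max 0 (1 - sq_plus t) * (- (2 * max 0 t * (- (2 * (z \<bullet> h)) / (s\<^sup>2 - r\<^sup>2))))))"

lemma cutoff_C1:
  assumes "0 \<le> r" "r < s"
  shows "C1_deriv (cutoff r s) (cutoff' r s)"
proof (rule C1_derivI)
  have sr: "s\<^sup>2 - r\<^sup>2 \<noteq> 0"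
    using power_strict_mono[OF assms(2,1), of 2] by simp
  have q: "((\<lambda>z. sq_plus (g z)) has_derivative (\<lambda>h. 2 * max 0 (g z) * g' h)) (at z)"
    if "(g has_derivative g') (at z)" for g :: "complex \<Rightarrow> real" and g' z
    using has_derivative_compose[OF that sq_plus_deriv[unfolded has_field_derivative_def]] by simp
  show "(cutoff r s has_derivative cutoff' r s z) (at z)" for z
  proof -
    have t: "((\<lambda>z. (s\<^sup>2 - z \<bullet> z) / (s\<^sup>2 - r\<^sup>2)) has_derivative (\<lambda>h. - (2 * (z \<bullet> h)) / (s\<^sup>2 - r\<^sup>2))) (at z)"
      unfolding divide_inverse
      by (rule has_derivative_eq_rhs, rule has_derivative_mult_left, (rule derivative_intros)+)
        (simp add: inner_commute)
    note one = has_derivative_const[of "1::real"]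
    show ?thesis
      using has_derivative_diff[OF one q[OF has_derivative_diff[OF one q[OF t]]]]
      unfolding cutoff_def[abs_def] cutoff'_def Let_def diff_0 .
  qed
  have t: "continuous_on UNIV (\<lambda>z::complex. (s\<^sup>2 - z \<bullet> z) / (s\<^sup>2 - r\<^sup>2))"
    unfolding divide_inverse by (intro continuous_intros)
  have sqt: "continuous_on UNIV (\<lambda>z::complex. sq_plus ((s\<^sup>2 - z \<bullet> z) / (s\<^sup>2 - r\<^sup>2)))"
    unfolding sq_plus_def by (intro continuous_on_power continuous_on_max continuous_on_const t)
  show "continuous_on UNIV (\<lambda>z. cutoff' r s z b)" for b
    unfolding cutoff'_def Let_def divide_inverse
    by (intro continuous_intros t[unfolded divide_inverse] sqt[unfolded divide_inverse])
qed

lemma cutoff_eq: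
  assumes "0 \<le> r" "r < s"
  shows "norm z \<le> r \<Longrightarrow> cutoff r s z = 1" "norm z \<ge> s \<Longrightarrow> cutoff r s z = 0"
proof -
  have sr: "s\<^sup>2 - r\<^sup>2 > 0" using assms by (simp add: power_strict_mono)
  show "cutoff r s z = 1" if "norm z \<le> r"
  proof -
    have "z \<bullet> z \<le> r\<^sup>2" using that by (simp add: power2_norm_eq_inner[symmetric] power_mono)
    then have "1 \<le> (s\<^sup>2 - z \<bullet> z) / (s\<^sup>2 - r\<^sup>2)" using sr by (simp add: le_divide_eq)
    then have "1 \<le> sq_plus ((s\<^sup>2 - z \<bullet> z) / (s\<^sup>2 - r\<^sup>2))"
      by (simp add: sq_plus_def one_le_power)
    then show ?thesis by (simp add: cutoff_def sq_plus_def[of "1 - _"])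
  qed
  show "cutoff r s z = 0" if "norm z \<ge> s"
  proof -
    have "s\<^sup>2 \<le> z \<bullet> z" using that assms by (simp add: power2_norm_eq_inner[symmetric] power_mono)
    then have "(s\<^sup>2 - z \<bullet> z) / (s\<^sup>2 - r\<^sup>2) \<le> 0" using sr by (simp add: divide_le_0_iff)
    then show ?thesis by (simp add: cutoff_def sq_plus_def)
  qed
qed

lemma cutoff_bounds: "0 \<le> cutoff r s z" "cutoff r s z \<le> 1"
proof -
  have "sq_plus t \<ge> 0" for t by (simp add: sq_plus_def)
  moreover have "sq_plus t \<le> 1" if "t \<le> 1" for t
    using that by (simp add: sq_plus_def power_le_one)
  ultimately show "0 \<le> cutoff r s z" "cutoff r s z \<le> 1" by (simp_all add: cutoff_def)
qed

section \<open>Cauchy potentials\<close>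

text \<open>
  The Young-type inequality \<open>young\<close> is the only way in which the norm of the drift enters: for \<open>2 < p < \<infinity>\<close>
  it holds with \<open>H = N powr p\<close> and the conjugate exponent \<open>q\<close>, for \<open>p = \<infinity>\<close> with \<open>H = 0\<close>.
\<close>

locale young_pair =
  fixes N H :: "complex \<Rightarrow> real" and q :: real
  assumes N_measurable [measurable]: "N \<in> borel_measurable borel"
    and H_measurable [measurable]: "H \<in> borel_measurable borel"
    and young: "t \<ge> 0 \<Longrightarrow> N z * t \<le> t + H z + (if t > 1 then t powr q else 0)"
    and H_nonneg: "H z \<ge> 0"
    and H_int: "(\<integral>\<^sup>+z. H z \<partial>lborel) \<le> 1"

text \<open>Apply \<open>young\<close> with \<open>t = 1 / |z - y|\<close>. The linear term is
  integrated over a ball of radius \<open>\<rho> + norm z\<close> about \<open>z\<close> and grows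
  linearly, \<open>H\<close> contributes at most 1, and the power \<open>q\<close> occurs only
  within distance 1 of \<open>z\<close>, where \<open>q < 2\<close> makes it integrable. The
  constant depends on \<open>q\<close> alone, so it is uniform over all drifts.\<close>

lemma cauchy_potential_bound:
  assumes q: "0 \<le> q" "q < 2"
  shows "\<exists>C>0. \<forall>N H \<rho> z. young_pair N H q \<longrightarrow> \<rho> \<ge> 1 \<longrightarrow>
      (\<integral>\<^sup>+y. indicator (ball 0 \<rho>) y * ennreal (N y * inverse (norm (z - y))) \<partial>lborel) \<le> ennreal (C * (\<rho> + norm z))"
proof -
  obtain C1 where C1: "C1 \<ge> 0"
    "\<And>r z. r > 0 \<Longrightarrow> (\<integral>\<^sup>+y. indicator (ball z r) y * ennreal (inverse (norm (z - y))) \<partial>(lborel :: complex measure)) \<le> ennreal (C1 * r)"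
    using nn_integral_inverse_norm_ball by blast
  define I where "I = (\<integral>\<^sup>+z. indicator (ball 0 1) z * ennreal (norm z powr (- q)) \<partial>(lborel :: complex measure))"
  have "I < \<infinity>" unfolding I_def by (rule nn_integral_norm_powr_ball[OF q])
  then obtain C2 where C2: "C2 \<ge> 0" "I = ennreal C2" by (cases I) auto
  show ?thesis
  proof (intro exI[of _ "C1 + 1 + C2"] conjI allI impI)
    show "C1 + 1 + C2 > 0" using C1 C2 by simp
    fix N H :: "complex \<Rightarrow> real" and \<rho> :: real and z :: complex
    assume "young_pair N H q" and \<rho>: "\<rho> \<ge> 1"
    then interpret young_pair N H q by simp
    have [measurable]: "ball x r \<in> sets borel" for x :: complex and r by simp
    have [measurable]: "(\<lambda>y. indicator (ball z r) y * ennreal (inverse (norm (z - y)))) \<in> borel_measurable borel"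
      "(\<lambda>y. indicator (ball z 1) y * ennreal (norm (z - y) powr (- q))) \<in> borel_measurable borel"
      "(\<lambda>y. indicator (ball 0 1) y * ennreal (cmod y powr (- q))) \<in> borel_measurable borel" for r
      by measurable
    have trans: "(\<integral>\<^sup>+y. indicator (ball z 1) y * ennreal (norm (z - y) powr (- q)) \<partial>lborel) = I"
      unfolding I_def
      by (subst (2) lborel_distr_reflect[of z, symmetric], subst nn_integral_distr)
        (auto simp: indicator_def dist_norm norm_minus_commute intro!: nn_integral_cong)
    have "(\<integral>\<^sup>+y. indicator (ball 0 \<rho>) y * ennreal (N y * inverse (norm (z - y))) \<partial>(lborel :: complex measure))
      \<le> (\<integral>\<^sup>+y. indicator (ball z (\<rho> + norm z)) y * ennreal (inverse (norm (z - y))) + (ennreal (H y)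
           + indicator (ball z 1) y * ennreal (norm (z - y) powr (- q))) \<partial>lborel)"
    proof (rule nn_integral_mono)
      fix y
      show "indicator (ball 0 \<rho>) y * ennreal (N y * inverse (norm (z - y))) \<le>
        indicator (ball z (\<rho> + norm z)) y * ennreal (inverse (norm (z - y))) + (ennreal (H y)
           + indicator (ball z 1) y * ennreal (norm (z - y) powr (- q)))"
      proof (cases "y \<in> ball 0 \<rho>")
        case True
        then have y1: "y \<in> ball z (\<rho> + norm z)"
          using norm_triangle_ineq4[of z y] by (simp add: dist_norm)
        let ?t = "inverse (norm (z - y))"
        let ?E = "if ?t > 1 then ?t powr q else 0"
        have E: "ennreal ?E \<le> indicator (ball z 1) y * ennreal (norm (z - y) powr (- q))"
        proof (cases "?t > 1")
          case True
          then have "norm (z - y) < 1"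
            by (metis less_le_not_le linorder_not_le norm_ge_zero one_less_inverse_iff)
          then show ?thesis using True
            by (simp add: dist_norm powr_minus inverse_powr)
        qed auto
        have "ennreal (N y * ?t) \<le> ennreal (?t + (H y + ?E))"
          using young[of ?t y] by (intro ennreal_leI) (simp add: add.assoc)
        also have "\<dots> = ennreal ?t + (ennreal (H y) + ennreal ?E)"
          using H_nonneg[of y] by (simp add: ennreal_plus[symmetric] del: ennreal_plus)
        also have "\<dots> \<le> ennreal ?t + (ennreal (H y) + indicator (ball z 1) y * ennreal (norm (z - y) powr (- q)))"
          by (intro add_mono order_refl E)
        finally show ?thesis using True y1 by simp
      qed simp
    qed
    also have "\<dots> = (\<integral>\<^sup>+y. indicator (ball z (\<rho> + norm z)) y * ennreal (inverse (norm (z - y))) \<partial>lborel) + ((\<integral>\<^sup>+y. H y \<partial>lborel) + I)"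
      unfolding trans[symmetric] by (subst nn_integral_add; (subst nn_integral_add)?) auto
    also have "\<dots> \<le> ennreal (C1 * (\<rho> + norm z)) + (1 + ennreal C2)"
      using \<rho> by (intro add_mono C1(2) H_int eq_refl[OF C2(2)] add_pos_nonneg) auto
    also have "\<dots> = ennreal (C1 * (\<rho> + norm z) + (1 + C2))"
      using C1 C2 \<rho> by (simp add: ennreal_plus[symmetric] ennreal_1[symmetric] del: ennreal_plus ennreal_1)
    also have "\<dots> \<le> ennreal ((C1 + 1 + C2) * (\<rho> + norm z))"
    proof (rule ennreal_leI)
      have "(1 + C2) * 1 \<le> (1 + C2) * (\<rho> + norm z)"
        using C2 \<rho> norm_ge_zero[of z] by (intro mult_left_mono; linarith)
      then show "C1 * (\<rho> + norm z) + (1 + C2) \<le> (C1 + 1 + C2) * (\<rho> + norm z)"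
        by (simp add: algebra_simps)
    qed
    finally show "(\<integral>\<^sup>+y. indicator (ball 0 \<rho>) y * ennreal (N y * inverse (norm (z - y))) \<partial>(lborel :: complex measure)) \<le> ennreal ((C1 + 1 + C2) * (\<rho> + norm z))" .
  qed
qed

lemma integrable_cauchy_bounded:
  fixes k :: "complex \<Rightarrow> complex"
  assumes [measurable]: "k \<in> borel_measurable borel" and "\<And>y. norm (k y) \<le> M" "\<And>y. y \<notin> ball 0 r \<Longrightarrow> k y = 0"
  shows "integrable lborel (\<lambda>y. k y * inverse (z - y))"
proof (rule integrableI_bounded)
  show "(\<lambda>y. k y * inverse (z - y)) \<in> borel_measurable lborel" by measurable
  obtain C where C: "C \<ge> 0"
    "\<And>r z. r > 0 \<Longrightarrow> (\<integral>\<^sup>+y. indicator (ball z r) y * ennreal (inverse (norm (z - y))) \<partial>(lborel :: complex measure)) \<le> ennreal (C * r)"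
    using nn_integral_inverse_norm_ball by blast
  have [measurable]: "ball x r \<in> sets borel" for x :: complex and r by simp
  define s where "s = max 0 r + norm z + 1"
  have "s > 0" by (simp add: s_def add_nonneg_pos)
  have "(\<integral>\<^sup>+y. norm (k y * inverse (z - y)) \<partial>lborel) \<le> (\<integral>\<^sup>+y. ennreal M * (indicator (ball z s) y * ennreal (inverse (norm (z - y)))) \<partial>lborel)"
  proof (rule nn_integral_mono)
    fix y
    show "ennreal (norm (k y * inverse (z - y))) \<le> ennreal M * (indicator (ball z s) y * ennreal (inverse (norm (z - y))))"
    proof (cases "y \<in> ball 0 r")
      case True
      then have "y \<in> ball z s"
        using norm_triangle_ineq4[of z y] by (simp add: dist_norm s_def)
      moreover have "norm (k y * inverse (z - y)) \<le> M * inverse (norm (z - y))"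
        unfolding norm_mult norm_inverse by (intro mult_right_mono assms) auto
      moreover have "M \<ge> 0" using assms(2)[of y] norm_ge_zero order_trans by blast
      ultimately show ?thesis by (simp add: ennreal_mult[symmetric] ennreal_leI)
    qed (simp add: assms)
  qed
  also have "\<dots> = ennreal M * (\<integral>\<^sup>+y. indicator (ball z s) y * ennreal (inverse (norm (z - y))) \<partial>lborel)"
    by (rule nn_integral_cmult) measurable
  also have "\<dots> \<le> ennreal M * ennreal (C * s)"
    by (intro mult_left_mono C \<open>s > 0\<close>) auto
  also have "\<dots> < \<infinity>" by (simp add: ennreal_mult_less_top)
  finally show "(\<integral>\<^sup>+y. norm (k y * inverse (z - y)) \<partial>lborel) < \<infinity>" .
qed

text \<open>Differentiation under the integral sign away from the support of \<open>k\<close>. With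
  \<open>a = z - y\<close> the remainder of the kernel is \<open>h^2 / (a^2 (a + h))\<close>, so the
  difference quotient converges at a rate linear in \<open>norm h\<close>.\<close>

lemma cauchy_transform_holomorphic:
  fixes k :: "complex \<Rightarrow> complex"
  assumes [measurable]: "k \<in> borel_measurable borel" and bd: "\<And>y. norm (k y) \<le> M" "\<And>y. y \<notin> ball 0 r \<Longrightarrow> k y = 0"
    and U: "open U" "\<And>y. y \<in> U \<Longrightarrow> k y = 0"
  shows "(\<lambda>z. LINT y|lborel. k y * inverse (z - y)) holomorphic_on U"
proof (rule holomorphic_onI)
  fix z assume "z \<in> U"
  let ?V = "\<lambda>z. LINT y|lborel. k y * inverse (z - y)"
  obtain e where e: "e > 0" "ball z e \<subseteq> U" using U(1) \<open>z \<in> U\<close> open_contains_ball by blast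
  \<comment> \<open>The support of \<open>k\<close> has distance at least \<open>2 * d\<close> from
    \<open>z\<close>, so for \<open>norm h < d\<close> it keeps distance \<open>d\<close> from
    \<open>z + h\<close>.\<close>
  define d where "d = e / 2"
  have d: "d > 0" using e by (simp add: d_def)
  have far: "2 * d \<le> norm (z - y)" if "k y \<noteq> 0" for y
    using that U(2)[of y] e(2) by (force simp: d_def dist_norm)
  have ik: "integrable lborel (\<lambda>y. norm (k y))"
  proof (rule Bochner_Integration.integrable_bound[where f="\<lambda>y. M * indicator (ball 0 r) y"])
    show "integrable lborel (\<lambda>y. M * indicator (ball (0::complex) r) y)"
      using emeasure_lborel_ball_finite[of "0::complex" r] by (intro integrable_mult_right) (simp add: integrable_indicator_iff)
    show "AE y in lborel. norm (norm (k y)) \<le> norm (M * indicator (ball 0 r) y)"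
      using bd by (intro AE_I2) (auto simp: indicator_def intro: order_trans[OF bd(1)])
  qed measurable
  define L where "L = (LINT y|lborel. - k y * (inverse (z - y))\<^sup>2)"
  have iL: "integrable lborel (\<lambda>y. - k y * (inverse (z - y))\<^sup>2)"
  proof (rule Bochner_Integration.integrable_bound[where f="\<lambda>y. (inverse (2 * d))\<^sup>2 * norm (k y)"])
    show "AE y in lborel. norm (- k y * (inverse (z - y))\<^sup>2) \<le> norm ((inverse (2 * d))\<^sup>2 * norm (k y))"
    proof (rule AE_I2)
      fix y show "norm (- k y * (inverse (z - y))\<^sup>2) \<le> norm ((inverse (2 * d))\<^sup>2 * norm (k y))"
      proof (cases "k y = 0")
        case False
        have "(inverse (norm (z - y)))\<^sup>2 \<le> (inverse (2 * d))\<^sup>2"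
          using far[OF False] d by (intro power_mono le_imp_inverse_le) auto
        then show ?thesis
          by (simp add: norm_mult norm_power norm_inverse mult.commute mult_left_mono)
      qed simp
    qed
  qed (use ik in auto)
  have iV: "integrable lborel (\<lambda>y. k y * inverse (x - y))" for x
    by (rule integrable_cauchy_bounded[OF assms(1) bd])
  define I where "I = (LINT y|lborel. norm (k y))"
  have I: "I \<ge> 0" unfolding I_def by simp
  have main: "norm (?V (z + h) - ?V z - h * L) \<le> (I / (4 * d ^ 3)) * (norm h)\<^sup>2" if h: "norm h < d" for h
  proof -
    have ih: "integrable lborel (\<lambda>y. h * (- k y * (inverse (z - y))\<^sup>2))"
      by (intro integrable_mult_right iL)
    have eq: "?V (z + h) - ?V z - h * L = (LINT y|lborel. k y * inverse (z + h - y) - k y * inverse (z - y) - h * (- k y * (inverse (z - y))\<^sup>2))"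
      unfolding L_def
      by (simp only: Bochner_Integration.integral_diff[OF Bochner_Integration.integrable_diff[OF iV iV] ih]
          Bochner_Integration.integral_diff[OF iV iV] integral_mult_right_zero)
    have "norm (?V (z + h) - ?V z - h * L) \<le> (LINT y|lborel. norm (k y * inverse (z + h - y) - k y * inverse (z - y) - h * (- k y * (inverse (z - y))\<^sup>2)))"
      unfolding eq by (rule integral_norm_bound)
    also have "\<dots> \<le> (LINT y|lborel. norm (k y) * ((norm h)\<^sup>2 / (4 * d ^ 3)))"
    proof (rule integral_mono)
      show "integrable lborel (\<lambda>y. norm (k y * inverse (z + h - y) - k y * inverse (z - y) - h * (- k y * (inverse (z - y))\<^sup>2)))"
        by (rule integrable_norm[OF Bochner_Integration.integrable_diff[OF Bochner_Integration.integrable_diff[OF iV iV] ih]])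
      show "integrable lborel (\<lambda>y. norm (k y) * ((norm h)\<^sup>2 / (4 * d ^ 3)))" using ik by auto
      fix y
      show "norm (k y * inverse (z + h - y) - k y * inverse (z - y) - h * (- k y * (inverse (z - y))\<^sup>2)) \<le> norm (k y) * ((norm h)\<^sup>2 / (4 * d ^ 3))"
      proof (cases "k y = 0")
        case False
        let ?a = "z - y"
        have a: "norm ?a \<ge> 2 * d" using far[OF False] .
        have ah: "norm (?a + h) \<ge> d" using norm_diff_ineq[of ?a h] a h by linarith
        have ne: "?a \<noteq> 0" "?a + h \<noteq> 0" using a ah d by auto
        have "k y * inverse (z + h - y) - k y * inverse ?a - h * (- k y * (inverse ?a)\<^sup>2) = k y * (h\<^sup>2 / (?a\<^sup>2 * (?a + h)))"
        proof -
          have "inverse (?a + h) - inverse ?a + h * (inverse ?a)\<^sup>2 = h\<^sup>2 / (?a\<^sup>2 * (?a + h))"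
          proof -
            obtain u v where uv: "u = inverse (?a + h)" "v = inverse ?a" by blast
            have "u * (?a + h) = 1" "v * ?a = 1" using ne by (simp_all add: uv)
            then have "(u - v + h * v\<^sup>2) * (?a\<^sup>2 * (?a + h)) = h\<^sup>2" by algebra
            then show ?thesis
              using ne by (simp add: uv nonzero_eq_divide_eq)
          qed
          moreover have "k y * inverse (z + h - y) - k y * inverse ?a - h * (- k y * (inverse ?a)\<^sup>2) =
              k y * (inverse (?a + h) - inverse ?a + h * (inverse ?a)\<^sup>2)"
          proof -
            have "z + h - y = ?a + h" by simp
            then show ?thesis by (simp only: right_diff_distrib distrib_left) simp
          qed
          ultimately show ?thesis by (simp only:)
        qed
        moreover have "norm (h\<^sup>2 / (?a\<^sup>2 * (?a + h))) \<le> (norm h)\<^sup>2 / (4 * d ^ 3)"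
        proof -
          have "(2 * d)\<^sup>2 * d \<le> (norm ?a)\<^sup>2 * norm (?a + h)"
            using a ah d by (intro mult_mono power_mono) auto
          then have "(norm h)\<^sup>2 / ((norm ?a)\<^sup>2 * norm (?a + h)) \<le> (norm h)\<^sup>2 / ((2 * d)\<^sup>2 * d)"
            using d ne by (intro divide_left_mono mult_pos_pos) (simp_all del: power_mult_distrib)
          then show ?thesis
            by (simp add: norm_divide norm_mult norm_power power2_eq_square power3_eq_cube mult_ac)
        qed
        ultimately show ?thesis
          by (simp add: norm_mult mult_left_mono del: times_divide_eq_right)
      qed simp
    qed
    also have "\<dots> = (I / (4 * d ^ 3)) * (norm h)\<^sup>2"
      by (simp add: I_def)
    finally show ?thesis .
  qed
  have "(?V has_field_derivative L) (at z)"
    unfolding DERIV_def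
  proof (rule LIM_zero_cancel, rule tendsto_0_le[where K="I / (4 * d ^ 3)"])
    show "((\<lambda>h::complex. h) \<longlongrightarrow> 0) (at 0)" by (rule tendsto_ident_at)
    have "\<forall>\<^sub>F h in at 0. h \<in> ball (0::complex) d - {0}"
      using d by (intro eventually_at_in_open) auto
    then show "\<forall>\<^sub>F h in at 0. norm ((?V (z + h) - ?V z) / h - L) \<le> norm h * (I / (4 * d ^ 3))"
    proof eventually_elim
      case (elim h)
      then have h: "norm h < d" "norm h > 0" by auto
      have "norm ((?V (z + h) - ?V z) / h - L) = norm (?V (z + h) - ?V z - h * L) / norm h"
        using h by (simp add: norm_divide[symmetric] diff_divide_distrib)
      also have "\<dots> \<le> (I / (4 * d ^ 3)) * (norm h)\<^sup>2 / norm h"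
        using main[OF h(1)] by (intro divide_right_mono) auto
      finally show ?case
        using h by (simp add: power2_eq_square mult.commute)
    qed
  qed
  then show "?V field_differentiable at z within U"
    using field_differentiable_at_within field_differentiable_def by blast
qed

section \<open>Weakly holomorphic functions and the similarity principle\<close>

lemma dbar_mult_left: "dbar (\<lambda>h. c * L h) = c * dbar L"
  by (simp add: dbar_def algebra_simps)

lemma dbar_add: "dbar (\<lambda>h. L h + M h) = dbar L + dbar M"
  by (simp add: dbar_def algebra_simps)

lemma dbar_mult_right: "dbar (\<lambda>h. L h * c) = dbar L * c"
  by (simp add: dbar_def algebra_simps)

lemma dbar_uminus: "dbar (\<lambda>h. - L h) = - dbar L"
  by (simp add: dbar_def algebra_simps)

lemma continuous_dbar:
  assumes "C1_deriv \<psi> \<psi>'"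
  shows "continuous_on S (\<lambda>z. dbar (\<psi>' z))"
  unfolding dbar_def by (intro continuous_intros C1_derivD(2)[OF assms])

lemma dbar_zero_outside:
  assumes "C1_deriv \<psi> \<psi>'" "closed S" "\<And>z. z \<notin> S \<Longrightarrow> \<psi> z = 0" "z \<notin> S"
  shows "dbar (\<psi>' z) = 0"
  using has_derivative_zero_outside[OF C1_derivD(1)[OF assms(1)] assms(2-4)] by (simp add: dbar_def)

text \<open>
  Weyl's lemma in quantitative form: testing with \<open>\<zeta> \<mapsto> \<theta> \<zeta> * reg_cauchy \<delta> (z - \<zeta>)\<close> turns weak
  holomorphy into the identity \<open>(h \<theta>) * poisson2 \<delta> = (h dbar \<theta>) * reg_cauchy \<delta>\<close> of convolutions.
\<close>

lemma weakly_holomorphic_representation: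
  fixes h :: "complex \<Rightarrow> complex"
  assumes hm [measurable]: "h \<in> borel_measurable borel"
    and hb: "\<And>z. z \<in> S \<Longrightarrow> norm (h z) \<le> M"
    and S: "compact S"
    and weak: "\<And>\<psi> \<psi>'. C1_deriv \<psi> \<psi>' \<Longrightarrow> (\<And>z. z \<notin> S \<Longrightarrow> \<psi> z = 0) \<Longrightarrow> (LINT z|lborel. h z * dbar (\<psi>' z)) = 0"
    and \<theta>: "C1_deriv \<theta> \<theta>'" "\<And>z. z \<notin> S \<Longrightarrow> \<theta> z = 0"
  shows "AE z in lborel. of_real kap * (h z * \<theta> z) = (LINT y|lborel. h y * dbar (\<theta>' y) * inverse (z - y))"
proof -
  define g where "g z = h z * \<theta> z" for z
  define k where "k z = h z * dbar (\<theta>' z)" for z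
  have [measurable]: "\<theta> \<in> borel_measurable borel" "(\<lambda>z. dbar (\<theta>' z)) \<in> borel_measurable borel"
    using C1_derivD(4)[OF \<theta>(1)] continuous_dbar[OF \<theta>(1)] borel_measurable_continuous_onI by blast+
  have gm [measurable]: "g \<in> borel_measurable borel" and km [measurable]: "k \<in> borel_measurable borel"
    unfolding g_def k_def by measurable
  have d0: "dbar (\<theta>' z) = 0" if "z \<notin> S" for z
    by (rule dbar_zero_outside[OF \<theta>(1) compact_imp_closed[OF S] \<theta>(2) that])
  have g0: "g z = 0" and k0: "k z = 0" if "z \<notin> S" for z
    using \<theta>(2)[OF that] d0[OF that] by (auto simp: g_def k_def)
  obtain r where r: "r > 0" "S \<subseteq> ball 0 r"
    using compact_imp_bounded[OF S] bounded_subset_ballD by blast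
  have kball: "k y = 0" if "y \<notin> ball 0 r" for y
    using that r(2) k0[of y] by blast
  obtain B1 B2 where B1: "B1 \<ge> 0" "\<And>z. norm (\<theta> z) \<le> B1" and B2: "B2 \<ge> 0" "\<And>z. norm (dbar (\<theta>' z)) \<le> B2"
    using continuous_compact_support_bounded[OF C1_derivD(4)[OF \<theta>(1)] S \<theta>(2)]
      continuous_compact_support_bounded[OF continuous_dbar[OF \<theta>(1)] S d0] by metis
  have bd: "norm (h z * c) \<le> \<bar>M\<bar> * B" if "norm c \<le> B" "B \<ge> 0" "z \<notin> S \<Longrightarrow> c = 0" for z c B
  proof (cases "z \<in> S")
    case True
    then show ?thesis unfolding norm_mult using hb[OF True] that by (intro mult_mono) auto
  qed (use that in auto)
  have gb: "norm (g z) \<le> \<bar>M\<bar> * B1" and kb: "norm (k z) \<le> \<bar>M\<bar> * B2" for z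
    unfolding g_def k_def using B1 B2 \<theta>(2) d0 by (auto intro!: bd)
  have bint: "integrable lborel F" if "F \<in> borel_measurable borel" "\<And>z. norm (F z) \<le> B" "\<And>z. z \<notin> S \<Longrightarrow> F z = 0"
    for F :: "complex \<Rightarrow> complex" and B
  proof (rule Bochner_Integration.integrable_bound[where f="\<lambda>z. B * indicator (ball 0 r) z"])
    show "integrable lborel (\<lambda>z. B * indicator (ball (0::complex) r) z)"
      using emeasure_lborel_ball_finite[of "0::complex" r] by (intro integrable_mult_right) (simp add: integrable_indicator_iff)
    show "AE z in lborel. norm (F z) \<le> norm (B * indicator (ball 0 r) z)"
    proof (rule AE_I2)
      fix z show "norm (F z) \<le> norm (B * indicator (ball 0 r) z)"
        using that(2)[of z] that(3)[of z] r(2) by (cases "z \<in> S") (auto simp: indicator_def subset_iff)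
    qed
  qed (use that in auto)
  have gi: "integrable lborel g" and ki: "integrable lborel k"
    using bint[OF gm gb g0] bint[OF km kb k0] by blast+
  define V where "V z = (LINT y|lborel. k y * inverse (z - y))" for z
  define \<delta> where "\<delta> n = inverse (real (Suc n))" for n
  have \<delta>: "\<delta> n > 0" "\<delta> \<longlonglongrightarrow> 0" for n
    unfolding \<delta>_def[abs_def] by (simp, rule LIMSEQ_inverse_real_of_nat)
  define P where "P n z = (LINT y|lborel. g y * of_real (poisson2 (\<delta> n) (z - y)))" for n z
  have P_eq: "P n z = (LINT y|lborel. k y * reg_cauchy (\<delta> n) (z - y))" for n z
  proof -
    note C = C1_mult[OF \<theta>(1) C1_reflect[OF reg_cauchy_C1[OF \<delta>(1)[of n]], of z]]
    have "(LINT y|lborel. h y * dbar (\<lambda>h. \<theta> y * - reg_cauchy' (\<delta> n) (z - y) h + \<theta>' y h * reg_cauchy (\<delta> n) (z - y))) = 0"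
      by (rule weak[OF C]) (simp add: \<theta>(2))
    moreover have "h y * dbar (\<lambda>h. \<theta> y * - reg_cauchy' (\<delta> n) (z - y) h + \<theta>' y h * reg_cauchy (\<delta> n) (z - y)) =
        k y * reg_cauchy (\<delta> n) (z - y) - g y * of_real (poisson2 (\<delta> n) (z - y))" for y
      unfolding dbar_add dbar_mult_left dbar_mult_right dbar_uminus dbar_reg_cauchy[OF \<delta>(1)]
      by (simp add: g_def k_def algebra_simps)
    moreover have "integrable lborel (\<lambda>y. k y * reg_cauchy (\<delta> n) (z - y))"
      by (rule conv_integrable[OF ki S _ C1_derivD(4)[OF reg_cauchy_C1[OF \<delta>(1)]]]) (rule k0)
    moreover have "integrable lborel (\<lambda>y. g y * of_real (poisson2 (\<delta> n) (z - y)))"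
      by (rule integrable_mult_poisson2[OF gi \<delta>(1)])
    ultimately show ?thesis by (simp add: P_def)
  qed
  have Pm [measurable]: "P n \<in> borel_measurable borel" for n
    unfolding P_eq[abs_def]
    by (intro borel_measurable_continuous_onI conv_continuous[OF ki S _ C1_derivD(4)[OF reg_cauchy_C1[OF \<delta>(1)]]]) (rule k0)
  have lim: "(\<lambda>n. P n z) \<longlonglongrightarrow> V z" for z
    unfolding P_eq V_def
  proof (rule integral_dominated_convergence[where w="\<lambda>y. norm (k y * inverse (z - y))"])
    show "integrable lborel (\<lambda>y. norm (k y * inverse (z - y)))"
      using kball by (intro integrable_norm integrable_cauchy_bounded[OF km kb, of r])
    show "AE y in lborel. (\<lambda>n. k y * reg_cauchy (\<delta> n) (z - y)) \<longlonglongrightarrow> k y * inverse (z - y)"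
      by (intro AE_I2 tendsto_mult tendsto_const reg_cauchy_tendsto \<delta>)
    show "AE y in lborel. norm (k y * reg_cauchy (\<delta> n) (z - y)) \<le> norm (k y * inverse (z - y))" for n
      by (intro AE_I2) (auto simp: norm_mult norm_inverse intro!: mult_left_mono norm_reg_cauchy_le)
  qed measurable
  have [measurable]: "V \<in> borel_measurable borel"
    by (rule borel_measurable_LIMSEQ_metric[OF Pm lim])
  \<comment> \<open>\<open>P n\<close> converges pointwise to the Cauchy transform \<open>V\<close>
    and in L1 to \<open>kap * g\<close>; Fatou's lemma identifies the two limits almost
    everywhere.\<close>
  have "(\<integral>\<^sup>+z. norm (V z - of_real kap * g z) \<partial>lborel) = (\<integral>\<^sup>+z. liminf (\<lambda>n. ennreal (norm (P n z - of_real kap * g z))) \<partial>lborel)"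
  proof (intro nn_integral_cong)
    fix z
    have "(\<lambda>n. ennreal (norm (P n z - of_real kap * g z))) \<longlonglongrightarrow> ennreal (norm (V z - of_real kap * g z))"
      by (intro tendsto_ennrealI tendsto_norm tendsto_diff lim tendsto_const)
    from lim_imp_Liminf[OF _ this] show "ennreal (norm (V z - of_real kap * g z)) = liminf (\<lambda>n. ennreal (norm (P n z - of_real kap * g z)))"
      by simp
  qed
  also have "\<dots> \<le> liminf (\<lambda>n. \<integral>\<^sup>+z. norm (P n z - of_real kap * g z) \<partial>lborel)"
    by (rule nn_integral_liminf) measurable
  also have "\<dots> = 0"
    using lim_imp_Liminf[OF _ mollify_L1[OF gi \<delta>]] unfolding P_def by simp
  finally have "(\<integral>\<^sup>+z. norm (V z - of_real kap * g z) \<partial>lborel) = 0" by simp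
  then have "AE z in lborel. ennreal (norm (V z - of_real kap * g z)) = 0"
    by (subst (asm) nn_integral_0_iff_AE) auto
  then show ?thesis
    by eventually_elim (simp add: V_def g_def k_def mult.assoc)
qed

section \<open>The similarity principle for the first order system\<close>

context young_pair
begin

lemma H_integrable: "integrable lborel H"
proof -
  have "(\<integral>\<^sup>+z. norm (H z) \<partial>lborel) < \<infinity>"
    using H_int H_nonneg by (simp add: less_le_trans[OF _ order_refl] le_less_trans)
  then show ?thesis by (intro integrableI_bounded) auto
qed

lemma N_le: "N z \<le> 1 + H z"
  using young[of 1 z] by simp

text \<open>By \<open>N_le\<close> the dominating function splits into a constant on a ball and the
  integrable \<open>H\<close>, whatever the exponent of the drift.\<close>

lemma integrable_restrict:
  fixes F :: "complex \<Rightarrow> 'b::{banach, second_countable_topology}"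
  assumes [measurable]: "F \<in> borel_measurable borel" and "\<And>z. norm (F z) \<le> B * N z" "B \<ge> 0" "\<And>z. z \<notin> ball 0 r \<Longrightarrow> F z = 0"
  shows "integrable lborel F"
proof (rule Bochner_Integration.integrable_bound[where f="\<lambda>z. B * (indicator (ball 0 r) z + H z)"])
  show "integrable lborel (\<lambda>z. B * (indicator (ball (0::complex) r) z + H z))"
    using emeasure_lborel_ball_finite[of "0::complex" r]
    by (intro integrable_mult_right Bochner_Integration.integrable_add H_integrable) (simp add: integrable_indicator_iff)
  show "AE z in lborel. norm (F z) \<le> norm (B * (indicator (ball 0 r) z + H z))"
  proof (rule AE_I2)
    fix z show "norm (F z) \<le> norm (B * (indicator (ball 0 r) z + H z))"
    proof (cases "z \<in> ball 0 r")
      case True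
      have "B * N z \<le> B * (1 + H z)" using N_le assms(3) by (intro mult_left_mono) auto
      then have "norm (F z) \<le> B * (1 + H z)" using assms(2)[of z] by linarith
      then show ?thesis using True H_nonneg[of z] assms(3) by (simp add: abs_of_nonneg)
    qed (simp add: assms(4))
  qed
qed measurable

end

text \<open>\<open>weak_eq\<close> is the weak form of \<open>D f = a f\<close> outside the closed
  unit disc; moving \<open>D\<close> onto \<open>\<psi>\<close> changes a sign, so both terms carry
  a plus.\<close>

locale drift_system = young_pair +
  fixes f a :: "complex \<Rightarrow> complex"
  assumes f_measurable [measurable]: "f \<in> borel_measurable borel"
    and a_measurable [measurable]: "a \<in> borel_measurable borel"
    and f_bound: "norm (f z) \<le> 1"
    and a_bound: "norm (a z) \<le> N z"
    and weak_eq: "C1_deriv \<psi> \<psi>' \<Longrightarrow> compact S \<Longrightarrow> S \<subseteq> - cball 0 1 \<Longrightarrow> (\<And>z. z \<notin> S \<Longrightarrow> \<psi> z = 0) \<Longrightarrow>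
      (LINT z|lborel. f z * dbar (\<psi>' z) + a z * f z * \<psi> z) = 0"
begin

text \<open>The Cauchy transform of \<open>a\<close> cut off to a disc. Dividing by
  \<open>kap\<close>, the mass of \<open>D (1 / z)\<close>, makes it a solution of
  \<open>D w = a\<close> in that disc.\<close>

definition potential :: "real \<Rightarrow> complex \<Rightarrow> complex" where
  "potential \<rho> z = (LINT y|lborel. (indicator (ball 0 \<rho>) y * a y) * inverse (z - y)) / of_real kap"

lemma potential_integrable:
  assumes "\<rho> \<ge> 1" and C: "\<And>z. (\<integral>\<^sup>+y. indicator (ball 0 \<rho>) y * ennreal (N y * inverse (norm (z - y))) \<partial>lborel) \<le> ennreal (C * (\<rho> + norm z))"
  shows "integrable lborel (\<lambda>y. (indicator (ball 0 \<rho>) y * a y) * inverse (z - y))"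
    and "(LINT y|lborel. norm ((indicator (ball 0 \<rho>) y * a y) * inverse (z - y))) \<le> \<bar>C\<bar> * (\<rho> + norm z)"
proof -
  have [measurable]: "ball (0::complex) \<rho> \<in> sets borel" by simp
  have le: "(\<integral>\<^sup>+y. norm ((indicator (ball 0 \<rho>) y * a y) * inverse (z - y)) \<partial>lborel) \<le> ennreal (\<bar>C\<bar> * (\<rho> + norm z))"
  proof -
    have "(\<integral>\<^sup>+y. norm ((indicator (ball 0 \<rho>) y * a y) * inverse (z - y)) \<partial>lborel) \<le>
      (\<integral>\<^sup>+y. indicator (ball 0 \<rho>) y * ennreal (N y * inverse (norm (z - y))) \<partial>lborel)"
      by (rule nn_integral_mono)
        (auto simp: indicator_def norm_mult norm_inverse intro!: ennreal_leI mult_right_mono a_bound)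
    also note C
    also have "ennreal (C * (\<rho> + norm z)) \<le> ennreal (\<bar>C\<bar> * (\<rho> + norm z))"
      using assms(1) by (intro ennreal_leI mult_right_mono) auto
    finally show ?thesis .
  qed
  show i: "integrable lborel (\<lambda>y. (indicator (ball 0 \<rho>) y * a y) * inverse (z - y))"
  proof (rule integrableI_bounded)
    show "(\<integral>\<^sup>+y. norm ((indicator (ball 0 \<rho>) y * a y) * inverse (z - y)) \<partial>lborel) < \<infinity>"
      using le by (rule le_less_trans) simp
  qed measurable
  have "ennreal (LINT y|lborel. norm ((indicator (ball 0 \<rho>) y * a y) * inverse (z - y))) \<le> ennreal (\<bar>C\<bar> * (\<rho> + norm z))"
    using le nn_integral_eq_integral[OF integrable_norm[OF i]] by simp
  then show "(LINT y|lborel. norm ((indicator (ball 0 \<rho>) y * a y) * inverse (z - y))) \<le> \<bar>C\<bar> * (\<rho> + norm z)"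
    using assms(1) by (subst (asm) ennreal_le_iff) (auto intro!: mult_nonneg_nonneg add_nonneg_nonneg)
qed

text \<open>The mollified potentials \<open>w n\<close> are \<open>C^1\<close>, so
  \<open>exp (- w n) * \<psi>\<close> may be used as a test function. The product rule leaves the
  desired integrand plus an error with the factor \<open>\<alpha> - dbar (w' n z)\<close>, which
  tends to 0 in L1 by \<open>mollify_L1\<close>; all other factors are bounded uniformly in
  \<open>n\<close> because the kernels are dominated by \<open>1 / |z|\<close>.\<close>

lemma similarity:
  assumes "\<rho> \<ge> 1" and C: "C \<ge> 0" "\<And>z. (\<integral>\<^sup>+y. indicator (ball 0 \<rho>) y * ennreal (N y * inverse (norm (z - y))) \<partial>lborel) \<le> ennreal (C * (\<rho> + norm z))"
  shows "potential \<rho> \<in> borel_measurable borel"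
    and "norm (potential \<rho> z) \<le> C / kap * (\<rho> + norm z)"
    and "C1_deriv \<psi> \<psi>' \<Longrightarrow> compact S \<Longrightarrow> S \<subseteq> ball 0 \<rho> - cball 0 1 \<Longrightarrow> (\<And>z. z \<notin> S \<Longrightarrow> \<psi> z = 0) \<Longrightarrow>
      (LINT z|lborel. (f z * exp (- potential \<rho> z)) * dbar (\<psi>' z)) = 0"
proof -
  define \<alpha> where "\<alpha> y = indicator (ball 0 \<rho>) y * a y" for y
  have [measurable]: "ball (0::complex) \<rho> \<in> sets borel" by simp
  have \<alpha>m [measurable]: "\<alpha> \<in> borel_measurable borel" unfolding \<alpha>_def by measurable
  have N0: "N z \<ge> 0" for z using a_bound[of z] norm_ge_zero order_trans by blast
  have \<alpha>i: "integrable lborel \<alpha>"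
    by (rule integrable_restrict[of _ 1 \<rho>]) (use a_bound N0 in \<open>auto simp: \<alpha>_def indicator_def\<close>)
  have \<alpha>0: "\<alpha> y = 0" if "y \<notin> cball 0 \<rho>" for y
    using that by (auto simp: \<alpha>_def indicator_def)
  note pot = potential_integrable[OF assms(1) C(2), folded \<alpha>_def, unfolded abs_of_nonneg[OF C(1)]]
  have pot_eq: "potential \<rho> z = (LINT y|lborel. \<alpha> y * inverse (z - y)) / of_real kap" for z
    by (simp add: potential_def \<alpha>_def)
  define \<delta> where "\<delta> n = inverse (real (Suc n))" for n
  have \<delta>: "\<delta> n > 0" "\<delta> \<longlonglongrightarrow> 0" for n
    unfolding \<delta>_def[abs_def] by (simp, rule LIMSEQ_inverse_real_of_nat)
  define w where "w n z = (LINT y|lborel. \<alpha> y * reg_cauchy (\<delta> n) (z - y)) / of_real kap" for n z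
  define w' where "w' n z h = (LINT y|lborel. \<alpha> y * reg_cauchy' (\<delta> n) (z - y) h) / of_real kap" for n z h
  have rc: "continuous_on UNIV (reg_cauchy (\<delta> n))" for n
    by (rule C1_derivD(4)[OF reg_cauchy_C1[OF \<delta>(1)]])
  have wC: "C1_deriv (w n) (w' n)" for n
  proof -
    have 1: "C1_deriv (\<lambda>z. LINT y|lborel. \<alpha> y * reg_cauchy (\<delta> n) (z - y)) (\<lambda>z h. LINT y|lborel. \<alpha> y * reg_cauchy' (\<delta> n) (z - y) h)"
      by (rule conv_C1_deriv[OF \<alpha>i compact_cball \<alpha>0 reg_cauchy_C1[OF \<delta>(1)]])
    show ?thesis
      using C1_mult[OF 1 C1_const[of "inverse (of_real kap)"]]
      unfolding w_def[abs_def] w'_def[abs_def] by (simp add: divide_inverse)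
  qed
  have dbar_w: "of_real kap * dbar (w' n z) = (LINT y|lborel. \<alpha> y * of_real (poisson2 (\<delta> n) (z - y)))" for n z
  proof -
    have i: "integrable lborel (\<lambda>y. \<alpha> y * reg_cauchy' (\<delta> n) (z - y) h)" for h
      by (rule conv_integrable[OF \<alpha>i compact_cball \<alpha>0 C1_derivD(2)[OF reg_cauchy_C1[OF \<delta>(1)]]])
    have "of_real kap * dbar (w' n z) = (LINT y|lborel. \<alpha> y * reg_cauchy' (\<delta> n) (z - y) 1) + \<i> * (LINT y|lborel. \<alpha> y * reg_cauchy' (\<delta> n) (z - y) \<i>)"
      using kap_pos by (simp add: dbar_def w'_def distrib_left)
    also have "\<dots> = (LINT y|lborel. \<alpha> y * dbar (reg_cauchy' (\<delta> n) (z - y)))"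
      using i[of 1] i[of \<i>] by (simp add: dbar_def distrib_left mult.left_commute[of _ \<i>])
    finally show ?thesis unfolding dbar_reg_cauchy[OF \<delta>(1)] .
  qed
  have dom: "norm (\<alpha> y * reg_cauchy (\<delta> n) (z - y)) \<le> norm (\<alpha> y * inverse (z - y))" for n z y
    by (auto simp: norm_mult norm_inverse intro!: mult_left_mono norm_reg_cauchy_le)
  have wlim: "(\<lambda>n. w n z) \<longlonglongrightarrow> potential \<rho> z" for z
    unfolding w_def pot_eq
  proof (intro tendsto_divide tendsto_const)
    show "(\<lambda>n. LINT y|lborel. \<alpha> y * reg_cauchy (\<delta> n) (z - y)) \<longlonglongrightarrow> (LINT y|lborel. \<alpha> y * inverse (z - y))"
    proof (rule integral_dominated_convergence[where w="\<lambda>y. norm (\<alpha> y * inverse (z - y))"])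
      show "integrable lborel (\<lambda>y. norm (\<alpha> y * inverse (z - y)))"
        by (intro integrable_norm pot(1))
      show "AE y in lborel. (\<lambda>n. \<alpha> y * reg_cauchy (\<delta> n) (z - y)) \<longlonglongrightarrow> \<alpha> y * inverse (z - y)"
        by (intro AE_I2 tendsto_mult tendsto_const reg_cauchy_tendsto \<delta>)
      show "AE y in lborel. norm (\<alpha> y * reg_cauchy (\<delta> n) (z - y)) \<le> norm (\<alpha> y * inverse (z - y))" for n
        by (intro AE_I2 dom)
    qed measurable
  qed (use kap_pos in simp)
  have wb: "norm (w n z) \<le> C / kap * (\<rho> + norm z)" for n z
  proof -
    have "norm (LINT y|lborel. \<alpha> y * reg_cauchy (\<delta> n) (z - y)) \<le> (LINT y|lborel. norm (\<alpha> y * reg_cauchy (\<delta> n) (z - y)))"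
      by (rule integral_norm_bound)
    also have "\<dots> \<le> (LINT y|lborel. norm (\<alpha> y * inverse (z - y)))"
      by (intro integral_mono integrable_norm dom pot(1) conv_integrable[OF \<alpha>i compact_cball \<alpha>0 rc])
    also note pot(2)
    finally show ?thesis
      using kap_pos by (simp add: w_def norm_divide divide_right_mono)
  qed
  have wm [measurable]: "w n \<in> borel_measurable borel" for n
    by (rule borel_measurable_continuous_onI[OF C1_derivD(4)[OF wC]])
  show pm [measurable]: "potential \<rho> \<in> borel_measurable borel"
    by (rule borel_measurable_LIMSEQ_metric[OF wm wlim])
  show "norm (potential \<rho> z) \<le> C / kap * (\<rho> + norm z)"
    by (rule LIMSEQ_le_const2[OF tendsto_norm[OF wlim]]) (use wb in auto)
  assume \<psi>: "C1_deriv \<psi> \<psi>'" and S: "compact S" "S \<subseteq> ball 0 \<rho> - cball 0 1" and \<psi>0: "\<And>z. z \<notin> S \<Longrightarrow> \<psi> z = 0"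
  have d0: "dbar (\<psi>' z) = 0" if "z \<notin> S" for z
    by (rule dbar_zero_outside[OF \<psi> compact_imp_closed[OF S(1)] \<psi>0 that])
  obtain B1 B2 where B1: "B1 \<ge> 0" "\<And>z. norm (\<psi> z) \<le> B1" and B2: "B2 \<ge> 0" "\<And>z. norm (dbar (\<psi>' z)) \<le> B2"
    using continuous_compact_support_bounded[OF C1_derivD(4)[OF \<psi>] S(1) \<psi>0]
      continuous_compact_support_bounded[OF continuous_dbar[OF \<psi>] S(1) d0] by metis
  have [measurable]: "\<psi> \<in> borel_measurable borel" "(\<lambda>z. dbar (\<psi>' z)) \<in> borel_measurable borel"
    "(\<lambda>z. dbar (w' n z)) \<in> borel_measurable borel" for n
    using C1_derivD(4)[OF \<psi>] continuous_dbar[OF \<psi>] continuous_dbar[OF wC] borel_measurable_continuous_onI by blast+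
  define E where "E = exp (C / kap * (2 * \<rho>))"
  have Eb: "norm (exp (- u)) \<le> E" if "norm u \<le> C / kap * (\<rho> + norm z)" "z \<in> S" for u z :: complex
  proof -
    have "norm z < \<rho>" using that S(2) by auto
    then have "C / kap * (\<rho> + norm z) \<le> C / kap * (2 * \<rho>)"
      using C kap_pos by (intro mult_left_mono) auto
    moreover have "Re (- u) \<le> norm u" using complex_Re_le_cmod[of "- u"] by simp
    ultimately show ?thesis using that by (simp add: E_def)
  qed
  \<comment> \<open>\<open>X\<close> carries the derivative of \<open>\<psi>\<close> and converges
    by domination; \<open>Y\<close> collects the equation for \<open>f\<close> against the
    derivative of \<open>exp (- w n)\<close> and vanishes in the limit.\<close>
  define X where "X n z = f z * exp (- w n z) * dbar (\<psi>' z)" for n z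
  define Y where "Y n z = (\<alpha> z - dbar (w' n z)) * (f z * exp (- w n z) * \<psi> z)" for n z
  have ball_int: "integrable lborel (\<lambda>z. (E * B2) * indicator (ball (0::complex) \<rho>) z)"
    using emeasure_lborel_ball_finite[of "0::complex" \<rho>] by (intro integrable_mult_right) (simp add: integrable_indicator_iff)
  have Xb: "norm (f z * exp (- u) * dbar (\<psi>' z)) \<le> (E * B2) * indicator (ball 0 \<rho>) z"
    if "norm u \<le> C / kap * (\<rho> + norm z)" for u z :: complex
  proof (cases "z \<in> S")
    case True
    then have "indicat_real (ball 0 \<rho>) z = 1" using S(2) by (auto simp: indicator_def)
    moreover have "norm (f z * exp (- u) * dbar (\<psi>' z)) \<le> 1 * E * B2"
      unfolding norm_mult using f_bound Eb[OF that True] B2 by (intro mult_mono) (auto simp: E_def)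
    ultimately show ?thesis by simp
  qed (use B2 in \<open>auto simp: d0 E_def\<close>)
  have Xi: "integrable lborel (X n)" for n
    unfolding X_def using wb Xb
    by (intro Bochner_Integration.integrable_bound[OF ball_int]) (auto intro!: AE_I2 order_trans[OF _ abs_ge_self])
  have zero: "(LINT z|lborel. X n z + Y n z) = 0" for n
  proof -
    have ew: "C1_deriv (\<lambda>z. exp (- w n z)) (\<lambda>z h. - (exp (- w n z) * w' n z h))"
    proof (rule C1_derivI)
      show "((\<lambda>z. exp (- w n z)) has_derivative (\<lambda>h. - (exp (- w n z) * w' n z h))) (at z)" for z
      proof -
        have e: "(exp has_derivative (\<lambda>h. exp (- w n z) * h)) (at (- w n z))"
          using DERIV_exp[of "- w n z"] by (simp add: has_field_derivative_def)
        show ?thesis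
          using has_derivative_compose[OF has_derivative_minus[OF C1_derivD(1)[OF wC]] e] by simp
      qed
      show "continuous_on UNIV (\<lambda>z. - (exp (- w n z) * w' n z b))" for b
        by (intro continuous_intros C1_derivD(2,4)[OF wC])
    qed
    have "(LINT z|lborel. f z * dbar (\<lambda>h. exp (- w n z) * \<psi>' z h + - (exp (- w n z) * w' n z h) * \<psi> z) + a z * f z * (exp (- w n z) * \<psi> z)) = 0"
      using S by (intro weak_eq[OF C1_mult[OF ew \<psi>] S(1)]) (auto simp: \<psi>0)
    moreover have "f z * dbar (\<lambda>h. exp (- w n z) * \<psi>' z h + - (exp (- w n z) * w' n z h) * \<psi> z) + a z * f z * (exp (- w n z) * \<psi> z) = X n z + Y n z" for z
    proof -
      have "a z * \<psi> z = \<alpha> z * \<psi> z"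
        using \<psi>0[of z] S(2) by (cases "z \<in> S") (auto simp: \<alpha>_def indicator_def)
      then have "a z * f z * (exp (- w n z) * \<psi> z) = \<alpha> z * (f z * exp (- w n z) * \<psi> z)"
        by (metis (no_types, opaque_lifting) mult.assoc mult.commute)
      then show ?thesis
        unfolding dbar_add dbar_mult_left dbar_mult_right dbar_uminus X_def Y_def by (simp add: algebra_simps)
    qed
    ultimately show ?thesis by simp
  qed
  have Ylim: "(\<lambda>n. LINT z|lborel. Y n z) \<longlonglongrightarrow> 0" and Yi: "integrable lborel (Y n)" for n
  proof -
    define D where "D n = (\<integral>\<^sup>+z. norm (of_real kap * dbar (w' n z) - of_real kap * \<alpha> z) \<partial>lborel)" for n
    have Dlim: "D \<longlonglongrightarrow> 0"
      unfolding D_def dbar_w by (rule mollify_L1[OF \<alpha>i \<delta>])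
    have bd: "norm (Y n z) \<le> (E * B1 / kap) * norm (of_real kap * dbar (w' n z) - of_real kap * \<alpha> z)" for n z
    proof (cases "z \<in> S")
      case True
      have "norm (f z * exp (- w n z) * \<psi> z) \<le> 1 * E * B1"
        unfolding norm_mult using f_bound Eb[OF wb True] B1 by (intro mult_mono) (auto simp: E_def)
      then have "norm (Y n z) \<le> norm (\<alpha> z - dbar (w' n z)) * (E * B1)"
        unfolding Y_def norm_mult[of "_ - _"] by (intro mult_left_mono) auto
      moreover have "norm (of_real kap * dbar (w' n z) - of_real kap * \<alpha> z) = kap * norm (\<alpha> z - dbar (w' n z))"
        using kap_pos by (simp add: right_diff_distrib[symmetric] norm_mult norm_minus_commute)
      ultimately show ?thesis using kap_pos by (simp add: mult.commute)
    qed (use B1 kap_pos in \<open>auto simp: Y_def \<psi>0 E_def\<close>)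
    have nn: "(\<integral>\<^sup>+z. norm (Y n z) \<partial>lborel) \<le> ennreal (E * B1 / kap) * D n" for n
    proof -
      have "(\<integral>\<^sup>+z. norm (Y n z) \<partial>lborel) \<le> (\<integral>\<^sup>+z. ennreal (E * B1 / kap) * norm (of_real kap * dbar (w' n z) - of_real kap * \<alpha> z) \<partial>lborel)"
        using bd B1 kap_pos by (intro nn_integral_mono) (simp add: ennreal_mult[symmetric] E_def ennreal_leI)
      also have "\<dots> = ennreal (E * B1 / kap) * D n"
        unfolding D_def by (rule nn_integral_cmult) measurable
      finally show ?thesis .
    qed
    have Ym [measurable]: "Y n \<in> borel_measurable borel" for n unfolding Y_def by measurable
    have "integrable lborel (\<lambda>z. dbar (w' n z) * indicator (ball 0 \<rho>) z)" for n
    proof -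
      have "integrable lborel (\<lambda>z. indicator (cball 0 \<rho>) z *\<^sub>R dbar (w' n z))"
        by (intro borel_integrable_compact continuous_dbar[OF wC]) auto
      then show ?thesis
        by (rule Bochner_Integration.integrable_bound) (auto simp: indicator_def)
    qed
    then have "integrable lborel (\<lambda>z. \<alpha> z - dbar (w' n z) * indicator (ball 0 \<rho>) z)" for n
      using \<alpha>i by (intro Bochner_Integration.integrable_diff)
    then have "integrable lborel (\<lambda>z. (E * B1) * norm (\<alpha> z - dbar (w' n z) * indicator (ball 0 \<rho>) z))" for n
      by (intro integrable_mult_right integrable_norm)
    then show Yi: "integrable lborel (Y n)" for n
    proof (rule Bochner_Integration.integrable_bound)
      show "AE z in lborel. norm (Y n z) \<le> norm ((E * B1) * norm (\<alpha> z - dbar (w' n z) * indicator (ball 0 \<rho>) z))"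
      proof (rule AE_I2)
        fix z show "norm (Y n z) \<le> norm ((E * B1) * norm (\<alpha> z - dbar (w' n z) * indicator (ball 0 \<rho>) z))"
        proof (cases "z \<in> S")
          case True
          then have "z \<in> ball 0 \<rho>" using S(2) by auto
          then show ?thesis using bd[of n z] kap_pos B1
            by (simp add: right_diff_distrib[symmetric] norm_mult norm_minus_commute E_def)
        qed (auto simp: Y_def \<psi>0)
      qed
    qed measurable
    have "(\<lambda>n. ennreal (E * B1 / kap) * D n) \<longlonglongrightarrow> ennreal (E * B1 / kap) * 0"
      by (intro ennreal_tendsto_cmult Dlim) simp
    then have "(\<lambda>n. ennreal (E * B1 / kap) * D n) \<longlonglongrightarrow> 0" by simp
    from tendsto_sandwich[OF _ _ tendsto_const this, of "\<lambda>n. ennreal (norm (LINT z|lborel. Y n z))"]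
    have "(\<lambda>n. ennreal (norm (LINT z|lborel. Y n z))) \<longlonglongrightarrow> ennreal 0"
      using order_trans[OF integral_norm_bound_ennreal[OF Yi] nn] by simp
    then have "(\<lambda>n. norm (LINT z|lborel. Y n z)) \<longlonglongrightarrow> 0"
      by (subst (asm) tendsto_ennreal_iff) auto
    then show "(\<lambda>n. LINT z|lborel. Y n z) \<longlonglongrightarrow> 0"
      by (rule tendsto_norm_zero_cancel)
  qed
  have "(\<lambda>n. LINT z|lborel. X n z) \<longlonglongrightarrow> (LINT z|lborel. (f z * exp (- potential \<rho> z)) * dbar (\<psi>' z))"
  proof (rule integral_dominated_convergence[OF _ _ ball_int])
    show "AE z in lborel. (\<lambda>n. X n z) \<longlonglongrightarrow> f z * exp (- potential \<rho> z) * dbar (\<psi>' z)"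
      unfolding X_def by (intro AE_I2 tendsto_mult tendsto_const tendsto_exp tendsto_minus wlim)
    show "AE z in lborel. norm (X n z) \<le> E * B2 * indicator (ball 0 \<rho>) z" for n
      unfolding X_def using Xb[OF wb] by auto
    show "X n \<in> borel_measurable lborel" for n by (rule borel_measurable_integrable[OF Xi])
  qed measurable
  moreover have "(LINT z|lborel. X n z) = - (LINT z|lborel. Y n z)" for n
    using zero[of n] Xi[of n] Yi[of n] by (simp add: add_eq_0_iff)
  ultimately have "(\<lambda>n. - (LINT z|lborel. Y n z)) \<longlonglongrightarrow> (LINT z|lborel. (f z * exp (- potential \<rho> z)) * dbar (\<psi>' z))"
    by simp
  moreover have "(\<lambda>n. - (LINT z|lborel. Y n z)) \<longlonglongrightarrow> 0"
    using tendsto_minus[OF Ylim] by simp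
  ultimately show "(LINT z|lborel. (f z * exp (- potential \<rho> z)) * dbar (\<psi>' z)) = 0"
    by (rule LIMSEQ_unique)
qed

end

section \<open>Propagation of smallness in an annulus\<close>

text \<open>
  The maximum principle is applied to \<open>H\<close> times a power of the Blaschke factor of the exterior domain
  \<open>norm z > 3/2\<close> with pole at \<open>z\<^sub>0\<close>; dividing by \<open>z ^ k\<close> compensates its growth on the outer circle.
\<close>

lemma annulus_maximum:
  fixes H :: "complex \<Rightarrow> complex"
  assumes R: "R \<ge> 10" "norm z0 = R" and holo: "H holomorphic_on U" "open U"
    and U: "\<And>z. 3/2 \<le> norm z \<Longrightarrow> norm z \<le> 4 * R \<Longrightarrow> z \<in> U"
    and M: "\<And>z. 3/2 \<le> norm z \<Longrightarrow> norm z \<le> 4 * R \<Longrightarrow> norm (H z) \<le> M" "M > 0"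
    and \<tau>: "\<And>z. norm (z - z0) \<le> 1/8 \<Longrightarrow> norm (H z) \<le> \<tau>"
    and z1: "2 < norm z1" "norm z1 < 4" "norm (H z1) \<ge> m" "m > 0"
    and J: "(8/3) ^ J \<ge> R" "(1 - 6 / R) ^ (J + 1) \<ge> 7/8" and j: "(7/6) ^ j > M / m"
  shows "\<tau> * (24 * R\<^sup>2) ^ (j * (J + 1)) \<ge> M"
proof (rule ccontr)
  define k where "k = j * J"
  define N where "N = j * (J + 1)"
  have Nk: "N = j + k" by (simp add: N_def k_def)
  assume "\<not> ?thesis"
  then have small: "\<tau> * (24 * R\<^sup>2) ^ N < M" by (simp add: N_def)
  have \<tau>0: "\<tau> \<ge> 0" using \<tau>[of z0] norm_ge_zero order_trans[of 0 "norm (H z0)" \<tau>] by simp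
  \<comment> \<open>The Blaschke factor: \<open>9/4\<close> is the square of the inner radius, so
    \<open>norm (b z) = 1\<close> for \<open>norm z = 3/2\<close>, and the only pole is
    \<open>z0\<close>.\<close>
  define b where "b z = (9/4 - cnj z0 * z) / (3/2 * (z - z0))" for z
  \<comment> \<open>\<open>F\<close> is \<open>H\<close> times the \<open>j\<close>-th power of
    \<open>b * (b / z) ^ J\<close>. That expression has modulus \<open>(2/3) ^ J\<close> on the
    inner circle, at most \<open>R / 4 ^ J \<le> (2/3) ^ J\<close> on the outer one, and at least
    \<open>7/6 * (2/3) ^ J\<close> at \<open>z1\<close>; hence its \<open>j\<close>-th power beats
    \<open>M / m\<close>.\<close>
  define F where "F z = H z * b z ^ N / z ^ k" for z
  define S where "S = {z. 3/2 < norm z \<and> norm z < 4 * R} - cball z0 (1/8)"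
  define T where "T = {z. 3/2 \<le> norm z \<and> norm z \<le> 4 * R} - ball z0 (1/8)"
  have "open S"
    unfolding S_def by (intro open_Diff open_Collect_conj open_Collect_less continuous_intros) auto
  have "closed T"
    unfolding T_def by (intro closed_Diff closed_Collect_conj closed_Collect_le continuous_intros) auto
  have ST: "closure S \<subseteq> T"
    using \<open>closed T\<close> by (intro closure_minimal) (auto simp: S_def T_def)
  have holF: "F holomorphic_on (U - {0, z0})"
    unfolding F_def b_def
    by (intro holomorphic_intros holomorphic_on_subset[OF holo(1)]) auto
  have TU: "T \<subseteq> U - {0, z0}"
    using U by (auto simp: T_def)
  \<comment> \<open>The lower bound for \<open>norm (F z1)\<close>, with \<open>norm z1\<close>
    replaced by 2 in the \<open>j\<close> unpaired factors. The base \<open>7/6\<close> in the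
    assumption on \<open>j\<close> is \<open>4/3 * 7/8\<close>, where \<open>7/8\<close> bounds the
    loss from \<open>1 - 6 / R\<close>.\<close>
  define LB where "LB = m * ((4/3) ^ j * (2/3) ^ k * (1 - 6 / R) ^ N)"
  have R6: "0 \<le> 1 - 6 / R" "1 - 6 / R \<le> 1" using R by auto
  have LB: "LB > M * (2/3) ^ k"
  proof -
    have "(1 - 6 / R) ^ N = ((1 - 6 / R) ^ (J + 1)) ^ j"
      unfolding N_def by (simp only: power_mult[symmetric] mult.commute)
    also have "\<dots> \<ge> (7/8) ^ j"
      by (intro power_mono J) auto
    finally have "(4/3) ^ j * (7/8) ^ j \<le> (4/3) ^ j * (1 - 6 / R) ^ N"
      by (intro mult_left_mono) auto
    also have "(4/3) ^ j * (7/8) ^ j = (7/6 :: real) ^ j"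
      by (simp add: power_mult_distrib[symmetric])
    finally have "M / m < (4/3) ^ j * (1 - 6 / R) ^ N" using j by linarith
    then have "M < m * ((4/3) ^ j * (1 - 6 / R) ^ N)"
      using z1(4) by (simp add: divide_less_eq mult.commute)
    then have "M * (2/3) ^ k < m * ((4/3) ^ j * (1 - 6 / R) ^ N) * (2/3) ^ k"
      by (intro mult_strict_right_mono) auto
    then show ?thesis by (simp add: LB_def mult_ac)
  qed
  define B where "B = max (M * (2/3) ^ k) (\<tau> * (16 * R\<^sup>2) ^ N)"
  have bd: "norm (F z) \<le> B" if z: "z \<in> frontier S" for z
  proof -
    have "z \<in> T" "z \<notin> S"
      using z ST \<open>open S\<close> by (auto simp: frontier_def interior_open)
    then have zT: "3/2 \<le> norm z" "norm z \<le> 4 * R" "norm (z - z0) \<ge> 1/8"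
      by (auto simp: T_def dist_norm norm_minus_commute)
    have "norm z = 3/2 \<or> norm z = 4 * R \<or> norm (z - z0) = 1/8"
      using \<open>z \<notin> S\<close> zT by (auto simp: S_def dist_norm norm_minus_commute)
    have nF: "norm (F z) = norm (H z) * norm (b z) ^ N / norm z ^ k"
      by (simp add: F_def norm_mult norm_divide norm_power)
    have nb: "norm (b z) = norm (9/4 - cnj z0 * z) / (3/2 * norm (z - z0))"
      unfolding b_def norm_divide[of "9/4 - cnj z0 * z"] norm_mult[of "3/2"] by simp
    consider "norm z = 3/2" | "norm z = 4 * R" | "norm (z - z0) = 1/8"
      using \<open>_ \<or> _ \<or> _\<close> by blast
    then show ?thesis
    proof cases
      case 1
      have "z * cnj z = 9/4"
        using complex_norm_square[of z] unfolding 1 by (simp add: power2_eq_square)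
      then have "9/4 - cnj z0 * z = z * cnj (z - z0)" by (simp add: algebra_simps)
      then have "norm (9/4 - cnj z0 * z) = 3/2 * norm (z - z0)"
        using 1 by (simp add: norm_mult del: complex_cnj_diff)
      moreover have "norm (z - z0) > 0" using zT(3) by linarith
      ultimately have nb1: "norm (b z) = 1" unfolding nb by simp
      have "norm (F z) = norm (H z) * (2/3) ^ k"
        unfolding nF 1 nb1 by (simp add: power_divide)
      also have "\<dots> \<le> M * (2/3) ^ k"
        by (intro mult_right_mono M zT) auto
      finally show ?thesis by (simp add: B_def)
    next
      case 2
      have "norm (9/4 - cnj z0 * z) \<le> 9/4 + R * (4 * R)"
        using norm_triangle_ineq4[of "9/4" "cnj z0 * z"] R 2 by (simp add: norm_mult)
      also have "\<dots> \<le> R * (3/2 * (3 * R))"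
      proof -
        have "10 * 10 \<le> R * R" using R by (intro mult_mono) auto
        then show ?thesis by simp
      qed
      also have "\<dots> \<le> R * (3/2 * norm (z - z0))"
        using R 2 norm_triangle_ineq2[of z z0] by (intro mult_left_mono) auto
      finally have "norm (9/4 - cnj z0 * z) \<le> R * (3/2 * norm (z - z0))" .
      moreover have "3/2 * norm (z - z0) > 0" using zT(3) by linarith
      ultimately have "norm (b z) \<le> R"
        unfolding nb by (subst pos_divide_le_eq)
      then have "norm (H z) * norm (b z) ^ N \<le> M * R ^ N"
        using M(2) by (intro mult_mono power_mono M(1) zT) auto
      then have "norm (F z) \<le> M * R ^ N / (4 * R) ^ k"
        unfolding nF 2 using R by (intro divide_right_mono) auto
      also have "\<dots> = M * (R ^ j / 4 ^ k)"
        using R by (simp add: Nk power_add power_mult_distrib field_simps)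
      also have "\<dots> \<le> M * (2/3) ^ k"
      proof (rule mult_left_mono)
        have "R ^ j \<le> ((8/3) ^ J) ^ j" using R by (intro power_mono J) auto
        also have "\<dots> = (8/3) ^ k" by (simp add: k_def power_mult[symmetric] mult.commute)
        also have "\<dots> = (2/3) ^ k * 4 ^ k" by (simp add: power_mult_distrib[symmetric])
        finally show "R ^ j / 4 ^ k \<le> (2/3) ^ k" by (simp add: pos_divide_le_eq)
      qed (use M in auto)
      finally show ?thesis by (simp add: B_def)
    next
      case 3
      have nz: "norm z \<le> R + 1/8" using norm_triangle_sub[of z z0] R 3 by simp
      have "norm (9/4 - cnj z0 * z) \<le> 9/4 + R * (R + 1/8)"
      proof -
        have "norm (9/4 - cnj z0 * z) \<le> 9/4 + R * norm z"
          using norm_triangle_ineq4[of "9/4" "cnj z0 * z"] R by (simp add: norm_mult)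
        also have "\<dots> \<le> 9/4 + R * (R + 1/8)" using nz R by (intro add_left_mono mult_left_mono) auto
        finally show ?thesis .
      qed
      also have "\<dots> \<le> 3 * R\<^sup>2"
      proof -
        have "10 * R \<le> R * R" using R by (intro mult_right_mono) auto
        moreover have "9/4 + R * (R + 1/8) = R * R + R / 8 + 9/4" "3 * R\<^sup>2 = 3 * (R * R)"
          by (simp_all add: power2_eq_square algebra_simps)
        ultimately show ?thesis using R(1) by linarith
      qed
      \<comment> \<open>On the small circle the denominator of \<open>b\<close> has modulus
        \<open>3/2 * 1/8 = 3/16\<close>, and 3 divided by \<open>3/16\<close> is 16.\<close>
      finally have "norm (b z) \<le> 16 * R\<^sup>2"
        unfolding nb 3 by (simp add: divide_le_eq)
      then have "norm (H z) * norm (b z) ^ N \<le> \<tau> * (16 * R\<^sup>2) ^ N"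
        using 3 \<tau>0 by (intro mult_mono power_mono \<tau>) auto
      moreover have "norm (F z) \<le> norm (H z) * norm (b z) ^ N / 1"
        unfolding nF using zT(1) by (intro divide_left_mono one_le_power mult_nonneg_nonneg) (auto intro!: zero_less_power)
      ultimately show ?thesis by (simp add: B_def)
    qed
  qed
  have z1S: "z1 \<in> S"
  proof -
    have "norm (z1 - z0) > 1/8" using norm_triangle_ineq2[of z0 z1] R z1 by (simp add: norm_minus_commute)
    then show ?thesis using z1 R by (auto simp: S_def dist_norm norm_minus_commute)
  qed
  have "norm (F z1) \<le> B"
  proof (rule maximum_modulus_frontier[of F S B z1])
    show "F holomorphic_on interior S"
      using ST TU closure_subset interior_subset by (intro holomorphic_on_subset[OF holF]) blast
    show "continuous_on (closure S) F"
      using ST TU by (intro continuous_on_subset[OF holomorphic_on_imp_continuous_on[OF holF]]) blast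
    show "bounded S"
      by (rule bounded_subset[OF bounded_ball[of 0 "4 * R"]]) (auto simp: S_def)
  qed (use bd z1S in auto)
  moreover have "LB \<le> norm (F z1)"
  proof -
    let ?r = "norm z1"
    have "?r * R - 9/4 \<le> norm (9/4 - cnj z0 * z1)"
      using norm_triangle_ineq2[of "cnj z0 * z1" "9/4"] R by (simp add: norm_mult norm_minus_commute mult.commute)
    moreover have "3/2 * norm (z1 - z0) \<le> 3/2 * (R + 4)"
      using norm_triangle_ineq4[of z1 z0] z1 R by simp
    moreover have "norm (z1 - z0) > 0" using z1S by (auto simp: S_def)
    ultimately have nb: "norm (b z1) \<ge> (?r * R - 9/4) / (3/2 * (R + 4))"
      unfolding b_def norm_divide norm_mult using z1 R
      by (intro frac_le) (auto intro: order_trans[OF _ mult_mono[of 2 ?r 10 R]])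
    \<comment> \<open>The product \<open>(1 - 6 / R) * (R + 4)\<close> equals
      \<open>R - 2 - 24 / R\<close>; the term \<open>- 2 * ?r\<close> absorbs \<open>9/4\<close>
      because \<open>?r > 2\<close>.\<close>
    have "2/3 * ?r * (1 - 6 / R) \<le> (?r * R - 9/4) / (3/2 * (R + 4))"
    proof -
      have "2/3 * ?r * (1 - 6 / R) * (3/2 * (R + 4)) = ?r * (R - 2 - 24 / R)"
        using R by (simp add: field_simps)
      also have "\<dots> = ?r * R - 2 * ?r - 24 * ?r / R" by (simp add: algebra_simps)
      also have "\<dots> \<le> ?r * R - 9/4"
      proof -
        have "24 * ?r / R \<ge> 0" using R by simp
        then show ?thesis using z1(1) by linarith
      qed
      finally show ?thesis using R by (simp add: pos_le_divide_eq)
    qed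
    from order_trans[OF this nb] have "(2/3 * ?r * (1 - 6 / R)) ^ N \<le> norm (b z1) ^ N"
      by (rule power_mono) (use R6 in auto)
    then have "m * (2/3 * ?r * (1 - 6 / R)) ^ N / ?r ^ k \<le> norm (F z1)"
      unfolding F_def norm_mult norm_divide norm_power using z1 R6
      by (intro divide_right_mono mult_mono) auto
    moreover have "LB \<le> m * (2/3 * ?r * (1 - 6 / R)) ^ N / ?r ^ k"
    proof -
      have r: "?r ^ k > 0" using z1 by (intro zero_less_power) linarith
      have "(2/3 * ?r * (1 - 6 / R)) ^ N / ?r ^ k = (2/3 * ?r) ^ j * (2/3) ^ k * (1 - 6 / R) ^ N"
      proof -
        have "(2/3 * ?r * (1 - 6 / R)) ^ N = (2/3 * ?r) ^ N * (1 - 6 / R) ^ N"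
          by (rule power_mult_distrib)
        also have "(2/3 * ?r) ^ N = (2/3 * ?r) ^ j * ((2/3) ^ k * ?r ^ k)"
          by (simp only: Nk power_add power_mult_distrib)
        moreover have "z1 \<noteq> 0" using z1(1) by auto
        ultimately show ?thesis by simp
      qed
      moreover have "(4/3) ^ j * ((2/3) ^ k * (1 - 6 / R) ^ N) \<le> (2/3 * ?r) ^ j * ((2/3) ^ k * (1 - 6 / R) ^ N)"
        using z1 R6 by (intro mult_right_mono power_mono mult_nonneg_nonneg zero_le_power) auto
      ultimately have "(4/3) ^ j * (2/3) ^ k * (1 - 6 / R) ^ N \<le> (2/3 * ?r * (1 - 6 / R)) ^ N / ?r ^ k"
        by (simp add: mult.assoc)
      from mult_left_mono[OF this, of m] show ?thesis using z1(4) by (simp add: LB_def)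
    qed
    ultimately show ?thesis by linarith
  qed
  moreover have "B < LB"
  proof -
    have "\<tau> * (16 * R\<^sup>2) ^ N \<le> M * (2/3) ^ k"
    proof -
      \<comment> \<open>The surplus in \<open>24 = 16 * 3/2\<close> pays for the factor
        \<open>(2/3) ^ k\<close> present in the bounds on the other two circles.\<close>
      have "(24 * R\<^sup>2) ^ N = (16 * R\<^sup>2 * (3/2)) ^ N" by simp
      also have "\<dots> = (16 * R\<^sup>2) ^ N * (3/2) ^ N" by (rule power_mult_distrib)
      finally have "(24 * R\<^sup>2) ^ N = (16 * R\<^sup>2) ^ N * (3/2) ^ N" .
      then have "\<tau> * (16 * R\<^sup>2) ^ N * (3/2) ^ N < M" using small by (simp only: mult.assoc)
      moreover have "\<tau> * (16 * R\<^sup>2) ^ N * (3/2) ^ k \<le> \<tau> * (16 * R\<^sup>2) ^ N * (3/2) ^ N"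
        using \<tau>0 Nk by (intro mult_left_mono power_increasing) auto
      ultimately have "\<tau> * (16 * R\<^sup>2) ^ N * (3/2) ^ k \<le> M" by linarith
      then have "\<tau> * (16 * R\<^sup>2) ^ N * (3/2) ^ k * (2/3) ^ k \<le> M * (2/3) ^ k"
        by (intro mult_right_mono) auto
      moreover have "(3/2) ^ k * (2/3) ^ k = (1 :: real)"
        by (simp add: power_mult_distrib[symmetric])
      ultimately show ?thesis by (simp only: mult.assoc mult_1_right)
    qed
    then show ?thesis using LB by (simp add: B_def)
  qed
  ultimately show False by linarith
qed

text \<open>The choice of exponents in \<open>annulus_maximum\<close>: \<open>J\<close> of order
  \<open>ln R\<close> and \<open>j\<close> of order \<open>R\<close>. The loss is
  \<open>24 * R\<^sup>2\<close> to the power \<open>j * (J + 1)\<close>, and its logarithm is of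
  order \<open>R * ln R * ln R\<close>.\<close>

lemma annulus_growth:
  fixes c :: real
  assumes "c \<ge> 0"
  shows "\<exists>C\<ge>0. \<exists>R0\<ge>24. \<forall>R z0 z1 H U M m \<tau>. R \<ge> R0 \<longrightarrow> norm (z0 :: complex) = R \<longrightarrow> H holomorphic_on U \<longrightarrow> open U \<longrightarrow>
      (\<forall>z. 3/2 \<le> norm z \<longrightarrow> norm z \<le> 4 * R \<longrightarrow> z \<in> U) \<longrightarrow>
      (\<forall>z. 3/2 \<le> norm z \<longrightarrow> norm z \<le> 4 * R \<longrightarrow> norm (H z) \<le> M) \<longrightarrow> M \<ge> 1 \<longrightarrow>
      (\<forall>z. norm (z - z0) \<le> 1/8 \<longrightarrow> norm (H z) \<le> \<tau>) \<longrightarrow>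
      2 < norm z1 \<longrightarrow> norm z1 < 4 \<longrightarrow> norm (H z1) \<ge> m \<longrightarrow> m > 0 \<longrightarrow> M / m \<le> exp (c * R) \<longrightarrow>
      \<tau> \<ge> exp (- C * R * (ln R)\<^sup>2)"
proof -
  \<comment> \<open>The size of \<open>R\<close> that Bernoulli's inequality requires:
    \<open>(J + 1) * (6 / R) \<le> 1/8\<close> with \<open>J \<le> 2 * ln R + 1\<close>.\<close>
  have "\<forall>\<^sub>F R in at_top. 48 * (2 * ln R + 2) \<le> (R :: real)"
    by real_asymp
  then obtain R1 where R1: "\<And>R :: real. R \<ge> R1 \<Longrightarrow> 48 * (2 * ln R + 2) \<le> R"
    by (auto simp: eventually_at_top_linorder)
  \<comment> \<open>The product of \<open>j \<le> (7 * c + 2) * R\<close>,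
    \<open>J + 1 \<le> 4 * ln R\<close> and
    \<open>ln (24 * R\<^sup>2) \<le> 3 * ln R\<close>.\<close>
  define C where "C = 3 * (28 * c + 8)"
  show ?thesis
  proof (rule exI[of _ C], intro exI[of _ "max 24 R1"] conjI allI impI)
    show "C \<ge> 0" using assms by (simp add: C_def)
    fix R :: real and z0 z1 :: complex and H :: "complex \<Rightarrow> complex" and U :: "complex set" and M m \<tau> :: real
    assume R: "R \<ge> max 24 R1" and z0: "norm z0 = R" and H: "H holomorphic_on U" "open U"
      and U0: "\<forall>z. 3/2 \<le> norm z \<longrightarrow> norm z \<le> 4 * R \<longrightarrow> z \<in> U"
      and M: "\<forall>z. 3/2 \<le> norm z \<longrightarrow> norm z \<le> 4 * R \<longrightarrow> norm (H z) \<le> M" "M \<ge> 1"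
      and \<tau>0: "\<forall>z. norm (z - z0) \<le> 1/8 \<longrightarrow> norm (H z) \<le> \<tau>"
      and z1: "2 < norm z1" "norm z1 < 4" "norm (H z1) \<ge> m" "m > 0" "M / m \<le> exp (c * R)"
    note U = U0[rule_format] and M1 = M(1)[rule_format] and \<tau> = \<tau>0[rule_format]
    have R24: "R \<ge> 24" and R1': "48 * (2 * ln R + 2) \<le> R" using R R1[of R] by auto
    have lnR: "ln R \<ge> 1"
    proof -
      have "exp 1 \<le> R" using exp_le R24 by linarith
      then show ?thesis using R24 by (subst ln_ge_iff) auto
    qed
    \<comment> \<open>The factor 2 comes from \<open>exp (1/2) \<le> 8/3\<close>: then
      \<open>(8/3) ^ J \<ge> exp (J / 2) \<ge> R\<close>.\<close>
    define J where "J = nat \<lceil>2 * ln R\<rceil>"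
    have J: "2 * ln R \<le> real J" "real J \<le> 2 * ln R + 1"
      unfolding J_def using lnR by linarith+
    \<comment> \<open>The factor 7 comes from \<open>exp (1/7) \<le> 7/6\<close>; the summand 1
      makes the final inequality strict.\<close>
    define j where "j = nat \<lceil>7 * c * R + 1\<rceil>"
    have "7 * c * R \<ge> 0" using assms R24 by simp
    then have j: "7 * c * R + 1 \<le> real j" "real j \<le> 7 * c * R + 2"
      unfolding j_def by linarith+
    have J1: "(8/3) ^ J \<ge> R"
    proof -
      have "exp (1/2 :: real) \<le> 8/3"
      proof -
        have "(exp (1/2 :: real))\<^sup>2 = exp 1" by (simp add: exp_double[symmetric])
        also have "\<dots> \<le> (8/3)\<^sup>2" using exp_le by (simp add: power2_eq_square)
        finally show ?thesis by (rule power2_le_imp_le) simp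
      qed
      then have "exp (1/2) ^ J \<le> (8/3 :: real) ^ J" by (intro power_mono) auto
      moreover have "R \<le> exp (1/2) ^ J"
      proof -
        have "R = exp (ln R)" using R24 by simp
        also have "\<dots> \<le> exp (real J * (1/2))" using J(1) by simp
        also have "\<dots> = exp (1/2) ^ J" by (rule exp_of_nat_mult)
        finally show ?thesis .
      qed
      ultimately show ?thesis by linarith
    qed
    have J2: "(1 - 6 / R) ^ (J + 1) \<ge> 7/8"
    proof -
      have "1 + real (J + 1) * - (6 / R) \<le> (1 + - (6 / R)) ^ (J + 1)"
        using R24 by (intro Bernoulli_inequality) (auto simp: field_simps)
      moreover have "real (J + 1) * (6 / R) \<le> 1/8"
      proof -
        have "48 * real (J + 1) \<le> R" using J(2) R1' by simp
        then show ?thesis using R24 by (simp add: field_simps)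
      qed
      ultimately show ?thesis
        unfolding mult_minus_right add_uminus_conv_diff by linarith
    qed
    have j2: "(7/6) ^ j > M / m"
    proof -
      have "exp (1/7 :: real) \<le> 7/6"
      proof -
        have "1 + (- 1/7) \<le> exp (- 1/7 :: real)" by (rule exp_ge_add_one_self)
        then have "inverse (exp (- 1/7 :: real)) \<le> inverse (6/7)" by (intro le_imp_inverse_le) auto
        then show ?thesis by (simp add: exp_minus)
      qed
      then have "exp (1/7) ^ j \<le> (7/6 :: real) ^ j" by (intro power_mono) auto
      moreover have "exp (c * R) < exp (1/7) ^ j"
      proof -
        have "exp (c * R) < exp (real j * (1/7))" using j(1) by simp
        also have "\<dots> = exp (1/7) ^ j" by (rule exp_of_nat_mult)
        finally show ?thesis .
      qed
      ultimately show ?thesis using z1(5) by linarith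
    qed
    have main: "\<tau> * (24 * R\<^sup>2) ^ (j * (J + 1)) \<ge> M"
      using R24 M(2) by (intro annulus_maximum[OF _ z0 H U M1 _ \<tau> z1(1-4) J1 J2 j2]) auto
    have "(24 * R\<^sup>2) ^ (j * (J + 1)) \<le> exp (C * R * (ln R)\<^sup>2)"
    proof -
      have "24 * R\<^sup>2 \<le> R ^ 3" using R24 by (simp add: power2_eq_square power3_eq_cube mult_right_mono)
      also have "\<dots> = exp (3 * ln R)" using R24 exp_of_nat_mult[of 3 "ln R"] by simp
      finally have "(24 * R\<^sup>2) ^ (j * (J + 1)) \<le> exp (3 * ln R) ^ (j * (J + 1))"
        using R24 by (intro power_mono) auto
      also have "\<dots> = exp (real (j * (J + 1)) * (3 * ln R))"
        by (rule exp_of_nat_mult[symmetric])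
      also have "\<dots> \<le> exp (C * R * (ln R)\<^sup>2)"
      proof -
        have "real j \<le> (7 * c + 2) * R" using j(2) R24 by (simp add: algebra_simps)
        moreover have "real (J + 1) \<le> 4 * ln R" using J(2) lnR by simp
        ultimately have "real j * real (J + 1) \<le> ((7 * c + 2) * R) * (4 * ln R)"
          using assms R24 by (intro mult_mono) auto
        then have "real (j * (J + 1)) * (3 * ln R) \<le> (((7 * c + 2) * R) * (4 * ln R)) * (3 * ln R)"
          unfolding of_nat_mult using lnR by (intro mult_right_mono) auto
        also have "\<dots> = C * R * (ln R)\<^sup>2"
          by (simp add: C_def power2_eq_square algebra_simps)
        finally show ?thesis by simp
      qed
      finally show ?thesis .
    qed
    moreover have "\<tau> \<ge> 0" using \<tau>[of z0] norm_ge_zero order_trans[of 0 "norm (H z0)" \<tau>] by simp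
    ultimately have "\<tau> * (24 * R\<^sup>2) ^ (j * (J + 1)) \<le> \<tau> * exp (C * R * (ln R)\<^sup>2)"
      by (intro mult_left_mono) auto
    then have "1 \<le> \<tau> * exp (C * R * (ln R)\<^sup>2)" using main M(2) by linarith
    then have "1 / exp (C * R * (ln R)\<^sup>2) \<le> \<tau>" by (simp add: divide_le_eq)
    then show "\<tau> \<ge> exp (- C * R * (ln R)\<^sup>2)" by (simp add: exp_minus inverse_eq_divide)
  qed auto
qed

text \<open>The set of violations is open and null, hence empty. This turns almost everywhere
  estimates of the weakly holomorphic function into pointwise ones for its holomorphic
  representative, as the maximum principle requires.\<close>

lemma AE_bound_continuous:
  fixes F :: "'a::euclidean_space \<Rightarrow> 'b::real_normed_vector"
  assumes U: "open U" "continuous_on U F" and ae: "AE z in lborel. z \<in> U \<longrightarrow> norm (F z) \<le> M" and z: "z \<in> U"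
  shows "norm (F z) \<le> M"
proof (rule ccontr)
  assume "\<not> ?thesis"
  define V where "V = U \<inter> (\<lambda>z. norm (F z)) -` {M<..}"
  have "open V"
    unfolding V_def by (intro continuous_open_preimage continuous_on_norm U) auto
  moreover have "V \<noteq> {}" using z \<open>\<not> _\<close> by (auto simp: V_def)
  moreover have "V \<in> null_sets lborel"
  proof -
    have "AE z in lborel. z \<notin> V" using ae by eventually_elim (auto simp: V_def)
    then show ?thesis using \<open>open V\<close> by (subst (asm) AE_iff_null_sets[symmetric]) auto
  qed
  ultimately show False
    using open_not_negligible negligible_iff_null_sets null_sets_completionI by metis
qed

lemma dbar_zero_where_constant:
  assumes "C1_deriv \<theta> \<theta>'" "open U" "\<And>z. z \<in> U \<Longrightarrow> \<theta> z = c" "z \<in> U"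
  shows "dbar (\<theta>' z) = 0"
proof -
  have "dbar (\<lambda>h. \<theta>' z h - 0) = 0"
    by (rule dbar_zero_outside[OF C1_diff[OF assms(1) C1_const[of c]], of "- U"]) (use assms in auto)
  then show ?thesis by simp
qed

text \<open>\<open>weakly_holomorphic_representation\<close> is used twice. With a cutoff equal to 1
  on the annulus \<open>U\<close> it writes \<open>f * exp (- w)\<close> as the Cauchy transform of
  a function vanishing on \<open>U\<close>, hence as a holomorphic \<open>F\<close>; with a small
  cutoff about \<open>z0\<close> it bounds \<open>F\<close> there by the L1 norm of
  \<open>f\<close>. Then \<open>annulus_growth\<close> applies to \<open>F\<close>.\<close>

lemma growth_estimate:
  fixes q c0 :: real
  assumes q: "0 \<le> q" "q < 2" and c0: "c0 > 0"
  shows "\<exists>C\<ge>0. \<exists>R0\<ge>24. \<forall>f a N H R z0. drift_system N H q f a \<longrightarrow>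
       (LINT z|lborel. indicator (ball 3 1) z * (norm (f z))\<^sup>2) \<ge> c0 \<longrightarrow> R \<ge> R0 \<longrightarrow> norm (z0 :: complex) = R \<longrightarrow>
       (LINT z|lborel. indicator (cball z0 (1/2)) z * norm (f z)) \<ge> exp (- C * R * (ln R)\<^sup>2)"
proof -
  obtain C1 where C1: "C1 > 0"
    "\<forall>N H \<rho> z. young_pair N H q \<longrightarrow> \<rho> \<ge> 1 \<longrightarrow>
      (\<integral>\<^sup>+y. indicator (ball 0 \<rho>) y * ennreal (N y * inverse (norm (z - y))) \<partial>lborel) \<le> ennreal (C1 * (\<rho> + norm z))"
    using cauchy_potential_bound[OF q] by blast
  \<comment> \<open>In the disc of radius \<open>6 * R\<close> the potential is at most
    \<open>C1 / kap * (6 * R + 6 * R)\<close>.\<close>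
  define B where "B = 12 * C1 / kap"
  have B: "B > 0" using C1 kap_pos by (simp add: B_def)
  define v where "v = measure lborel (ball (3::complex) 1)"
  have v: "v > 0" unfolding v_def using content_ball_pos[of 1 "3::complex"] by simp
  \<comment> \<open>Chosen so that \<open>norm (f z) \<le> m0\<close> almost everywhere on the unit
    ball about 3 would give an integral of at most \<open>c0 / 2\<close>.\<close>
  define m0 where "m0 = sqrt (c0 / (2 * v))"
  have m0: "m0 > 0" using c0 v by (simp add: m0_def)
  \<comment> \<open>The ratio of the bounds for \<open>F\<close> is
    \<open>exp (2 * B * R) / m0\<close>, and \<open>1 / m0 \<le> exp (R / m0)\<close> since
    \<open>R \<ge> 1\<close>.\<close>
  define c where "c = 2 * B + 1 / m0"
  have c: "c \<ge> 0" using B m0 by (simp add: c_def)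
  obtain C2 R1 where C2: "C2 \<ge> 0" "R1 \<ge> 24"
    "\<forall>R z0 z1 H U M m \<tau>. R \<ge> R1 \<longrightarrow> norm (z0 :: complex) = R \<longrightarrow> H holomorphic_on U \<longrightarrow> open U \<longrightarrow>
      (\<forall>z. 3/2 \<le> norm z \<longrightarrow> norm z \<le> 4 * R \<longrightarrow> z \<in> U) \<longrightarrow>
      (\<forall>z. 3/2 \<le> norm z \<longrightarrow> norm z \<le> 4 * R \<longrightarrow> norm (H z) \<le> M) \<longrightarrow> M \<ge> 1 \<longrightarrow>
      (\<forall>z. norm (z - z0) \<le> 1/8 \<longrightarrow> norm (H z) \<le> \<tau>) \<longrightarrow>
      2 < norm z1 \<longrightarrow> norm z1 < 4 \<longrightarrow> norm (H z1) \<ge> m \<longrightarrow> m > 0 \<longrightarrow> M / m \<le> exp (c * R) \<longrightarrow>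
      \<tau> \<ge> exp (- C2 * R * (ln R)\<^sup>2)"
    using annulus_growth[OF c] by blast
  define \<eta> where "\<eta> z = complex_of_real (cutoff (1/4) (1/2) z)" for z
  define \<eta>' where "\<eta>' z h = complex_of_real (cutoff' (1/4) (1/2) z h)" for z h
  have \<eta>: "C1_deriv \<eta> \<eta>'"
    unfolding \<eta>_def[abs_def] \<eta>'_def[abs_def] by (intro C1_of_real cutoff_C1) auto
  have \<eta>0: "\<eta> z = 0" if "z \<notin> cball 0 (1/2)" for z
    using that unfolding \<eta>_def by (subst cutoff_eq(2)) auto
  have \<eta>1: "\<eta> z = 1" if "z \<in> ball 0 (1/4)" for z
    using that unfolding \<eta>_def by (subst cutoff_eq(1)) auto
  have d\<eta>0: "dbar (\<eta>' z) = 0" if "z \<notin> cball 0 (1/2)" for z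
    by (rule dbar_zero_outside[OF \<eta> closed_cball \<eta>0 that])
  have d\<eta>1: "dbar (\<eta>' z) = 0" if "z \<in> ball 0 (1/4)" for z
    by (rule dbar_zero_where_constant[OF \<eta> open_ball \<eta>1 that])
  obtain B3 where B3: "B3 \<ge> 0" "\<And>z. norm (dbar (\<eta>' z)) \<le> B3"
    using continuous_compact_support_bounded[OF continuous_dbar[OF \<eta>] compact_cball d\<eta>0] by metis
  \<comment> \<open>For \<open>z\<close> within \<open>3/16\<close> of \<open>z0\<close> and
    \<open>y\<close> at distance at least \<open>1/4\<close>, where the derivative of the cutoff
    lives, \<open>norm (z - y) \<ge> 1/16\<close>: hence 16. The added 1 keeps \<open>D\<close>
    positive.\<close>
  define D where "D = 16 * (B3 + 1) / kap"
  have D: "D > 0" using B3 kap_pos by (simp add: D_def)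
  define C where "C = C2 + B + D"
  show ?thesis
  proof (rule exI[of _ C], intro exI[of _ R1] conjI allI impI)
    show "C \<ge> 0" using C2 B D by (simp add: C_def)
    show "R1 \<ge> 24" by fact
    fix f a :: "complex \<Rightarrow> complex" and N H :: "complex \<Rightarrow> real" and R :: real and z0 :: complex
    assume ds: "drift_system N H q f a" and low: "(LINT z|lborel. indicator (ball 3 1) z * (norm (f z))\<^sup>2) \<ge> c0"
      and R: "R \<ge> R1" and z0: "norm z0 = R"
    interpret drift_system N H q f a by fact
    have R24: "R \<ge> 24" using R C2 by simp
    define \<rho> where "\<rho> = 6 * R"
    have \<rho>: "\<rho> \<ge> 1" using R24 by (simp add: \<rho>_def)
    have Cb: "(\<integral>\<^sup>+y. indicator (ball 0 \<rho>) y * ennreal (N y * inverse (norm (z - y))) \<partial>lborel) \<le> ennreal (C1 * (\<rho> + norm z))" for z :: complex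
      using C1(2) \<rho> young_pair_axioms by blast
    note sim = similarity[OF \<rho> less_imp_le[OF C1(1)] Cb]
    define w where "w = potential \<rho>"
    have wb: "norm (w z) \<le> B * R" if "norm z \<le> 6 * R" for z
    proof -
      have "norm (w z) \<le> C1 / kap * (\<rho> + norm z)" unfolding w_def by (rule sim(2))
      also have "\<dots> \<le> C1 / kap * (12 * R)"
        using that C1 kap_pos by (intro mult_left_mono) (auto simp: \<rho>_def)
      finally show ?thesis by (simp add: B_def mult_ac)
    qed
    have ew: "exp (- (B * R)) \<le> norm (exp (- w z))" "norm (exp (- w z)) \<le> exp (B * R)" if "norm z \<le> 6 * R" for z
      using wb[OF that] abs_Re_le_cmod[of "w z"] by auto
    define h where "h z = f z * exp (- w z)" for z
    have [measurable]: "w \<in> borel_measurable borel" unfolding w_def by (rule sim(1))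
    have hm [measurable]: "h \<in> borel_measurable borel" unfolding h_def by measurable
    have hb: "norm (h z) \<le> exp (B * R) * norm (f z)" "norm (h z) \<le> exp (B * R)" if "norm z \<le> 6 * R" for z
    proof -
      show 1: "norm (h z) \<le> exp (B * R) * norm (f z)"
        unfolding h_def norm_mult
        using mult_left_mono[OF ew(2)[OF that] norm_ge_zero[of "f z"]] by (simp only: mult.commute)
      have "exp (B * R) * norm (f z) \<le> exp (B * R) * 1" by (intro mult_left_mono f_bound) auto
      then show "norm (h z) \<le> exp (B * R)" using 1 by linarith
    qed
    have weakh: "(LINT z|lborel. h z * dbar (\<psi>' z)) = 0"
      if "C1_deriv \<psi> \<psi>'" "compact S" "S \<subseteq> ball 0 \<rho> - cball 0 1" "\<And>z. z \<notin> S \<Longrightarrow> \<psi> z = 0" for \<psi> \<psi>' S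
      unfolding h_def w_def by (rule sim(3)[OF that])
    define S where "S = cball 0 (11/2 * R) - ball (0::complex) (9/8)"
    have S: "compact S" "S \<subseteq> ball 0 \<rho> - cball 0 1"
      unfolding S_def using R24 by (auto intro: compact_diff simp: \<rho>_def)
    have hS: "norm (h z) \<le> exp (B * R)" if "z \<in> S" for z
      using that R24 by (intro hb) (auto simp: S_def)
    define U where "U = ball 0 (5 * R) - cball (0::complex) (5/4)"
    have oU: "open U" unfolding U_def by (intro open_Diff) auto
    \<comment> \<open>The radii \<open>1 < 9/8 < 5/4 < 3/2\<close> and
      \<open>4 * R < 5 * R < 11/2 * R < 6 * R\<close> leave room for the support \<open>S\<close>
      inside the region of the weak identity, for the set \<open>U\<close> where
      \<open>\<theta> = 1\<close>, and for the closed annulus of the maximum principle inside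
      \<open>U\<close>.\<close>
    define \<theta> where "\<theta> z = complex_of_real (cutoff (5 * R) (11/2 * R) z) * (1 - complex_of_real (cutoff (9/8) (5/4) z))" for z
    obtain \<theta>' where \<theta>: "C1_deriv \<theta> \<theta>'"
      unfolding \<theta>_def[abs_def]
      using C1_mult[OF C1_of_real[OF cutoff_C1[of "5 * R" "11/2 * R"]] C1_diff[OF C1_const C1_of_real[OF cutoff_C1[of "9/8" "5/4"]]]] R24
      by auto
    have \<theta>0: "\<theta> z = 0" if "z \<notin> S" for z
    proof (cases "norm z \<le> 9/8")
      case True
      then have "cutoff (9/8) (5/4) z = 1" by (intro cutoff_eq) auto
      then show ?thesis by (simp add: \<theta>_def)
    next
      case False
      then have "cutoff (5 * R) (11/2 * R) z = 0" using that R24 by (intro cutoff_eq) (auto simp: S_def)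
      then show ?thesis by (simp add: \<theta>_def)
    qed
    have \<theta>1: "\<theta> z = 1" if "z \<in> U" for z
    proof -
      have "cutoff (5 * R) (11/2 * R) z = 1" "cutoff (9/8) (5/4) z = 0"
        using that R24 by (auto simp: U_def intro!: cutoff_eq)
      then show ?thesis by (simp add: \<theta>_def)
    qed
    define k where "k y = h y * dbar (\<theta>' y)" for y
    have rep1: "AE z in lborel. of_real kap * (h z * \<theta> z) = (LINT y|lborel. k y * inverse (z - y))"
      unfolding k_def
      by (rule weakly_holomorphic_representation[OF hm hS S(1) weakh[OF _ S] \<theta> \<theta>0])
    have d\<theta>0: "dbar (\<theta>' z) = 0" if "z \<notin> S" for z
      by (rule dbar_zero_outside[OF \<theta> compact_imp_closed[OF S(1)] \<theta>0 that])
    have d\<theta>1: "dbar (\<theta>' z) = 0" if "z \<in> U" for z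
      by (rule dbar_zero_where_constant[OF \<theta> oU \<theta>1 that])
    obtain B4 where B4: "B4 \<ge> 0" "\<And>z. norm (dbar (\<theta>' z)) \<le> B4"
      using continuous_compact_support_bounded[OF continuous_dbar[OF \<theta>] S(1) d\<theta>0] by metis
    have km: "k \<in> borel_measurable borel"
      unfolding k_def using borel_measurable_continuous_onI[OF continuous_dbar[OF \<theta>]] by measurable
    have kb: "norm (k y) \<le> exp (B * R) * B4" for y
    proof (cases "y \<in> S")
      case True
      then show ?thesis unfolding k_def norm_mult by (intro mult_mono hS B4) auto
    qed (use B4 in \<open>simp add: k_def d\<theta>0\<close>)
    have k0: "k y = 0" if "y \<notin> ball 0 \<rho>" for y
    proof -
      have "y \<notin> S" using that S(2) by blast
      then show ?thesis by (simp add: k_def d\<theta>0)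
    qed
    define F where "F z = (LINT y|lborel. k y * inverse (z - y)) / of_real kap" for z
    have holF: "F holomorphic_on U"
      unfolding F_def using kap_pos
      by (intro holomorphic_intros cauchy_transform_holomorphic[OF km kb k0 oU]) (auto simp: k_def d\<theta>1)
    have Fh: "AE z in lborel. z \<in> U \<longrightarrow> F z = h z"
      using rep1 by eventually_elim (use \<theta>1 kap_pos in \<open>auto simp: F_def divide_eq_eq mult.commute\<close>)
    note contF = holomorphic_on_imp_continuous_on[OF holF]
    have inU: "z \<in> U" if "3/2 \<le> norm z" "norm z \<le> 4 * R" for z
      using that R24 by (auto simp: U_def)
    have FM: "norm (F z) \<le> exp (B * R)" if "z \<in> U" for z
    proof (rule AE_bound_continuous[OF oU contF _ that])
      show "AE z in lborel. z \<in> U \<longrightarrow> norm (F z) \<le> exp (B * R)"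
        using Fh by eventually_elim (use R24 in \<open>auto simp: U_def intro!: hb\<close>)
    qed
    define I where "I = (LINT z|lborel. indicator (cball z0 (1/2)) z * norm (f z))"
    have iI: "integrable lborel (\<lambda>z. indicator (cball z0 (1/2)) z * norm (f z))"
    proof (rule Bochner_Integration.integrable_bound[where f="indicator (cball z0 (1/2)) :: complex \<Rightarrow> real"])
      show "integrable lborel (indicator (cball z0 (1/2)) :: complex \<Rightarrow> real)"
        using emeasure_lborel_cball_finite[of z0 "1/2"] by (simp add: integrable_indicator_iff)
      show "AE z in lborel. norm (indicator (cball z0 (1/2)) z * norm (f z)) \<le> norm (indicat_real (cball z0 (1/2)) z)"
        using f_bound by (intro AE_I2) (auto simp: indicator_def)
      have [measurable]: "cball z0 (1/2) \<in> sets borel" by simp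
      show "(\<lambda>z. indicator (cball z0 (1/2)) z * norm (f z)) \<in> borel_measurable lborel" by measurable
    qed
    have I0: "I \<ge> 0" unfolding I_def by (intro integral_nonneg_AE) auto
    define \<tau> where "\<tau> = D * exp (B * R) * I"
    have rep2: "AE z in lborel. of_real kap * (h z * \<eta> (z - z0)) = (LINT y|lborel. h y * dbar (\<eta>' (y - z0)) * inverse (z - y))"
    proof (rule weakly_holomorphic_representation[OF hm _ compact_cball _ C1_translate[OF \<eta>]])
      have sub: "cball z0 (1/2) \<subseteq> ball 0 \<rho> - cball 0 1"
      proof
        fix z assume "z \<in> cball z0 (1/2)"
        then have "norm (z - z0) \<le> 1/2" by (simp add: dist_norm norm_minus_commute)
        then have "norm z \<le> R + 1/2" "norm z \<ge> R - 1/2"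
          using norm_triangle_ineq2[of z z0] norm_triangle_ineq3[of z z0] z0 by linarith+
        then show "z \<in> ball 0 \<rho> - cball 0 1" using R24 by (simp add: \<rho>_def)
      qed
      show "norm (h z) \<le> exp (B * R)" if "z \<in> cball z0 (1/2)" for z
        using sub that by (intro hb) (auto simp: \<rho>_def)
      show "(LINT z|lborel. h z * dbar (\<psi>' z)) = 0"
        if "C1_deriv \<psi> \<psi>'" "\<And>z. z \<notin> cball z0 (1/2) \<Longrightarrow> \<psi> z = 0" for \<psi> \<psi>'
        by (rule weakh[OF that(1) compact_cball sub that(2)])
      show "\<eta> (z - z0) = 0" if "z \<notin> cball z0 (1/2)" for z
        using that by (intro \<eta>0) (simp add: dist_norm norm_minus_commute)
    qed
    have oV: "open (ball z0 (3/16))" by simp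
    have VU: "ball z0 (3/16) \<subseteq> U"
    proof
      fix z assume "z \<in> ball z0 (3/16)"
      then have "norm (z - z0) < 3/16" by (simp add: dist_norm norm_minus_commute)
      then have "norm z \<le> R + 1/2" "norm z \<ge> R - 1/2"
        using norm_triangle_ineq2[of z z0] norm_triangle_ineq3[of z z0] z0 by linarith+
      then show "z \<in> U" using R24 by (simp add: U_def)
    qed
    have F\<tau>: "norm (F z) \<le> \<tau>" if "z \<in> ball z0 (3/16)" for z
    proof (rule AE_bound_continuous[OF oV continuous_on_subset[OF contF VU] _ that])
      show "AE z in lborel. z \<in> ball z0 (3/16) \<longrightarrow> norm (F z) \<le> \<tau>"
        using rep2 Fh
      proof (eventually_elim, intro impI)
        fix z assume r: "of_real kap * (h z * \<eta> (z - z0)) = (LINT y|lborel. h y * dbar (\<eta>' (y - z0)) * inverse (z - y))"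
          and Fz: "z \<in> U \<longrightarrow> F z = h z" and z: "z \<in> ball z0 (3/16)"
        have \<eta>z: "\<eta> (z - z0) = 1" using z by (intro \<eta>1) (simp add: dist_norm norm_minus_commute)
        have pt: "norm (h y * dbar (\<eta>' (y - z0)) * inverse (z - y)) \<le> (16 * B3 * exp (B * R)) * (indicator (cball z0 (1/2)) y * norm (f y))" for y
        proof (cases "dbar (\<eta>' (y - z0)) = 0")
          case False
          then have y: "norm (y - z0) \<le> 1/2" "norm (y - z0) \<ge> 1/4"
            using d\<eta>0[of "y - z0"] d\<eta>1[of "y - z0"] by force+
          have "norm (z - y) \<ge> 1/16"
            using y(2) z norm_triangle_ineq4[of "z - z0" "z - y"] by (simp add: dist_norm norm_minus_commute)
          then have i: "inverse (norm (z - y)) \<le> 16"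
            using le_imp_inverse_le[of "1/16" "norm (z - y)"] by simp
          have "norm y \<le> R + 1/2" using norm_triangle_ineq2[of y z0] y z0 by linarith
          then have hy: "norm (h y) \<le> exp (B * R) * norm (f y)" using R24 by (intro hb) auto
          have "norm (h y * dbar (\<eta>' (y - z0)) * inverse (z - y)) \<le> (exp (B * R) * norm (f y)) * B3 * 16"
            unfolding norm_mult norm_inverse using B3 hy i by (intro mult_mono) auto
          then show ?thesis using y by (simp add: dist_norm norm_minus_commute mult_ac)
        qed (use B3 in auto)
        have "norm (of_real kap * h z) \<le> (LINT y|lborel. norm (h y * dbar (\<eta>' (y - z0)) * inverse (z - y)))"
          using r \<eta>z integral_norm_bound[of lborel "\<lambda>y. h y * dbar (\<eta>' (y - z0)) * inverse (z - y)"] by simp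
        also have "\<dots> \<le> (LINT y|lborel. (16 * B3 * exp (B * R)) * (indicator (cball z0 (1/2)) y * norm (f y)))"
        proof (rule integral_mono_AE')
          show "integrable lborel (\<lambda>y. (16 * B3 * exp (B * R)) * (indicator (cball z0 (1/2)) y * norm (f y)))"
            by (intro integrable_mult_right iI)
          show "AE y in lborel. 0 \<le> (16 * B3 * exp (B * R)) * (indicator (cball z0 (1/2)) y * norm (f y))"
            using B3 by (intro AE_I2) (auto intro!: mult_nonneg_nonneg)
        qed (intro AE_I2 pt)
        also have "\<dots> = (16 * B3 * exp (B * R)) * I" by (simp add: I_def)
        also have "\<dots> \<le> (16 * (B3 + 1) * exp (B * R)) * I"
          using I0 by (intro mult_right_mono) auto
        finally have "norm (h z) \<le> (16 * (B3 + 1) * exp (B * R)) * I / kap"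
          using kap_pos by (simp add: norm_mult pos_le_divide_eq mult.commute)
        then show "norm (F z) \<le> \<tau>"
          using Fz z VU by (auto simp: \<tau>_def D_def)
      qed
    qed
    \<comment> \<open>\<open>F\<close> and \<open>h\<close> agree only almost everywhere, so a
      single point with large \<open>norm (f z)\<close> is not enough; the contradiction uses that
      such points would otherwise form a null set.\<close>
    have "\<exists>z1\<in>ball 3 1. F z1 = h z1 \<and> norm (f z1) > m0"
    proof (rule ccontr)
      assume neg: "\<not> ?thesis"
      have "AE z in lborel. indicator (ball 3 1) z * (norm (f z))\<^sup>2 \<le> c0 / (2 * v) * indicator (ball (3::complex) 1) z"
        using Fh
      proof eventually_elim
        case (elim z)
        show ?case
        proof (cases "z \<in> ball 3 1")
          case True
          then have "norm (z - 3) < 1" by (simp add: dist_norm norm_minus_commute)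
          then have "norm z \<ge> 2" "norm z \<le> 4"
            using norm_triangle_ineq2[of z 3] norm_triangle_ineq3[of z 3] by simp_all
          then have "z \<in> U" by (intro inU) (use R24 in auto)
          then have "norm (f z) \<le> m0" using neg elim True by force
          then have "(norm (f z))\<^sup>2 \<le> m0\<^sup>2" by (intro power_mono) auto
          then show ?thesis using True c0 v by (simp add: m0_def)
        qed simp
      qed
      then have "(LINT z|lborel. indicator (ball 3 1) z * (norm (f z))\<^sup>2) \<le> (LINT z|lborel. c0 / (2 * v) * indicator (ball (3::complex) 1) z)"
      proof (rule integral_mono_AE'[rotated])
        show "integrable lborel (\<lambda>z. c0 / (2 * v) * indicator (ball (3::complex) 1) z)"
          using emeasure_lborel_ball_finite[of "3::complex" 1]
          by (intro integrable_mult_right) (simp add: integrable_indicator_iff)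
        show "AE z in lborel. 0 \<le> c0 / (2 * v) * indicator (ball (3::complex) 1) z"
          using c0 v by (intro AE_I2) auto
      qed
      also have "\<dots> = c0 / 2" using v by (simp add: v_def)
      finally show False using low c0 by simp
    qed
    then obtain z1 where z1: "z1 \<in> ball 3 1" "F z1 = h z1" "norm (f z1) > m0" by blast
    have nz1: "2 < norm z1" "norm z1 < 4"
    proof -
      have "norm (z1 - 3) < 1" using z1 by (simp add: dist_norm norm_minus_commute)
      then show "2 < norm z1" "norm z1 < 4"
        using norm_triangle_ineq2[of 3 z1] norm_triangle_ineq2[of z1 3] by (simp_all add: norm_minus_commute)
    qed
    have hz1: "norm (F z1) \<ge> exp (- (B * R)) * m0"
    proof -
      have "m0 * exp (- (B * R)) \<le> norm (f z1) * norm (exp (- w z1))"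
        using ew(1)[of z1] nz1 R24 z1 m0 by (intro mult_mono) auto
      then show ?thesis unfolding z1(2) h_def norm_mult by (simp add: mult.commute)
    qed
    have "exp (- C2 * R * (ln R)\<^sup>2) \<le> \<tau>"
    proof (rule C2(3)[rule_format, OF R z0 holF oU inU _ _ _ nz1 hz1])
      show "norm (F z) \<le> exp (B * R)" if "3/2 \<le> norm z" "norm z \<le> 4 * R" for z
        by (rule FM[OF inU[OF that]])
      show "1 \<le> exp (B * R)" using B R24 by simp
      show "norm (F z) \<le> \<tau>" if "norm (z - z0) \<le> 1/8" for z
        using that by (intro F\<tau>) (simp add: dist_norm norm_minus_commute)
      show "0 < exp (- (B * R)) * m0" using m0 by simp
      have "exp (B * R) / (exp (- (B * R)) * m0) = exp (2 * (B * R)) * (1 / m0)"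
      proof -
        have "exp (2 * (B * R)) = exp (B * R) * exp (B * R)" by (simp add: exp_add[symmetric])
        then show ?thesis using m0 by (simp add: exp_minus field_simps)
      qed
      also have "\<dots> \<le> exp (2 * (B * R)) * exp (1 / m0 * R)"
      proof (rule mult_left_mono)
        have "1 / m0 \<le> 1 / m0 * R" using m0 R24 by (simp add: divide_right_mono)
        also have "\<dots> \<le> exp (1 / m0 * R)" using exp_ge_add_one_self[of "1 / m0 * R"] by linarith
        finally show "1 / m0 \<le> exp (1 / m0 * R)" .
      qed simp
      also have "\<dots> = exp (c * R)" by (simp add: c_def exp_add[symmetric] algebra_simps)
      finally show "exp (B * R) / (exp (- (B * R)) * m0) \<le> exp (c * R)" .
    qed
    then have "exp (- C2 * R * (ln R)\<^sup>2) * (exp (- (B * R)) * (1 / D)) \<le> \<tau> * (exp (- (B * R)) * (1 / D))"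
      using D by (intro mult_right_mono) auto
    also have "\<dots> = I" using D by (simp add: \<tau>_def exp_minus field_simps)
    finally have I1: "exp (- C2 * R * (ln R)\<^sup>2) * (exp (- (B * R)) * (1 / D)) \<le> I" .
    \<comment> \<open>As \<open>R\<close> and \<open>ln R\<close> are at least 1, the losses
      \<open>B * R\<close> and \<open>D\<close> are absorbed into the coefficient of
      \<open>R * (ln R)\<^sup>2\<close>, using \<open>1 / D \<ge> exp (- D)\<close>.\<close>
    have "exp (- C * R * (ln R)\<^sup>2) \<le> exp (- C2 * R * (ln R)\<^sup>2) * (exp (- (B * R)) * (1 / D))"
    proof -
      have lnR: "1 \<le> ln R"
      proof -
        have "exp 1 \<le> R" using exp_le R24 by linarith
        then show ?thesis using R24 by (subst ln_ge_iff) auto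
      qed
      have "1 * 1 \<le> R * (ln R)\<^sup>2" using R24 lnR by (intro mult_mono one_le_power) auto
      then have "D * 1 \<le> D * (R * (ln R)\<^sup>2)" using D by (intro mult_left_mono) auto
      moreover have "B * (R * 1) \<le> B * (R * (ln R)\<^sup>2)"
        using B R24 lnR by (intro mult_left_mono one_le_power) auto
      ultimately have "- C * R * (ln R)\<^sup>2 \<le> - C2 * R * (ln R)\<^sup>2 + (- (B * R) + - D)"
        by (simp add: C_def algebra_simps)
      then have "exp (- C * R * (ln R)\<^sup>2) \<le> exp (- C2 * R * (ln R)\<^sup>2) * (exp (- (B * R)) * exp (- D))"
        unfolding exp_add[symmetric] by simp
      also have "\<dots> \<le> exp (- C2 * R * (ln R)\<^sup>2) * (exp (- (B * R)) * (1 / D))"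
      proof (intro mult_left_mono)
        have "D \<le> exp D" using exp_ge_add_one_self[of D] by linarith
        then show "exp (- D) \<le> 1 / D" using D by (simp add: exp_minus field_simps)
      qed auto
      finally show ?thesis .
    qed
    then show "(LINT z|lborel. indicator (cball z0 (1/2)) z * norm (f z)) \<ge> exp (- C * R * (ln R)\<^sup>2)"
      using I1 by (simp add: I_def)
  qed
qed

section \<open>The energy estimate\<close>

lemma integrable_bounded_support:
  fixes F :: "complex \<Rightarrow> 'b::{banach, second_countable_topology}"
  assumes "F \<in> borel_measurable borel" "compact S" "\<And>z. norm (F z) \<le> M" "\<And>z. z \<notin> S \<Longrightarrow> F z = 0"
  shows "integrable lborel F"
proof (rule Bochner_Integration.integrable_bound[where f="\<lambda>z. M * indicator S z"])
  have "emeasure lborel S < \<infinity>" using emeasure_bounded_finite[OF compact_imp_bounded[OF assms(2)]] by simp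
  then show "integrable lborel (\<lambda>z. M * indicator S z)"
    using borel_compact[OF assms(2)] by (intro integrable_mult_right) (simp add: integrable_indicator_iff)
  show "AE z in lborel. norm (F z) \<le> norm (M * indicator S z)"
    using assms(3,4) by (intro AE_I2) (auto simp: indicator_def intro: order_trans[OF assms(3)])
qed (use assms(1) in simp)

lemma derivative_expand:
  assumes "C1_deriv \<phi> \<phi>'"
  shows "\<phi>' z w = Re w *\<^sub>R \<phi>' z 1 + Im w *\<^sub>R \<phi>' z \<i>"
  using linear_Basis_expand[OF C1_derivD(3)[OF assms], of z w] by (simp add: Basis_complex_def)

lemma derivative_measurable:
  fixes \<phi>' :: "complex \<Rightarrow> complex \<Rightarrow> 'b::euclidean_space"
  assumes "C1_deriv \<phi> \<phi>'" and [measurable]: "V \<in> borel_measurable borel"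
  shows "(\<lambda>z. \<phi>' z (V z)) \<in> borel_measurable borel"
proof -
  note [measurable] = borel_measurable_continuous_onI[OF C1_derivD(2)[OF assms(1)]]
  show ?thesis unfolding derivative_expand[OF assms(1), of _ "V _"] by measurable
qed

lemma derivative_norm_le:
  assumes "C1_deriv \<phi> \<phi>'" "norm (\<phi>' z 1) \<le> B" "norm (\<phi>' z \<i>) \<le> B"
  shows "norm (\<phi>' z h) \<le> 2 * B * norm h"
  using linear_norm_le_Basis[OF C1_derivD(3)[OF assms(1)], of z B h] assms(2,3)
  by (auto simp: Basis_complex_def)

text \<open>The drift enters only through the scalar \<open>b\<close>, which stands for the product
  of drift and gradient. Multiplication by \<open>\<i>\<close> is a quarter turn, so
  \<open>weak_curl\<close> says that the rotated gradient is divergence free.\<close>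

locale weak_solution = young_pair +
  fixes u b :: "complex \<Rightarrow> real" and G :: "complex \<Rightarrow> complex"
  assumes u_measurable [measurable]: "u \<in> borel_measurable borel"
    and b_measurable [measurable]: "b \<in> borel_measurable borel"
    and G_measurable [measurable]: "G \<in> borel_measurable borel"
    and G_bound: "norm (G z) \<le> 1"
    and b_bound: "\<bar>b z\<bar> \<le> N z * norm (G z)"
    and N_nonneg: "N z \<ge> 0"
    and weak_grad: "C1_deriv \<phi> \<phi>' \<Longrightarrow> compact S \<Longrightarrow> S \<subseteq> - cball 0 1 \<Longrightarrow> (\<And>z. z \<notin> S \<Longrightarrow> \<phi> z = 0) \<Longrightarrow>
      (LINT z|lborel. u z * \<phi>' z h + (G z \<bullet> h) * \<phi> z) = 0"
    and weak_div: "C1_deriv \<phi> \<phi>' \<Longrightarrow> compact S \<Longrightarrow> S \<subseteq> - cball 0 1 \<Longrightarrow> (\<And>z. z \<notin> S \<Longrightarrow> \<phi> z = 0) \<Longrightarrow>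
      (LINT z|lborel. \<phi>' z (G z) + b z * \<phi> z) = 0"
    and weak_curl: "C1_deriv \<phi> \<phi>' \<Longrightarrow> compact S \<Longrightarrow> S \<subseteq> - cball 0 1 \<Longrightarrow> (\<And>z. z \<notin> S \<Longrightarrow> \<phi> z = 0) \<Longrightarrow>
      (LINT z|lborel. \<phi>' z (\<i> * G z)) = 0"
begin

lemma weak_terms_integrable:
  fixes \<phi> :: "complex \<Rightarrow> real"
  assumes \<phi>: "C1_deriv \<phi> \<phi>'" and S: "compact S" "\<And>z. z \<notin> S \<Longrightarrow> \<phi> z = 0"
  shows "integrable lborel (\<lambda>z. \<phi>' z (G z))" "integrable lborel (\<lambda>z. \<phi>' z (\<i> * G z))" "integrable lborel (\<lambda>z. b z * \<phi> z)"
proof -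
  note d0 = has_derivative_zero_outside[OF C1_derivD(1)[OF \<phi>] compact_imp_closed[OF S(1)] S(2)]
  obtain B0 B1 B2 where B: "\<And>z. norm (\<phi> z) \<le> B0" "\<And>z. norm (\<phi>' z 1) \<le> B1" "\<And>z. norm (\<phi>' z \<i>) \<le> B2" "B0 \<ge> 0"
    using continuous_compact_support_bounded[OF C1_derivD(4)[OF \<phi>] S]
      continuous_compact_support_bounded[OF C1_derivD(2)[OF \<phi>] S(1) d0] by metis
  have le: "norm (\<phi>' z h) \<le> 2 * max B1 B2" if "norm h \<le> 1" for z h
  proof -
    have "norm (\<phi>' z h) \<le> 2 * max B1 B2 * norm h"
      using B(2,3)[of z] by (intro derivative_norm_le[OF \<phi>]) auto
    also have "\<dots> \<le> 2 * max B1 B2 * 1"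
      using B(2)[of z] norm_ge_zero[of "\<phi>' z 1"] that by (intro mult_left_mono) (auto simp: le_max_iff_disj)
    finally show ?thesis by simp
  qed
  have iG: "(\<lambda>z. \<i> * G z) \<in> borel_measurable borel" "norm (\<i> * G z) \<le> 1" for z
    using G_bound[of z] by (measurable, simp add: norm_mult)
  show "integrable lborel (\<lambda>z. \<phi>' z (G z))"
    by (rule integrable_bounded_support[OF derivative_measurable[OF \<phi> G_measurable] S(1) le[OF G_bound] d0])
  show "integrable lborel (\<lambda>z. \<phi>' z (\<i> * G z))"
    by (rule integrable_bounded_support[OF derivative_measurable[OF \<phi> iG(1)] S(1) le[OF iG(2)] d0])
  obtain r where r: "S \<subseteq> ball 0 r"
    using compact_imp_bounded[OF S(1)] bounded_subset_ballD by blast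
  have [measurable]: "\<phi> \<in> borel_measurable borel"
    by (rule borel_measurable_continuous_onI[OF C1_derivD(4)[OF \<phi>]])
  show "integrable lborel (\<lambda>z. b z * \<phi> z)"
  proof (rule integrable_restrict[where B=B0 and r=r])
    fix z
    have "\<bar>b z\<bar> \<le> N z"
      using b_bound[of z] mult_left_mono[OF G_bound N_nonneg, of z z] by simp
    then show "norm (b z * \<phi> z) \<le> B0 * N z"
      using B(1)[of z] N_nonneg[of z] by (simp add: abs_mult mult.commute[of B0] mult_mono)
    show "b z * \<phi> z = 0" if "z \<notin> ball 0 r"
    proof -
      have "z \<notin> S" using that r by blast
      then show ?thesis by (simp add: S(2))
    qed
  qed (use B in auto)
qed

text \<open>For \<open>f = cnj G\<close> the real and imaginary parts of
  \<open>f * dbar (\<psi>' z)\<close> are combinations of \<open>weak_div\<close> and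
  \<open>weak_curl\<close> terms for \<open>Re \<psi>\<close> and \<open>Im \<psi>\<close>. The
  quotient \<open>b / f\<close> is a valid coefficient because \<open>b_bound\<close> forces
  \<open>b\<close> to vanish where \<open>G\<close> does.\<close>

lemma drift_system: "drift_system N H q (\<lambda>z. cnj (G z)) (\<lambda>z. if G z = 0 then 0 else of_real (b z) / cnj (G z))"
proof
  have "continuous_on UNIV cnj" by (intro continuous_intros)
  note cm [measurable] = borel_measurable_continuous_onI[OF this]
  show "(\<lambda>z. cnj (G z)) \<in> borel_measurable borel" by measurable
  show "(\<lambda>z. if G z = 0 then 0 else complex_of_real (b z) / cnj (G z)) \<in> borel_measurable borel" by measurable
  show "norm (cnj (G z)) \<le> 1" for z using G_bound by simp
  show "norm (if G z = 0 then 0 else complex_of_real (b z) / cnj (G z)) \<le> N z" for z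
    using b_bound[of z] N_nonneg[of z] by (auto simp: norm_divide pos_divide_le_eq)
  fix \<psi> \<psi>' S
  assume \<psi>: "C1_deriv \<psi> \<psi>'" and S: "compact S" "S \<subseteq> - cball (0::complex) 1" and \<psi>0: "\<And>z. z \<notin> S \<Longrightarrow> \<psi> z = (0::complex)"
  have re: "C1_deriv (\<lambda>z. Re (\<psi> z)) (\<lambda>z h. Re (\<psi>' z h))" and im: "C1_deriv (\<lambda>z. Im (\<psi> z)) (\<lambda>z h. Im (\<psi>' z h))"
    by (rule C1_derivI; intro bounded_linear.has_derivative[OF bounded_linear_Re] bounded_linear.has_derivative[OF bounded_linear_Im]
        C1_derivD(1)[OF \<psi>] continuous_intros C1_derivD(2)[OF \<psi>])+
  have re0: "Re (\<psi> z) = 0" and im0: "Im (\<psi> z) = 0" if "z \<notin> S" for z using \<psi>0[OF that] by auto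
  note ir = weak_terms_integrable[OF re S(1) re0] and ii = weak_terms_integrable[OF im S(1) im0]
  have pt: "cnj (G z) * dbar (\<psi>' z) + (if G z = 0 then 0 else complex_of_real (b z) / cnj (G z)) * cnj (G z) * \<psi> z =
      of_real ((Re (\<psi>' z (G z)) + b z * Re (\<psi> z)) - Im (\<psi>' z (\<i> * G z)))
      + \<i> * of_real ((Im (\<psi>' z (G z)) + b z * Im (\<psi> z)) + Re (\<psi>' z (\<i> * G z)))" for z
  proof -
    have b: "(if G z = 0 then 0 else complex_of_real (b z) / cnj (G z)) * cnj (G z) = of_real (b z)"
      using b_bound[of z] by auto
    show ?thesis
      unfolding b dbar_def derivative_expand[OF \<psi>, of z "G z"] derivative_expand[OF \<psi>, of z "\<i> * G z"]
      by (simp add: complex_eq_iff algebra_simps)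
  qed
  have split_complex: "(LINT z|lborel. of_real (p z) + \<i> * of_real (r z)) = of_real (LINT z|lborel. p z) + \<i> * of_real (LINT z|lborel. r z)"
    if "integrable lborel p" "integrable lborel r" for p r :: "complex \<Rightarrow> real"
    using that by simp
  have "(LINT z|lborel. cnj (G z) * dbar (\<psi>' z) + (if G z = 0 then 0 else complex_of_real (b z) / cnj (G z)) * cnj (G z) * \<psi> z) =
     of_real (LINT z|lborel. Re (\<psi>' z (G z)) + b z * Re (\<psi> z) - Im (\<psi>' z (\<i> * G z)))
      + \<i> * of_real (LINT z|lborel. Im (\<psi>' z (G z)) + b z * Im (\<psi> z) + Re (\<psi>' z (\<i> * G z)))"
    unfolding pt
  proof (rule split_complex)
    show "integrable lborel (\<lambda>z. Re (\<psi>' z (G z)) + b z * Re (\<psi> z) - Im (\<psi>' z (\<i> * G z)))"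
      "integrable lborel (\<lambda>z. Im (\<psi>' z (G z)) + b z * Im (\<psi> z) + Re (\<psi>' z (\<i> * G z)))"
      using ir ii by (intro Bochner_Integration.integrable_diff Bochner_Integration.integrable_add; simp)+
  qed
  also have "\<dots> = 0"
    using weak_div[OF re S re0] weak_div[OF im S im0] weak_curl[OF re S re0] weak_curl[OF im S im0] ir ii by simp
  finally show "(LINT z|lborel. cnj (G z) * dbar (\<psi>' z) + (if G z = 0 then 0 else complex_of_real (b z) / cnj (G z)) * cnj (G z) * \<psi> z) = 0" .
qed

text \<open>Testing \<open>weak_div\<close> with \<open>\<phi> * u\<close> gives the integral of
  \<open>\<phi> * (norm G)\<^sup>2\<close> as minus that of
  \<open>u * (\<phi>' G + b * \<phi>)\<close>; since \<open>norm G \<le> 1\<close>, the bracket has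
  a bounded integral and the result is linear in \<open>s\<close>. As \<open>u\<close> is not
  \<open>C^1\<close>, it is localised by \<open>\<theta>\<close> and mollified, with an error that
  vanishes in L1.\<close>

lemma energy_estimate:
  fixes z0 :: complex
  assumes z0: "norm z0 \<ge> 3" and s: "\<And>z. z \<in> ball z0 1 \<Longrightarrow> \<bar>u z\<bar> \<le> s"
    and B: "\<And>z. \<bar>cutoff' (1/2) (5/8) z 1\<bar> \<le> B" "\<And>z. \<bar>cutoff' (1/2) (5/8) z \<i>\<bar> \<le> B"
  shows "(LINT z|lborel. indicator (cball z0 (1/2)) z * (norm (G z))\<^sup>2) \<le> ((2 * B + 1) * measure lborel (ball z0 1) + 1) * s"
proof -
  have s0: "s \<ge> 0" using s[of z0] by auto
  have B0: "B \<ge> 0" using B(1)[of 0] by auto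
  define S where "S = cball z0 (7/8)"
  have cS: "compact S" unfolding S_def by simp
  have SU: "S \<subseteq> - cball 0 1"
  proof
    fix z assume "z \<in> S"
    then have "norm (z0 - z) \<le> 7/8" by (simp add: S_def dist_norm)
    then show "z \<in> - cball 0 1" using z0 norm_triangle_sub[of z0 z] by simp
  qed
  have S1: "S \<subseteq> ball z0 1" by (auto simp: S_def)
  \<comment> \<open>\<open>\<theta>\<close> is 1 on a ball of radius \<open>3/4\<close>, which
    contains the support of \<open>\<phi>\<close> (radius \<open>5/8\<close>), so the localisation
    is invisible where \<open>\<phi>\<close> is nonzero.\<close>
  define \<theta> where "\<theta> z = cutoff (3/4) (7/8) (z - z0)" for z
  define \<theta>' where "\<theta>' z = cutoff' (3/4) (7/8) (z - z0)" for z
  have \<theta>: "C1_deriv \<theta> \<theta>'"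
    unfolding \<theta>_def[abs_def] \<theta>'_def[abs_def] by (intro C1_translate cutoff_C1) auto
  have \<theta>0: "\<theta> z = 0" if "z \<notin> S" for z
    using that unfolding \<theta>_def by (intro cutoff_eq) (auto simp: S_def dist_norm norm_minus_commute)
  have \<theta>'0: "\<theta>' z h = 0" if "z \<notin> S" for z h
    by (rule has_derivative_zero_outside[OF C1_derivD(1)[OF \<theta>] compact_imp_closed[OF cS] \<theta>0 that])
  have \<theta>1: "\<theta> z = 1" if "z \<in> ball z0 (3/4)" for z
    using that unfolding \<theta>_def by (intro cutoff_eq) (auto simp: dist_norm norm_minus_commute)
  have \<theta>'1: "\<theta>' z h = 0" if "z \<in> ball z0 (3/4)" for z h
    using has_derivative_zero_outside[OF C1_derivD(1)[OF C1_diff[OF \<theta> C1_const[of 1]]], of "- ball z0 (3/4)" z h] \<theta>1 that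
    by auto
  define \<phi> where "\<phi> z = cutoff (1/2) (5/8) (z - z0)" for z
  define \<phi>' where "\<phi>' z = cutoff' (1/2) (5/8) (z - z0)" for z
  have \<phi>: "C1_deriv \<phi> \<phi>'"
    unfolding \<phi>_def[abs_def] \<phi>'_def[abs_def] by (intro C1_translate cutoff_C1) auto
  have \<phi>b: "0 \<le> \<phi> z" "\<phi> z \<le> 1" for z unfolding \<phi>_def by (rule cutoff_bounds)+
  have \<phi>0: "\<phi> z = 0" if "z \<notin> cball z0 (5/8)" for z
    using that unfolding \<phi>_def by (intro cutoff_eq) (auto simp: dist_norm norm_minus_commute)
  have \<phi>S: "\<phi> z = 0" if "z \<notin> S" for z
    using that by (intro \<phi>0) (auto simp: S_def)
  have \<phi>'0: "\<phi>' z h = 0" if "z \<notin> S" for z h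
    by (rule has_derivative_zero_outside[OF C1_derivD(1)[OF \<phi>] compact_imp_closed[OF cS] \<phi>S that])
  have \<phi>1: "\<phi> z = 1" if "z \<in> cball z0 (1/2)" for z
    using that unfolding \<phi>_def by (intro cutoff_eq) (auto simp: dist_norm norm_minus_commute)
  note [measurable] = borel_measurable_continuous_onI[OF C1_derivD(4)[OF \<theta>]] borel_measurable_continuous_onI[OF C1_derivD(2)[OF \<theta>]]
    borel_measurable_continuous_onI[OF C1_derivD(4)[OF \<phi>]] borel_measurable_continuous_onI[OF C1_derivD(2)[OF \<phi>]]
    derivative_measurable[OF \<phi> G_measurable]
  obtain B1 B2 where B12: "B1 \<ge> 0" "\<And>z. norm (\<theta>' z 1) \<le> B1" "B2 \<ge> 0" "\<And>z. norm (\<theta>' z \<i>) \<le> B2"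
    using continuous_compact_support_bounded[OF C1_derivD(2)[OF \<theta>] cS \<theta>'0] by metis
  define v where "v z = \<theta> z * u z" for z
  \<comment> \<open>The weak gradient of \<open>v = \<theta> * u\<close> by the product
    rule.\<close>
  define \<gamma> where "\<gamma> z = of_real (\<theta> z) * G z + of_real (u z) * Complex (\<theta>' z 1) (\<theta>' z \<i>)" for z
  have \<gamma>h: "\<gamma> z \<bullet> h = \<theta> z * (G z \<bullet> h) + u z * \<theta>' z h" for z h
    unfolding \<gamma>_def derivative_expand[OF \<theta>, of z h] by (simp add: inner_complex_def algebra_simps)
  have vm [measurable]: "v \<in> borel_measurable borel" unfolding v_def by measurable
  have \<gamma>m [measurable]: "\<gamma> \<in> borel_measurable borel" unfolding \<gamma>_def Complex_eq by measurable
  have us: "\<bar>u z\<bar> \<le> s" if "z \<in> S" for z using s S1 that by blast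
  have v0: "v z = 0" and \<gamma>0: "\<gamma> z = 0" if "z \<notin> S" for z
    using \<theta>0[OF that] \<theta>'0[OF that] by (auto simp: v_def \<gamma>_def complex_eq_iff)
  have vb: "norm (v z) \<le> s" for z
  proof (cases "z \<in> S")
    case True
    have "\<bar>\<theta> z\<bar> * \<bar>u z\<bar> \<le> 1 * s"
      using cutoff_bounds[of "3/4" "7/8" "z - z0"] us[OF True] by (intro mult_mono) (auto simp: \<theta>_def)
    then show ?thesis by (simp add: v_def abs_mult)
  qed (simp add: v0 s0)
  have \<gamma>b: "norm (\<gamma> z) \<le> 1 + s * (B1 + B2)" for z
  proof (cases "z \<in> S")
    case True
    have "norm (Complex (\<theta>' z 1) (\<theta>' z \<i>)) \<le> B1 + B2"
      using B12 cmod_le[of "Complex (\<theta>' z 1) (\<theta>' z \<i>)"] by (auto intro: order_trans[OF _ add_mono])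
    then have "\<bar>u z\<bar> * norm (Complex (\<theta>' z 1) (\<theta>' z \<i>)) \<le> s * (B1 + B2)"
      using us[OF True] s0 by (intro mult_mono) auto
    moreover have "\<bar>\<theta> z\<bar> * norm (G z) \<le> 1 * 1"
      using cutoff_bounds[of "3/4" "7/8" "z - z0"] G_bound by (intro mult_mono) (auto simp: \<theta>_def)
    ultimately show ?thesis
      unfolding \<gamma>_def by (intro order_trans[OF norm_triangle_ineq]) (simp add: norm_mult)
  qed (use s0 B12 in \<open>simp add: \<gamma>0\<close>)
  have vi: "integrable lborel v"
    by (rule integrable_bounded_support[OF vm cS vb v0])
  have \<gamma>i: "integrable lborel \<gamma>"
    by (rule integrable_bounded_support[OF \<gamma>m cS \<gamma>b \<gamma>0])
  define \<delta> where "\<delta> n = inverse (real (Suc n))" for n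
  have \<delta>: "\<delta> n > 0" "\<delta> \<longlonglongrightarrow> 0" for n
    unfolding \<delta>_def[abs_def] by (simp, rule LIMSEQ_inverse_real_of_nat)
  define \<Gamma> where "\<Gamma> n z = (LINT y|lborel. \<gamma> y * of_real (poisson2 (\<delta> n) (z - y)))" for n z
  define w where "w n z = (LINT y|lborel. v y * poisson2 (\<delta> n) (z - y)) * inverse kap" for n z
  define w' where "w' n z h = (\<Gamma> n z \<bullet> h) * inverse kap" for n z h
  note P1 = poisson2_C1[OF \<delta>(1)]
  have wC: "C1_deriv (w n) (w' n)" for n
  proof -
    \<comment> \<open>Mollification commutes with the weak gradient: \<open>weak_grad\<close> is
      applied to the test function \<open>\<theta> y * poisson2 (\<delta> n) (z - y)\<close> in the
      variable \<open>y\<close>.\<close>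
    have "(LINT y|lborel. v y * poisson2' (\<delta> n) (z - y) h) = \<Gamma> n z \<bullet> h" for z h
    proof -
      have i1: "integrable lborel (\<lambda>y. v y * poisson2' (\<delta> n) (z - y) h)"
        by (rule conv_integrable[OF vi cS v0 C1_derivD(2)[OF P1]])
      have i2: "integrable lborel (\<lambda>y. \<gamma> y * of_real (poisson2 (\<delta> n) (z - y)))"
        by (rule integrable_mult_poisson2[OF \<gamma>i \<delta>(1)])
      have eq2: "(\<gamma> y * of_real (poisson2 (\<delta> n) (z - y))) \<bullet> h = (\<gamma> y \<bullet> h) * poisson2 (\<delta> n) (z - y)" for y
        by (simp add: inner_complex_def algebra_simps)
      have "(LINT y|lborel. u y * (\<theta> y * - poisson2' (\<delta> n) (z - y) h + \<theta>' y h * poisson2 (\<delta> n) (z - y)) + (G y \<bullet> h) * (\<theta> y * poisson2 (\<delta> n) (z - y))) = 0"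
        by (rule weak_grad[OF C1_mult[OF \<theta> C1_reflect[OF P1[of n], of z]] cS SU]) (simp add: \<theta>0)
      moreover have "u y * (\<theta> y * - poisson2' (\<delta> n) (z - y) h + \<theta>' y h * poisson2 (\<delta> n) (z - y)) + (G y \<bullet> h) * (\<theta> y * poisson2 (\<delta> n) (z - y))
         = (\<gamma> y * of_real (poisson2 (\<delta> n) (z - y))) \<bullet> h - v y * poisson2' (\<delta> n) (z - y) h" for y
        unfolding eq2 \<gamma>h v_def by (simp add: algebra_simps)
      ultimately have "(LINT y|lborel. (\<gamma> y * of_real (poisson2 (\<delta> n) (z - y))) \<bullet> h - v y * poisson2' (\<delta> n) (z - y) h) = 0"
        by (simp only:)
      then have "(LINT y|lborel. (\<gamma> y * of_real (poisson2 (\<delta> n) (z - y))) \<bullet> h) = (LINT y|lborel. v y * poisson2' (\<delta> n) (z - y) h)"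
        by (subst (asm) Bochner_Integration.integral_diff) (auto intro: i1 integrable_inner_left i2)
      then show ?thesis
        unfolding \<Gamma>_def using i2 by simp
    qed
    then show ?thesis
      using C1_mult[OF conv_C1_deriv[OF vi cS v0 P1[of n]] C1_const[of "inverse kap"]]
      unfolding w_def[abs_def] w'_def[abs_def] by simp
  qed
  \<comment> \<open>\<open>w n\<close> averages \<open>v\<close> against a positive kernel of mass
    \<open>kap\<close> and is divided by \<open>kap\<close>, so the sup bound survives without
    loss.\<close>
  have wb: "\<bar>w n z\<bar> \<le> s" for n z
  proof -
    have "norm (LINT y|lborel. v y * poisson2 (\<delta> n) (z - y)) \<le> (LINT y|lborel. norm (v y * poisson2 (\<delta> n) (z - y)))"
      by (rule integral_norm_bound)
    also have "\<dots> \<le> (LINT y|lborel. s * poisson2 (\<delta> n) (z - y))"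
    proof (rule integral_mono)
      show "integrable lborel (\<lambda>y. norm (v y * poisson2 (\<delta> n) (z - y)))"
        by (rule integrable_norm[OF conv_integrable[OF vi cS v0 C1_derivD(4)[OF P1]]])
      show "integrable lborel (\<lambda>y. s * poisson2 (\<delta> n) (z - y))"
        by (intro integrable_mult_right integral_poisson2 \<delta>)
      show "norm (v y * poisson2 (\<delta> n) (z - y)) \<le> s * poisson2 (\<delta> n) (z - y)" for y
        unfolding norm_mult using vb poisson2_bounds(1)[OF \<delta>(1)] by (auto intro!: mult_mono s0)
    qed
    also have "\<dots> = s * kap" using integral_poisson2(2)[OF \<delta>(1)] by simp
    finally show ?thesis
      using kap_pos by (simp add: w_def abs_mult divide_inverse[symmetric] pos_divide_le_eq)
  qed
  have \<Gamma>c: "continuous_on UNIV (\<Gamma> n)" for n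
    unfolding \<Gamma>_def[abs_def]
    by (rule conv_continuous[OF \<gamma>i cS \<gamma>0 C1_derivD(4)[OF C1_of_real[OF P1]]])
  note [measurable] = borel_measurable_continuous_onI[OF \<Gamma>c] borel_measurable_continuous_onI[OF C1_derivD(4)[OF wC]]
  have dG: "norm (\<phi>' z (G z)) \<le> 2 * B * indicator (ball z0 1) z" for z
  proof (cases "z \<in> S")
    case True
    have "norm (\<phi>' z (G z)) \<le> 2 * B * norm (G z)"
      by (rule derivative_norm_le[OF \<phi>]) (use B in \<open>auto simp: \<phi>'_def\<close>)
    also have "\<dots> \<le> 2 * B * 1" using B0 by (intro mult_left_mono G_bound) auto
    finally show ?thesis using True S1 by auto
  qed (use B0 in \<open>auto simp: \<phi>'0\<close>)
  have bphi: "\<bar>b z * \<phi> z\<bar> \<le> indicator (ball z0 1) z + H z" for z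
  proof (cases "z \<in> S")
    case True
    have "\<bar>b z\<bar> \<le> N z"
      using b_bound[of z] mult_left_mono[OF G_bound N_nonneg, of z z] by simp
    then have "\<bar>b z\<bar> * \<bar>\<phi> z\<bar> \<le> N z * 1" using \<phi>b[of z] N_nonneg[of z] by (intro mult_mono) auto
    then show ?thesis using True S1 N_le[of z] by (auto simp: abs_mult)
  qed (use H_nonneg[of z] in \<open>auto simp: \<phi>S\<close>)
  define X where "X = (LINT z|lborel. \<phi> z * (norm (G z))\<^sup>2)"
  define D where "D n = (\<integral>\<^sup>+z. norm (\<Gamma> n z - of_real kap * \<gamma> z) \<partial>lborel)" for n
  have Dlim: "D \<longlonglongrightarrow> 0" unfolding D_def \<Gamma>_def by (rule mollify_L1[OF \<gamma>i \<delta>])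
  define K where "K = (2 * B + 1) * measure lborel (ball z0 1) + 1"
  have K0: "K \<ge> 0" using B0 by (simp add: K_def)
  have iball: "integrable lborel (indicator (ball z0 1) :: complex \<Rightarrow> real)"
    using emeasure_lborel_ball_finite[of z0 1] by (simp add: integrable_indicator_iff)
  have bound: "ennreal X \<le> ennreal (K * s) + ennreal (inverse kap) * D n" for n
  proof -
    \<comment> \<open>\<open>A + Q\<close> is the \<open>weak_div\<close> integrand for
      \<open>\<phi> * w n\<close>; \<open>E\<close> is the error from using the mollified gradient
      in \<open>A\<close> instead of \<open>G\<close>.\<close>
    define A where "A z = \<phi> z * w' n z (G z)" for z
    define Q where "Q z = \<phi>' z (G z) * w n z + b z * (\<phi> z * w n z)" for z
    define E where "E z = \<phi> z * ((\<Gamma> n z - of_real kap * \<gamma> z) \<bullet> G z) * inverse kap" for z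
    have Am [measurable]: "A \<in> borel_measurable borel" and [measurable]: "Q \<in> borel_measurable borel" "E \<in> borel_measurable borel"
      unfolding A_def w'_def Q_def E_def by measurable
    have Qb: "norm (Q z) \<le> s * ((2 * B + 1) * indicator (ball z0 1) z + H z)" for z
    proof -
      have "norm (Q z) \<le> \<bar>w n z\<bar> * (\<bar>\<phi>' z (G z)\<bar> + \<bar>b z * \<phi> z\<bar>)"
        unfolding Q_def using abs_triangle_ineq[of "\<phi>' z (G z) * w n z" "b z * (\<phi> z * w n z)"]
        by (simp add: abs_mult algebra_simps)
      also have "\<dots> \<le> s * (2 * B * indicator (ball z0 1) z + (indicator (ball z0 1) z + H z))"
        using dG[of z] by (intro mult_mono wb add_mono bphi s0) auto
      finally show ?thesis by (simp add: algebra_simps)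
    qed
    have iQb: "integrable lborel (\<lambda>z. s * ((2 * B + 1) * indicator (ball z0 1) z + H z))"
      by (intro integrable_mult_right Bochner_Integration.integrable_add iball H_integrable)
    have Qi: "integrable lborel Q"
      using Qb by (intro Bochner_Integration.integrable_bound[OF iQb]) (auto intro!: AE_I2 order_trans[OF _ abs_ge_self])
    have "\<bar>LINT z|lborel. Q z\<bar> \<le> (LINT z|lborel. norm (Q z))"
      using integral_norm_bound[of lborel Q] by simp
    also have "\<dots> \<le> (LINT z|lborel. s * ((2 * B + 1) * indicator (ball z0 1) z + H z))"
      by (rule integral_mono[OF integrable_norm[OF Qi] iQb Qb])
    also have "\<dots> = s * ((2 * B + 1) * measure lborel (ball z0 1) + (LINT z|lborel. H z))"
      using iball H_integrable by simp
    also have "\<dots> \<le> s * K"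
    proof -
      have "ennreal (LINT z|lborel. H z) \<le> ennreal 1"
        using H_int nn_integral_eq_integral[OF H_integrable] H_nonneg by simp
      then have "(LINT z|lborel. H z) \<le> 1" by (subst (asm) ennreal_le_iff) auto
      then show ?thesis using s0 unfolding K_def by (intro mult_left_mono) auto
    qed
    finally have Qs: "\<bar>LINT z|lborel. Q z\<bar> \<le> K * s" by (simp add: mult.commute)
    have zero: "(LINT z|lborel. A z + Q z) = 0"
    proof -
      have "(LINT z|lborel. (\<phi> z * w' n z (G z) + \<phi>' z (G z) * w n z) + b z * (\<phi> z * w n z)) = 0"
        by (rule weak_div[OF C1_mult[OF \<phi> wC] cS SU]) (simp add: \<phi>S)
      then show ?thesis by (simp add: A_def Q_def add.assoc)
    qed
    have AE: "\<phi> z * (norm (G z))\<^sup>2 = A z - E z" for z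
    proof (cases "z \<in> cball z0 (5/8)")
      case True
      then have z: "z \<in> ball z0 (3/4)" by auto
      have "\<gamma> z = G z" using \<theta>1[OF z] \<theta>'1[OF z] by (simp add: \<gamma>_def complex_eq_iff)
      moreover have "(of_real kap * x) \<bullet> y = kap * (x \<bullet> y)" for x y :: complex
        by (simp add: inner_complex_def algebra_simps)
      ultimately show ?thesis
        using kap_pos by (simp add: A_def E_def w'_def inner_diff_left power2_norm_eq_inner field_simps)
    qed (simp add: A_def E_def \<phi>0)
    have Eb: "norm (E z) \<le> inverse kap * norm (\<Gamma> n z - of_real kap * \<gamma> z)" for z
    proof -
      have "\<bar>(\<Gamma> n z - of_real kap * \<gamma> z) \<bullet> G z\<bar> \<le> norm (\<Gamma> n z - of_real kap * \<gamma> z) * 1"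
        by (rule order_trans[OF Cauchy_Schwarz_ineq2]) (intro mult_left_mono G_bound norm_ge_zero)
      then have "\<bar>\<phi> z\<bar> * \<bar>(\<Gamma> n z - of_real kap * \<gamma> z) \<bullet> G z\<bar> \<le> 1 * norm (\<Gamma> n z - of_real kap * \<gamma> z)"
        using \<phi>b[of z] by (intro mult_mono) auto
      then show ?thesis using kap_pos by (simp add: E_def abs_mult mult.commute)
    qed
    obtain BG where BG: "\<And>z. z \<in> S \<Longrightarrow> norm (\<Gamma> n z) \<le> BG"
      using compact_imp_bounded[OF compact_continuous_image[OF continuous_on_subset[OF \<Gamma>c[of n]] cS]]
      unfolding bounded_iff by auto
    have Ai: "integrable lborel A"
    proof (rule integrable_bounded_support[OF Am cS])
      show "norm (A z) \<le> \<bar>BG\<bar> * inverse kap" for z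
      proof (cases "z \<in> S")
        case True
        have "\<bar>\<Gamma> n z \<bullet> G z\<bar> \<le> \<bar>BG\<bar> * 1"
          using BG[OF True] by (intro order_trans[OF Cauchy_Schwarz_ineq2] mult_mono G_bound) auto
        then have "\<bar>\<phi> z\<bar> * \<bar>\<Gamma> n z \<bullet> G z\<bar> \<le> 1 * \<bar>BG\<bar>"
          using \<phi>b[of z] by (intro mult_mono) auto
        then show ?thesis using kap_pos by (simp add: A_def w'_def abs_mult mult.assoc[symmetric] mult_right_mono)
      qed (use kap_pos in \<open>simp add: A_def \<phi>S\<close>)
      show "A z = 0" if "z \<notin> S" for z using that by (simp add: A_def \<phi>S)
    qed
    have Xi: "integrable lborel (\<lambda>z. \<phi> z * (norm (G z))\<^sup>2)"
    proof (rule integrable_bounded_support[OF _ cS])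
      show "norm (\<phi> z * (norm (G z))\<^sup>2) \<le> 1" for z
        using \<phi>b[of z] G_bound[of z] by (simp add: abs_mult mult_le_one power_le_one)
    qed (auto simp: \<phi>S)
    have Ei: "integrable lborel E"
      using Bochner_Integration.integrable_diff[OF Ai Xi] unfolding AE by simp
    have "X = (LINT z|lborel. A z) - (LINT z|lborel. E z)"
      unfolding X_def AE using Ai Ei by simp
    also have "(LINT z|lborel. A z) = - (LINT z|lborel. Q z)"
      using zero Ai Qi by simp
    finally have "X \<le> K * s + \<bar>LINT z|lborel. E z\<bar>" using Qs by linarith
    then have "ennreal X \<le> ennreal (K * s) + ennreal \<bar>LINT z|lborel. E z\<bar>"
      using K0 s0 by (simp add: ennreal_plus[symmetric] ennreal_leI del: ennreal_plus)
    also have "ennreal \<bar>LINT z|lborel. E z\<bar> \<le> (\<integral>\<^sup>+z. norm (E z) \<partial>lborel)"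
      using integral_norm_bound_ennreal[OF Ei] by simp
    also have "\<dots> \<le> (\<integral>\<^sup>+z. ennreal (inverse kap) * norm (\<Gamma> n z - of_real kap * \<gamma> z) \<partial>lborel)"
      using Eb kap_pos by (intro nn_integral_mono) (simp add: ennreal_mult[symmetric] ennreal_leI)
    also have "\<dots> = ennreal (inverse kap) * D n"
      unfolding D_def by (rule nn_integral_cmult) measurable
    finally show ?thesis by (simp add: add_left_mono)
  qed
  have "(\<lambda>n. ennreal (K * s) + ennreal (inverse kap) * D n) \<longlonglongrightarrow> ennreal (K * s) + ennreal (inverse kap) * 0"
    by (intro tendsto_add tendsto_const ennreal_tendsto_cmult Dlim) simp
  then have "ennreal X \<le> ennreal (K * s)"
    using LIMSEQ_le_const[of _ "ennreal (K * s)" "ennreal X"] bound by simp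
  then have X: "X \<le> K * s" using K0 s0 by (subst (asm) ennreal_le_iff) auto
  have "(LINT z|lborel. indicator (cball z0 (1/2)) z * (norm (G z))\<^sup>2) \<le> X"
    unfolding X_def
  proof (rule integral_mono_AE')
    show "integrable lborel (\<lambda>z. \<phi> z * (norm (G z))\<^sup>2)"
    proof (rule integrable_bounded_support[OF _ cS])
      show "norm (\<phi> z * (norm (G z))\<^sup>2) \<le> 1" for z
        using \<phi>b[of z] G_bound[of z] by (simp add: abs_mult mult_le_one power_le_one)
    qed (auto simp: \<phi>S)
    show "AE z in lborel. indicator (cball z0 (1/2)) z * (norm (G z))\<^sup>2 \<le> \<phi> z * (norm (G z))\<^sup>2"
      using \<phi>1 \<phi>b by (intro AE_I2 mult_right_mono) (auto simp: indicator_def)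
    show "AE z in lborel. 0 \<le> \<phi> z * (norm (G z))\<^sup>2" using \<phi>b by (intro AE_I2) auto
  qed
  then show ?thesis using X by (simp add: K_def)
qed

end

section \<open>From the plane to complex notation\<close>

text \<open>A linear isometry that preserves Lebesgue measure, so norms, balls and integrals are
  transported without constants.\<close>

definition plane :: "complex \<Rightarrow> real^2" where
  "plane z = (\<chi> i. if i = 1 then Re z else Im z)"

definition unplane :: "real^2 \<Rightarrow> complex" where
  "unplane x = Complex (x $ 1) (x $ 2)"

lemma plane_unplane [simp]: "plane (unplane x) = x"
  by (simp add: plane_def unplane_def vec_eq_iff forall_2)

lemma unplane_plane [simp]: "unplane (plane z) = z"
  by (simp add: plane_def unplane_def)

lemma inner_plane: "plane z \<bullet> plane w = z \<bullet> w"
  by (simp add: inner_vec_def plane_def sum_2 inner_complex_def)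

lemma norm_plane [simp]: "norm (plane z) = norm z"
  by (simp add: norm_eq_sqrt_inner inner_plane)

lemma norm_unplane [simp]: "norm (unplane x) = norm x"
  by (metis norm_plane plane_unplane)

lemma inner_unplane: "unplane x \<bullet> w = x \<bullet> plane w"
  by (metis inner_plane plane_unplane)

lemma linear_plane: "linear plane"
  by (rule linearI) (simp_all add: plane_def vec_eq_iff)

lemma linear_unplane: "linear unplane"
  by (rule linearI) (simp_all add: unplane_def complex_eq_iff)

lemma plane_continuous: "continuous_on S plane" and unplane_continuous: "continuous_on T unplane"
  by (simp_all add: linear_continuous_on linear_conv_bounded_linear[symmetric] linear_plane linear_unplane)

lemma plane_measurable [measurable]: "plane \<in> borel_measurable borel"
  by (rule borel_measurable_continuous_onI[OF plane_continuous])

lemma unplane_measurable [measurable]: "unplane \<in> borel_measurable borel"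
  by (rule borel_measurable_continuous_onI[OF unplane_continuous])

lemma dist_plane [simp]: "dist (plane z) (plane w) = dist z w"
  by (simp add: dist_norm linear_diff[OF linear_plane, symmetric])

lemma lborel_plane: "(lborel :: (real^2) measure) = distr lborel borel plane"
proof (rule lborel_eqI)
  have Basis: "(Basis :: (real^2) set) = {axis 1 1, axis 2 1}"
    by (auto simp: Basis_vec_def) (metis exhaust_2)
  fix l u :: "real^2"
  assume le: "\<And>b. b \<in> Basis \<Longrightarrow> l \<bullet> b \<le> u \<bullet> b"
  have "plane -` box l u = box (unplane l) (unplane u)"
    by (auto simp: mem_box Basis inner_axis plane_def unplane_def Basis_complex_def)
  then have "emeasure (distr lborel borel plane) (box l u) = emeasure lborel (box (unplane l) (unplane u))"
    by (subst emeasure_distr) auto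
  also have "\<dots> = ennreal ((u $ 1 - l $ 1) * (u $ 2 - l $ 2))"
    using le[of "axis 1 1"] le[of "axis 2 1"]
    by (simp add: emeasure_lborel_box_eq Basis Basis_complex_def inner_axis unplane_def)
  also have "(u $ 1 - l $ 1) * (u $ 2 - l $ 2) = (\<Prod>b\<in>Basis. (u - l) \<bullet> b)"
    by (simp add: Basis inner_axis axis_eq_axis)
  finally show "emeasure (distr lborel borel plane) (box l u) = (\<Prod>b\<in>Basis. (u - l) \<bullet> b)" .
qed simp

lemma integral_plane:
  fixes F :: "real^2 \<Rightarrow> 'b::{banach, second_countable_topology}"
  assumes "F \<in> borel_measurable borel"
  shows "(LINT x|lborel. F x) = (LINT z|lborel. F (plane z))"
  unfolding lborel_plane using assms by (subst integral_distr) auto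

lemma nn_integral_plane:
  assumes "F \<in> borel_measurable borel"
  shows "(\<integral>\<^sup>+x. F x \<partial>(lborel :: (real^2) measure)) = (\<integral>\<^sup>+z. F (plane z) \<partial>lborel)"
  unfolding lborel_plane using assms by (subst nn_integral_distr) auto

lemma C1_unplane:
  assumes "C1_deriv \<phi> \<phi>'"
  shows "C1_deriv (\<lambda>x. \<phi> (unplane x)) (\<lambda>x h. \<phi>' (unplane x) (unplane h))"
proof (rule C1_derivI)
  have "(unplane has_derivative unplane) (at x)" for x
    using linear_unplane linear_conv_bounded_linear bounded_linear_imp_has_derivative by blast
  then show "((\<lambda>x. \<phi> (unplane x)) has_derivative (\<lambda>h. \<phi>' (unplane x) (unplane h))) (at x)" for x
    by (rule has_derivative_compose[OF _ C1_derivD(1)[OF assms]])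
  show "continuous_on UNIV (\<lambda>x. \<phi>' (unplane x) (unplane b))" for b
    by (rule continuous_on_compose2[OF C1_derivD(2)[OF assms, of UNIV] unplane_continuous]) auto
qed

section \<open>Borel representatives\<close>

text \<open>Tonelli, convolutions and push-forwards are applied to Borel functions, while the data
  are only Lebesgue measurable; the coordinates are replaced one at a time.\<close>

lemma borel_representative:
  fixes f :: "'a::euclidean_space \<Rightarrow> 'b::euclidean_space"
  assumes "f \<in> borel_measurable lebesgue"
  shows "\<exists>g\<in>borel_measurable borel. AE x in lborel. f x = g x"
proof -
  have "\<exists>g\<in>borel_measurable lborel. AE x in lborel. f x \<bullet> b = g x" for b
    by (intro completion_ex_borel_measurable_real borel_measurable_inner assms borel_measurable_const)
  then obtain g where g: "\<And>b. g b \<in> borel_measurable lborel" "\<And>b. AE x in lborel. f x \<bullet> b = g b x"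
    by metis
  have [measurable]: "g b \<in> borel_measurable borel" for b using g(1) by simp
  show ?thesis
  proof (intro bexI)
    show "(\<lambda>x. \<Sum>b\<in>Basis. g b x *\<^sub>R b) \<in> borel_measurable borel" by measurable
    have "AE x in lborel. \<forall>b\<in>Basis. f x \<bullet> b = g b x"
      using g(2) by (intro AE_finite_allI) auto
    then show "AE x in lborel. f x = (\<Sum>b\<in>Basis. g b x *\<^sub>R b)"
    proof eventually_elim
      case (elim x)
      have "f x = (\<Sum>b\<in>Basis. (f x \<bullet> b) *\<^sub>R b)" by (rule euclidean_representation[symmetric])
      also have "\<dots> = (\<Sum>b\<in>Basis. g b x *\<^sub>R b)" using elim by (intro sum.cong) auto
      finally show ?case .
    qed
  qed
qed

text \<open>Local integrability provides measurability only on compact sets; the exterior domain is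
  exhausted by the closed annuli \<open>K n\<close>.\<close>

lemma locally_integrable_measurable:
  fixes f :: "'a::euclidean_space \<Rightarrow> 'b::euclidean_space"
  assumes "locally_integrable_on f (- cball 0 1)"
  shows "(\<lambda>x. indicator (- cball 0 1) x *\<^sub>R f x) \<in> borel_measurable lebesgue"
proof -
  define K where "K n = cball (0::'a) (real n) - ball 0 (1 + inverse (real (Suc n)))" for n
  have K: "compact (K n)" "K n \<subseteq> - cball 0 1" for n
  proof -
    show "compact (K n)" unfolding K_def by (intro compact_diff) auto
    show "K n \<subseteq> - cball 0 1"
    proof
      fix x assume "x \<in> K n"
      then have "norm x \<ge> 1 + inverse (real (Suc n))" by (simp add: K_def)
      moreover have "inverse (real (Suc n)) > 0" by simp
      ultimately have "norm x > 1" by linarith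
      then show "x \<in> - cball 0 1" by simp
    qed
  qed
  have m: "(\<lambda>x. indicator (K n) x *\<^sub>R f x) \<in> borel_measurable lebesgue" for n
  proof -
    have "set_integrable lebesgue (K n) f"
      using assms K[of n] by (simp add: locally_integrable_on_def)
    then show ?thesis
      unfolding set_integrable_def by (rule borel_measurable_integrable)
  qed
  show ?thesis
  proof (rule borel_measurable_LIMSEQ_metric[OF m])
    fix x :: 'a
    show "(\<lambda>n. indicator (K n) x *\<^sub>R f x) \<longlonglongrightarrow> indicator (- cball 0 1) x *\<^sub>R f x"
    proof (cases "x \<in> cball 0 1")
      case True
      then have "x \<notin> K n" for n using K(2)[of n] by blast
      then show ?thesis using True by simp
    next
      case False
      then have x: "norm x > 1" by simp
      have "\<forall>\<^sub>F n in sequentially. real n \<ge> norm x"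
        using eventually_ge_at_top[of "nat \<lceil>norm x\<rceil>"] by eventually_elim linarith
      moreover have "\<forall>\<^sub>F n in sequentially. inverse (real (Suc n)) < norm x - 1"
        using order_tendstoD(2)[OF LIMSEQ_inverse_real_of_nat, of "norm x - 1"] x by simp
      ultimately have "\<forall>\<^sub>F n in sequentially. indicator (K n) x *\<^sub>R f x = indicator (- cball 0 1) x *\<^sub>R f x"
        by eventually_elim (use x in \<open>auto simp: K_def\<close>)
      then show ?thesis by (rule tendsto_eventually)
    qed
  qed
qed

text \<open>Measurability of \<open>F\<close> on \<open>A\<close> is a consequence, not an
  assumption: Lebesgue measure is complete and \<open>F\<close> agrees there almost everywhere with
  a Borel function.\<close>

lemma set_integral_representative:
  fixes F G :: "'a::euclidean_space \<Rightarrow> 'b::euclidean_space"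
  assumes "G \<in> borel_measurable borel" "AE x in lborel. x \<in> A \<longrightarrow> F x = G x" "A \<in> sets borel" "\<And>x. x \<notin> A \<Longrightarrow> G x = 0"
  shows "set_integrable lebesgue A F \<longleftrightarrow> integrable lborel G" "(LINT x:A|lebesgue. F x) = (LINT x|lborel. G x)"
proof -
  have G: "G \<in> borel_measurable lebesgue" using assms(1) by (intro measurable_completion) simp
  have ae: "AE x in lebesgue. indicator A x *\<^sub>R F x = G x"
  proof (rule AE_completion)
    show "AE x in lborel. indicator A x *\<^sub>R F x = G x"
      using assms(2) by eventually_elim (auto simp: assms(4) indicator_def)
  qed
  have F: "(\<lambda>x. indicator A x *\<^sub>R F x) \<in> borel_measurable lebesgue"
    by (rule borel_measurable_AE[OF G]) (use ae in \<open>auto elim: eventually_mono\<close>)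
  show "set_integrable lebesgue A F \<longleftrightarrow> integrable lborel G"
    unfolding set_integrable_def using integrable_cong_AE[OF F G ae] integrable_completion[of G lborel] assms(1) by simp
  show "(LINT x:A|lebesgue. F x) = (LINT x|lborel. G x)"
    unfolding set_lebesgue_integral_def using integral_cong_AE[OF F G ae] integral_completion[of G lborel] assms(1) by simp
qed

lemma integrable_mult_compact_support:
  fixes F :: "'a::euclidean_space \<Rightarrow> 'b::euclidean_space" and c :: "'a \<Rightarrow> real"
  assumes "continuous_on UNIV c" "compact K" "\<And>x. x \<notin> K \<Longrightarrow> c x = 0" "set_integrable lborel K F"
  shows "integrable lborel (\<lambda>x. c x *\<^sub>R F x)"
proof -
  obtain B where B: "B \<ge> 0" "\<And>x. norm (c x) \<le> B"
    using continuous_compact_support_bounded[OF assms(1-3)] by metis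
  have [measurable]: "c \<in> borel_measurable borel" by (rule borel_measurable_continuous_onI[OF assms(1)])
  have i: "integrable lborel (\<lambda>x. indicator K x *\<^sub>R F x)" using assms(4) by (simp add: set_integrable_def)
  then have [measurable]: "(\<lambda>x. indicator K x *\<^sub>R F x) \<in> borel_measurable borel" by auto
  have "integrable lborel (\<lambda>x. c x *\<^sub>R (indicator K x *\<^sub>R F x))"
  proof (rule Bochner_Integration.integrable_bound)
    show "integrable lborel (\<lambda>x. B * norm (indicator K x *\<^sub>R F x))" using i by (intro integrable_mult_right integrable_norm)
    show "AE x in lborel. norm (c x *\<^sub>R (indicator K x *\<^sub>R F x)) \<le> norm (B * norm (indicator K x *\<^sub>R F x))"
    proof (rule AE_I2)
      fix x
      have "norm (c x *\<^sub>R y) \<le> norm (B * norm y)" for y :: 'b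
        using mult_right_mono[OF B(2)[of x] norm_ge_zero[of y]] B(1) by simp
      then show "norm (c x *\<^sub>R (indicator K x *\<^sub>R F x)) \<le> norm (B * norm (indicator K x *\<^sub>R F x))" .
    qed
  qed measurable
  moreover have "c x *\<^sub>R (indicator K x *\<^sub>R F x) = c x *\<^sub>R F x" for x
    using assms(3)[of x] by (cases "x \<in> K") auto
  ultimately show ?thesis by (simp only:)
qed

lemma test_functionD:
  assumes "test_function \<Omega> \<phi>"
  shows "C1_deriv \<phi> (\<lambda>x. frechet_derivative \<phi> (at x))" "b \<in> Basis \<Longrightarrow> test_function \<Omega> (\<lambda>x. frechet_derivative \<phi> (at x) b)"
    "compact (closure {x. \<phi> x \<noteq> 0})" "closure {x. \<phi> x \<noteq> 0} \<subseteq> \<Omega>"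
    "x \<notin> closure {x. \<phi> x \<noteq> 0} \<Longrightarrow> \<phi> x = 0" "x \<notin> closure {x. \<phi> x \<noteq> 0} \<Longrightarrow> frechet_derivative \<phi> (at x) h = 0"
proof -
  have sm: "Ck k \<phi>" for k using assms by (simp add: test_function_def)
  show C1: "C1_deriv \<phi> (\<lambda>x. frechet_derivative \<phi> (at x))" by (rule smooth_C1_deriv[OF sm])
  show cK: "compact (closure {x. \<phi> x \<noteq> 0})" and K\<Omega>: "closure {x. \<phi> x \<noteq> 0} \<subseteq> \<Omega>" using assms by (auto simp: test_function_def)
  show z: "\<phi> x = 0" if "x \<notin> closure {x. \<phi> x \<noteq> 0}" for x
    using that closure_subset[of "{x. \<phi> x \<noteq> 0}"] by auto
  show z': "frechet_derivative \<phi> (at x) h = 0" if "x \<notin> closure {x. \<phi> x \<noteq> 0}" for x h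
    by (rule has_derivative_zero_outside[OF C1_derivD(1)[OF C1] closed_closure z that])
  show "test_function \<Omega> (\<lambda>x. frechet_derivative \<phi> (at x) b)" if b: "b \<in> Basis"
  proof -
    have sub: "closure {x. frechet_derivative \<phi> (at x) b \<noteq> 0} \<subseteq> closure {x. \<phi> x \<noteq> 0}"
      using z' by (intro closure_minimal) auto
    then have "compact (closure {x. frechet_derivative \<phi> (at x) b \<noteq> 0})"
      using compact_Int_closed[OF cK closed_closure[of "{x. frechet_derivative \<phi> (at x) b \<noteq> 0}"]] by (simp add: inf.absorb2)
    then show ?thesis
      unfolding test_function_def using smooth_partial[OF sm b] sub K\<Omega> by blast
  qed
qed

lemma set_integrable_representative:
  fixes F G :: "'a::euclidean_space \<Rightarrow> 'b::euclidean_space"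
  assumes "locally_integrable_on F \<Omega>" "compact K" "K \<subseteq> \<Omega>" "G \<in> borel_measurable borel" "AE x in lborel. x \<in> \<Omega> \<longrightarrow> F x = G x"
  shows "set_integrable lborel K G"
proof -
  have [measurable]: "G \<in> borel_measurable borel" "K \<in> sets borel" using assms borel_compact by auto
  have "set_integrable lebesgue K F" using assms(1-3) by (simp add: locally_integrable_on_def)
  moreover have "AE x in lborel. x \<in> K \<longrightarrow> F x = indicator K x *\<^sub>R G x"
    using assms(5) by eventually_elim (use assms(3) in \<open>auto simp: indicator_def\<close>)
  ultimately show ?thesis
    unfolding set_integrable_def[of lborel] by (subst set_integral_representative(1)[symmetric, of _ K F]) auto
qed

text \<open>The vector identity is contracted with a fixed \<open>h\<close>. The two integrals are
  stated separately, with their integrability, because the curl identity later subtracts two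
  instances.\<close>

lemma test_gradient:
  fixes u u1 :: "'a::euclidean_space \<Rightarrow> real" and G G1 :: "'a \<Rightarrow> 'a"
  assumes \<Omega>: "\<Omega> \<in> sets borel" and wg: "weak_gradient_on \<Omega> u G"
    and u1: "u1 \<in> borel_measurable borel" "AE x in lborel. x \<in> \<Omega> \<longrightarrow> u x = u1 x" "\<And>x. x \<notin> \<Omega> \<Longrightarrow> u1 x = 0"
    and G1: "G1 \<in> borel_measurable borel" "AE x in lborel. x \<in> \<Omega> \<longrightarrow> G x = G1 x" "\<And>x. x \<notin> \<Omega> \<Longrightarrow> G1 x = 0"
    and \<phi>: "test_function \<Omega> \<phi>"
  shows "integrable lborel (\<lambda>x. frechet_derivative \<phi> (at x) (u1 x *\<^sub>R h))" "integrable lborel (\<lambda>x. (G1 x \<bullet> h) * \<phi> x)"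
    "(LINT x|lborel. frechet_derivative \<phi> (at x) (u1 x *\<^sub>R h)) + (LINT x|lborel. (G1 x \<bullet> h) * \<phi> x) = 0"
proof -
  note T = test_functionD[OF \<phi>]
  note D = C1_derivD[OF T(1)]
  have [measurable]: "u1 \<in> borel_measurable borel" "G1 \<in> borel_measurable borel" "\<phi> \<in> borel_measurable borel"
    "(\<lambda>x. frechet_derivative \<phi> (at x) b) \<in> borel_measurable borel" for b
    using u1 G1 borel_measurable_continuous_onI[OF D(4)] borel_measurable_continuous_onI[OF D(2)] by auto
  have [measurable]: "grad \<phi> \<in> borel_measurable borel"
    unfolding grad_def[abs_def] by measurable
  have locu: "locally_integrable_on u \<Omega>" and locG: "locally_integrable_on G \<Omega>"
    using wg by (auto simp: weak_gradient_on_def)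
  let ?K = "closure {x. \<phi> x \<noteq> 0}"
  have iu: "integrable lborel (\<lambda>x. frechet_derivative \<phi> (at x) b * u1 x)" if "b \<in> Basis" for b
    using integrable_mult_compact_support[OF D(2) T(3) T(6) set_integrable_representative[OF locu T(3,4) u1(1,2)], of b] by simp
  have i1: "integrable lborel (\<lambda>x. u1 x *\<^sub>R grad \<phi> x)"
  proof -
    have "u1 x *\<^sub>R grad \<phi> x = (\<Sum>b\<in>Basis. (frechet_derivative \<phi> (at x) b * u1 x) *\<^sub>R b)" for x
      by (simp add: grad_def scaleR_sum_right mult.commute)
    then show ?thesis using iu by auto
  qed
  have i2: "integrable lborel (\<lambda>x. \<phi> x *\<^sub>R G1 x)"
    by (rule integrable_mult_compact_support[OF D(4) T(3) T(5) set_integrable_representative[OF locG T(3,4) G1(1,2)]])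
  have "(LINT x:\<Omega>|lebesgue. u x *\<^sub>R grad \<phi> x) = (LINT x|lborel. u1 x *\<^sub>R grad \<phi> x)"
    by (rule set_integral_representative(2)[OF _ _ \<Omega>])
      (use u1(2,3) in \<open>auto elim: eventually_mono\<close>)
  moreover have "(LINT x:\<Omega>|lebesgue. \<phi> x *\<^sub>R G x) = (LINT x|lborel. \<phi> x *\<^sub>R G1 x)"
    by (rule set_integral_representative(2)[OF _ _ \<Omega>])
      (use G1(2,3) in \<open>auto elim: eventually_mono\<close>)
  ultimately have eq: "(LINT x|lborel. u1 x *\<^sub>R grad \<phi> x) = - (LINT x|lborel. \<phi> x *\<^sub>R G1 x)"
    using wg \<phi> by (simp add: weak_gradient_on_def)
  have p1: "(u1 x *\<^sub>R grad \<phi> x) \<bullet> h = frechet_derivative \<phi> (at x) (u1 x *\<^sub>R h)" for x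
    using inner_grad[of \<phi> x h] D(1)[of x] linear_cmul[OF D(3), of x "u1 x" h]
    by (auto simp: differentiable_def inner_commute)
  have p2: "(\<phi> x *\<^sub>R G1 x) \<bullet> h = (G1 x \<bullet> h) * \<phi> x" for x by simp
  show "integrable lborel (\<lambda>x. frechet_derivative \<phi> (at x) (u1 x *\<^sub>R h))"
    unfolding p1[symmetric] by (intro integrable_inner_left i1)
  show "integrable lborel (\<lambda>x. (G1 x \<bullet> h) * \<phi> x)"
    unfolding p2[symmetric] by (intro integrable_inner_left i2)
  have "(LINT x|lborel. frechet_derivative \<phi> (at x) (u1 x *\<^sub>R h)) = (LINT x|lborel. u1 x *\<^sub>R grad \<phi> x) \<bullet> h"
    unfolding p1[symmetric] using i1 by (intro integral_inner_left)
  moreover have "(LINT x|lborel. (G1 x \<bullet> h) * \<phi> x) = (LINT x|lborel. \<phi> x *\<^sub>R G1 x) \<bullet> h"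
    unfolding p2[symmetric] using i2 by (intro integral_inner_left)
  ultimately show "(LINT x|lborel. frechet_derivative \<phi> (at x) (u1 x *\<^sub>R h)) + (LINT x|lborel. (G1 x \<bullet> h) * \<phi> x) = 0"
    by (simp add: eq)
qed

section \<open>The norm of the drift and Young's inequality\<close>

lemma Lp_norm_infinity_AE:
  fixes F :: "'a::euclidean_space \<Rightarrow> 'b::euclidean_space"
  assumes "Lp_norm \<infinity> (lebesgue_on A) F \<le> 1" "A \<in> sets lebesgue"
  shows "AE x in lborel. x \<in> A \<longrightarrow> norm (F x) \<le> 1"
proof -
  have "AE x in lebesgue_on A. ennreal (norm (F x)) \<le> esssup (lebesgue_on A) (\<lambda>x. ennreal (norm (F x)))"
    by (rule esssup_AE)
  then have "AE x in lebesgue_on A. norm (F x) \<le> 1"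
  proof eventually_elim
    case (elim x)
    from order_trans[OF this, of 1] show ?case using assms(1) by (simp add: Lp_norm_def)
  qed
  then have "AE x in lebesgue. x \<in> A \<longrightarrow> norm (F x) \<le> 1"
    using assms(2) by (subst (asm) AE_restrict_space_iff) auto
  then show ?thesis by (rule AE_completion_iff[THEN iffD1])
qed

text \<open>For \<open>p = \<infinity>\<close> any value in \<open>[0, 2)\<close> would serve, since
  the drift is then bounded by 1 and \<open>young\<close> holds with \<open>H = 0\<close>.\<close>

definition conj_exponent :: "ennreal \<Rightarrow> real" where
  "conj_exponent p = (if p = \<infinity> then 3 / 2 else enn2real p / (enn2real p - 1))"

lemma exponent_gt_2:
  assumes "2 < p" "p \<noteq> \<infinity>"
  shows "2 < enn2real p"
proof -
  obtain r where r: "p = ennreal r" "r \<ge> 0" using assms(2) by (cases p) auto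
  have "ennreal 2 < ennreal r" using assms(1) r by simp
  then show ?thesis using r by (simp add: ennreal_less_iff del: ennreal_numeral)
qed

text \<open>\<open>P / (P - 1) < 2\<close> is equivalent to \<open>P > 2\<close> for
  \<open>P > 1\<close>: the decisive use of the assumption on \<open>p\<close>.\<close>

lemma conj_exponent_bounds:
  assumes "2 < p"
  shows "0 \<le> conj_exponent p" "conj_exponent p < 2"
proof -
  have "0 \<le> conj_exponent p \<and> conj_exponent p < 2"
  proof (cases "p = \<infinity>")
    case False
    then show ?thesis using exponent_gt_2[OF assms False] by (simp add: conj_exponent_def divide_less_eq)
  qed (simp add: conj_exponent_def)
  then show "0 \<le> conj_exponent p" "conj_exponent p < 2" by auto
qed

text \<open>For \<open>t > 1\<close> the usual dichotomy: either
  \<open>n \<le> t powr (q - 1)\<close>, or \<open>t \<le> n powr (P - 1)\<close>. For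
  \<open>t \<le> 1\<close> the term \<open>t\<close> covers \<open>n \<le> 1\<close> and
  \<open>n powr P\<close> covers \<open>n > 1\<close>, so the power of \<open>t\<close> is needed
  only near the singularity of the kernel.\<close>

lemma young_inequality:
  fixes P n t :: real
  assumes "P > 2" "n \<ge> 0" "t \<ge> 0"
  shows "n * t \<le> t + n powr P + (if t > 1 then t powr (P / (P - 1)) else 0)"
proof (cases "t > 1")
  case False
  show ?thesis
  proof (cases "n \<le> 1")
    case True
    then have "n * t \<le> 1 * t" using assms by (intro mult_right_mono) auto
    then show ?thesis using False by (simp add: add_increasing2)
  next
    case n: False
    have "n * t \<le> n * 1" using assms False by (intro mult_left_mono) auto
    also have "\<dots> \<le> n powr P" using powr_mono[of 1 P n] n assms by simp
    finally show ?thesis using False assms by simp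
  qed
next
  case True
  define q where "q = P / (P - 1)"
  have q: "(q - 1) * (P - 1) = 1" using assms by (simp add: q_def field_simps)
  have "n * t \<le> n powr P + t powr q"
  proof (cases "n \<le> t powr (q - 1)")
    case n: True
    have "n * t \<le> t powr (q - 1) * t powr 1" using True n assms by (intro mult_mono) auto
    also have "\<dots> = t powr q" by (simp only: powr_add[symmetric]) simp
    finally show ?thesis by (simp add: add_increasing)
  next
    case n: False
    then have n0: "n > 0" using less_le_trans[of 0 "t powr (q - 1)" n] True by simp
    have "t = (t powr (q - 1)) powr (P - 1)" using True q by (simp add: powr_powr)
    also have "\<dots> \<le> n powr (P - 1)" using n assms by (intro powr_mono2) auto
    finally have "n * t \<le> n powr 1 * n powr (P - 1)" using n0 assms(3) by (intro mult_mono) auto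
    also have "\<dots> = n powr P" by (simp only: powr_add[symmetric]) simp
    finally show ?thesis by (simp add: add_increasing2)
  qed
  then show ?thesis using True assms by (simp add: q_def)
qed

text \<open>A change on a null set makes the bounds hold at every point, as
  \<open>young_pair\<close> demands. For finite \<open>p\<close> the bound on the norm says that
  \<open>H\<close>, the \<open>p\<close>-th power, has integral at most 1.\<close>

lemma drift_representative:
  fixes W :: "'a::euclidean_space \<Rightarrow> 'b::euclidean_space"
  assumes p: "2 < p" and A: "A \<in> sets borel" and Wm: "W \<in> borel_measurable (lebesgue_on A)" and Wp: "Lp_norm p (lebesgue_on A) W \<le> 1"
  shows "\<exists>W1 H. W1 \<in> borel_measurable borel \<and> H \<in> borel_measurable borel \<and> (AE x in lborel. x \<in> A \<longrightarrow> W x = W1 x) \<and>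
    (\<forall>x. H x \<ge> (0::real)) \<and> (\<integral>\<^sup>+x. H x \<partial>lborel) \<le> 1 \<and>
    (\<forall>x t. t \<ge> 0 \<longrightarrow> norm (W1 x) * t \<le> t + H x + (if t > 1 then t powr conj_exponent p else 0))"
proof -
  have Al: "A \<in> sets lebesgue" using A by auto
  have "(\<lambda>x. indicator A x *\<^sub>R W x) \<in> borel_measurable lebesgue"
    using Wm Al by (subst (asm) borel_measurable_restrict_space_iff) auto
  then obtain W0 where W0 [measurable]: "W0 \<in> borel_measurable borel" and ae0: "AE x in lborel. indicator A x *\<^sub>R W x = W0 x"
    using borel_representative by blast
  show ?thesis
  proof (cases "p = \<infinity>")
    case True
    define W1 where "W1 x = (if norm (W0 x) \<le> 1 then W0 x else 0)" for x
    have [measurable]: "W1 \<in> borel_measurable borel" unfolding W1_def by measurable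
    have "AE x in lborel. x \<in> A \<longrightarrow> norm (W x) \<le> 1"
      using Lp_norm_infinity_AE[OF _ Al] Wp True by blast
    with ae0 have "AE x in lborel. x \<in> A \<longrightarrow> W x = W1 x"
      by eventually_elim (auto simp: W1_def indicator_def)
    moreover have "norm (W1 x) * t \<le> t + 0 + (if t > 1 then t powr conj_exponent p else 0)" if "t \<ge> 0" for x t
    proof -
      have "norm (W1 x) * t \<le> 1 * t" using that by (intro mult_right_mono) (auto simp: W1_def)
      then show ?thesis by (auto intro: order_trans add_increasing2)
    qed
    ultimately show ?thesis by (intro exI[of _ W1] exI[of _ "\<lambda>x. 0"]) auto
  next
    case False
    define P where "P = enn2real p"
    have P: "P > 2" unfolding P_def by (rule exponent_gt_2[OF p False])
    have P_eq: "conj_exponent p = P / (P - 1)" using False by (simp add: conj_exponent_def P_def)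
    define I where "I = (\<integral>\<^sup>+x. ennreal (norm (W x) powr P) \<partial>lebesgue_on A)"
    have I: "I \<noteq> \<infinity>" "enn2real I powr (1 / P) \<le> 1"
      using Wp False by (auto simp: Lp_norm_def I_def P_def Let_def top_unique split: if_splits)
    have "I \<le> 1"
    proof -
      obtain r where r: "I = ennreal r" "r \<ge> 0" using I(1) by (cases I) auto
      have "r \<le> 1"
      proof (rule ccontr)
        assume "\<not> r \<le> 1"
        then have "r powr (1 / P) > 1" using P by simp
        then show False using I(2) r by simp
      qed
      then show ?thesis using r by simp
    qed
    moreover have "(\<integral>\<^sup>+x. ennreal (norm (W0 x) powr P) \<partial>lborel) = I"
    proof -
      have "I = (\<integral>\<^sup>+x. ennreal (norm (W x) powr P) * indicator A x \<partial>lebesgue)"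
        unfolding I_def using Al by (subst nn_integral_restrict_space) auto
      also have "\<dots> = (\<integral>\<^sup>+x. ennreal (norm (W0 x) powr P) \<partial>lebesgue)"
      proof (rule nn_integral_cong_AE, rule AE_completion)
        show "AE x in lborel. ennreal (norm (W x) powr P) * indicator A x = ennreal (norm (W0 x) powr P)"
          using ae0 by eventually_elim (auto simp: indicator_def split: if_splits)
      qed
      also have "\<dots> = (\<integral>\<^sup>+x. ennreal (norm (W0 x) powr P) \<partial>lborel)"
        by (rule nn_integral_completion) measurable
      finally show ?thesis by simp
    qed
    moreover have "AE x in lborel. x \<in> A \<longrightarrow> W x = W0 x"
      using ae0 by eventually_elim (auto simp: indicator_def)
    ultimately show ?thesis
      unfolding P_eq using young_inequality[OF P]
      by (intro exI[of _ W0] exI[of _ "\<lambda>x. norm (W0 x) powr P"]) auto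
  qed
qed

section \<open>Reduction of a planar weak solution to complex notation\<close>

lemma plane_weak_solution:
  fixes W G :: "real^2 \<Rightarrow> real^2" and u :: "real^2 \<Rightarrow> real"
  assumes p: "2 < p" and Wm: "W \<in> borel_measurable (lebesgue_on (- ball 0 1))"
    and Wp: "Lp_norm p (lebesgue_on (- ball 0 1)) W \<le> 1"
    and sol: "weak_drift_solution (interior (- ball 0 1)) W u G"
    and Gp: "Lp_norm \<infinity> (lebesgue_on (- ball 0 1)) G \<le> 1"
    and s: "s \<ge> 0" "\<And>x. x \<in> ball x0 1 \<Longrightarrow> \<bar>u x\<bar> \<le> s"
  shows "\<exists>N H u' b G'. weak_solution N H (conj_exponent p) u' b G' \<and>
    (\<forall>z\<in>ball (unplane x0) 1. \<bar>u' z\<bar> \<le> s) \<and>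
    (LINT z|lborel. indicator (ball 3 1) z * (norm (G' z))\<^sup>2) = (LINT x:ball (plane 3) 1|lebesgue. (norm (G x))\<^sup>2)"
proof -
  define \<Omega> where "\<Omega> = - cball (0::real^2) 1"
  have int: "interior (- ball (0::real^2) 1) = \<Omega>"
    by (simp add: \<Omega>_def interior_complement)
  have \<Omega>: "open \<Omega>" "\<Omega> \<in> sets borel" "\<Omega> \<subseteq> - ball 0 1" by (auto simp: \<Omega>_def)
  note [measurable] = \<Omega>(2)
  have H1: "H1_loc_on \<Omega> u G" and drift: "\<And>\<phi>. test_function \<Omega> \<phi> \<Longrightarrow> (LINT x:\<Omega>|lebesgue. G x \<bullet> grad \<phi> x + (W x \<bullet> G x) * \<phi> x) = 0"
    using sol by (auto simp: weak_drift_solution_def int)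
  have wg: "weak_gradient_on \<Omega> u G" using H1 by (simp add: H1_loc_on_def)
  have locu: "locally_integrable_on u \<Omega>" and locG: "locally_integrable_on G \<Omega>"
    using wg by (auto simp: weak_gradient_on_def)
  obtain W1 H where W1 [measurable]: "W1 \<in> borel_measurable borel" and H [measurable]: "H \<in> borel_measurable borel"
    and aeW: "AE x in lborel. x \<in> - ball 0 1 \<longrightarrow> W x = W1 x" and H0: "\<And>x. H x \<ge> 0" "(\<integral>\<^sup>+x. H x \<partial>lborel) \<le> 1"
    and young: "\<And>x t. t \<ge> 0 \<Longrightarrow> norm (W1 x) * t \<le> t + H x + (if t > 1 then t powr conj_exponent p else 0)"
    using drift_representative[OF p _ Wm Wp] by auto
  obtain G0 where G0 [measurable]: "G0 \<in> borel_measurable borel" and aeG0: "AE x in lborel. indicator \<Omega> x *\<^sub>R G x = G0 x"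
    using borel_representative[OF locally_integrable_measurable[OF locG[unfolded \<Omega>_def]]] unfolding \<Omega>_def by blast
  obtain u0 where u0 [measurable]: "u0 \<in> borel_measurable borel" and aeu0: "AE x in lborel. indicator \<Omega> x *\<^sub>R u x = u0 x"
    using borel_representative[OF locally_integrable_measurable[OF locu[unfolded \<Omega>_def]]] unfolding \<Omega>_def by blast
  \<comment> \<open>The truncations here and in \<open>u1\<close> affect only null sets and make the
    bounds by 1 and by \<open>s\<close> valid everywhere.\<close>
  define G1 where "G1 x = (if x \<in> \<Omega> \<and> norm (G0 x) \<le> 1 then G0 x else 0)" for x
  define u1 where "u1 x = (if x \<in> \<Omega> \<and> (dist x0 x < 1 \<longrightarrow> \<bar>u0 x\<bar> \<le> s) then u0 x else 0)" for x
  have G1 [measurable]: "G1 \<in> borel_measurable borel" unfolding G1_def by measurable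
  have u1 [measurable]: "u1 \<in> borel_measurable borel" unfolding u1_def by measurable
  have G1b: "norm (G1 x) \<le> 1" for x by (simp add: G1_def)
  have u1b: "\<bar>u1 x\<bar> \<le> s" if "x \<in> ball x0 1" for x using that s(1) by (simp add: u1_def)
  have G10: "G1 x = 0" and u10: "u1 x = 0" if "x \<notin> \<Omega>" for x using that by (auto simp: G1_def u1_def)
  have "AE x in lborel. x \<in> - ball 0 1 \<longrightarrow> norm (G x) \<le> 1"
    by (rule Lp_norm_infinity_AE[OF Gp]) auto
  then have aeG: "AE x in lborel. x \<in> \<Omega> \<longrightarrow> G x = G1 x"
    using aeG0 by eventually_elim (use \<Omega>(3) in \<open>auto simp: G1_def\<close>)
  have aeu: "AE x in lborel. x \<in> \<Omega> \<longrightarrow> u x = u1 x"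
    using aeu0
  proof eventually_elim
    case (elim x)
    show ?case
    proof
      assume "x \<in> \<Omega>"
      then have "u x = u0 x" using elim by simp
      then show "u x = u1 x" using s(2)[of x] \<open>x \<in> \<Omega>\<close> by (simp add: u1_def)
    qed
  qed
  have tg: "integrable lborel (\<lambda>x. frechet_derivative \<phi> (at x) (u1 x *\<^sub>R h))" "integrable lborel (\<lambda>x. (G1 x \<bullet> h) * \<phi> x)"
    "(LINT x|lborel. frechet_derivative \<phi> (at x) (u1 x *\<^sub>R h)) + (LINT x|lborel. (G1 x \<bullet> h) * \<phi> x) = 0"
    if "test_function \<Omega> \<phi>" for \<phi> h
    by (rule test_gradient[OF \<Omega>(2) wg u1 aeu _ G1 aeG _ that]; simp add: u10 G10)+
  have Gi: "set_integrable lborel K G1" and ui: "set_integrable lborel K u1" if "compact K" "K \<subseteq> \<Omega>" for K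
    by (rule set_integrable_representative[OF locG that G1 aeG], rule set_integrable_representative[OF locu that u1 aeu])
  have Hi: "integrable lborel H"
  proof (rule integrableI_bounded)
    show "(\<integral>\<^sup>+x. norm (H x) \<partial>lborel) < \<infinity>" using H0 by (auto intro: le_less_trans)
  qed measurable
  have Wle: "\<bar>W1 x \<bullet> G1 x\<bar> \<le> norm (W1 x) * norm (G1 x)" "norm (W1 x) * norm (G1 x) \<le> 1 + H x" for x
  proof -
    show "\<bar>W1 x \<bullet> G1 x\<bar> \<le> norm (W1 x) * norm (G1 x)" by (rule Cauchy_Schwarz_ineq2)
    have "norm (W1 x) * norm (G1 x) \<le> norm (W1 x) * 1" by (intro mult_left_mono G1b) auto
    then show "norm (W1 x) * norm (G1 x) \<le> 1 + H x" using young[of 1 x] by simp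
  qed
  have bi: "set_integrable lborel K (\<lambda>x. W1 x \<bullet> G1 x)" if "compact K" for K
    unfolding set_integrable_def
  proof (rule Bochner_Integration.integrable_bound)
    have [measurable]: "K \<in> sets borel" by (rule borel_compact[OF that])
    show "integrable lborel (\<lambda>x. indicator K x + H x :: real)"
      using emeasure_bounded_finite[OF compact_imp_bounded[OF that]] Hi by (auto simp: integrable_indicator_iff)
    show "(\<lambda>x. indicator K x *\<^sub>R (W1 x \<bullet> G1 x)) \<in> borel_measurable lborel" by measurable
    show "AE x in lborel. norm (indicator K x *\<^sub>R (W1 x \<bullet> G1 x)) \<le> norm (indicator K x + H x :: real)"
      using order_trans[OF Wle] H0(1) by (intro AE_I2) (auto simp: indicator_def)
  qed
  \<comment> \<open>The quarter turn in the plane, corresponding to multiplication by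
    \<open>\<i>\<close>.\<close>
  define J where "J x = plane (\<i> * unplane x)" for x
  have J: "J x = - (x $ 2) *\<^sub>R axis 1 1 + (x $ 1) *\<^sub>R axis 2 1" for x
    by (simp add: J_def plane_def unplane_def vec_eq_iff forall_2 axis_def)
  have [measurable]: "J \<in> borel_measurable borel" unfolding J_def by measurable
  have normJ: "norm (J x) = norm x" for x by (simp add: J_def norm_mult)
  have Vi: "set_integrable lborel K (\<lambda>x. u1 x *\<^sub>R h)" if "compact K" "K \<subseteq> \<Omega>" for K h
    using ui[OF that] unfolding set_integrable_def scaleR_scaleR real_scaleR_def by (intro integrable_scaleR_left)
  have qi: "set_integrable lborel K (\<lambda>x. G1 x \<bullet> h)" if "compact K" "K \<subseteq> \<Omega>" for K h
    using Gi[OF that] unfolding set_integrable_def real_scaleR_def inner_scaleR_left[symmetric] by (intro integrable_inner_left)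
  have JGi: "set_integrable lborel K (\<lambda>x. J (G1 x))" if "compact K" "K \<subseteq> \<Omega>" for K
    unfolding set_integrable_def
  proof (rule Bochner_Integration.integrable_bound)
    have [measurable]: "K \<in> sets borel" by (rule borel_compact[OF that(1)])
    show "integrable lborel (\<lambda>x. indicator K x *\<^sub>R G1 x)" using Gi[OF that] by (simp add: set_integrable_def)
    show "(\<lambda>x. indicator K x *\<^sub>R J (G1 x)) \<in> borel_measurable lborel" by measurable
  qed (simp add: normJ)
  have div_test: "(LINT x|lborel. frechet_derivative \<psi> (at x) (G1 x) + (W1 x \<bullet> G1 x) * \<psi> x) = 0" if \<psi>: "test_function \<Omega> \<psi>" for \<psi>
  proof -
    note T = test_functionD[OF \<psi>]
    note D = C1_derivD[OF T(1)]
    have [measurable]: "\<psi> \<in> borel_measurable borel" "(\<lambda>x. frechet_derivative \<psi> (at x) b) \<in> borel_measurable borel" for b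
      using borel_measurable_continuous_onI[OF D(4)] borel_measurable_continuous_onI[OF D(2)] by auto
    have gm: "grad \<psi> \<in> borel_measurable borel"
      unfolding grad_def[abs_def] by measurable
    have ig: "G1 x \<bullet> grad \<psi> x = frechet_derivative \<psi> (at x) (G1 x)" for x
      using D(1)[of x] by (intro inner_grad) (auto simp: differentiable_def)
    have "(LINT x:\<Omega>|lebesgue. G x \<bullet> grad \<psi> x + (W x \<bullet> G x) * \<psi> x) = (LINT x|lborel. G1 x \<bullet> grad \<psi> x + (W1 x \<bullet> G1 x) * \<psi> x)"
    proof (rule set_integral_representative(2)[OF _ _ \<Omega>(2)])
      show "(\<lambda>x. G1 x \<bullet> grad \<psi> x + (W1 x \<bullet> G1 x) * \<psi> x) \<in> borel_measurable borel"
        using gm by measurable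
      show "AE x in lborel. x \<in> \<Omega> \<longrightarrow> G x \<bullet> grad \<psi> x + (W x \<bullet> G x) * \<psi> x = G1 x \<bullet> grad \<psi> x + (W1 x \<bullet> G1 x) * \<psi> x"
        using aeG aeW by eventually_elim (use \<Omega>(3) in auto)
    qed (simp add: G10)
    then show ?thesis using drift[OF \<psi>] unfolding ig by simp
  qed
  \<comment> \<open>A weak gradient is curl free: use the gradient identity for the test function
    with second-coordinate derivative in direction \<open>?e1\<close>, and for the other derivative
    in direction \<open>?e2\<close>. By the symmetric Hessian the terms with \<open>u1\<close>
    agree, so the difference contains only \<open>G1\<close>.\<close>
  have curl_test: "(LINT x|lborel. frechet_derivative \<psi> (at x) (J (G1 x)) + 0 * \<psi> x) = 0" if \<psi>: "test_function \<Omega> \<psi>"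
    and sym: "symmetric_hessian \<psi>" for \<psi>
  proof -
    let ?e1 = "axis 1 1 :: real^2" and ?e2 = "axis 2 1 :: real^2"
    have B: "?e1 \<in> Basis" "?e2 \<in> Basis" by (auto simp: Basis_vec_def)
    note T = test_functionD[OF \<psi>]
    note lin = C1_derivD(3)[OF T(1)]
    note t1 = T(2)[OF B(1)] and t2 = T(2)[OF B(2)]
    note a = tg[OF t2, of ?e1] and b = tg[OF t1, of ?e2]
    have e: "frechet_derivative (\<lambda>y. frechet_derivative \<psi> (at y) ?e2) (at x) (u1 x *\<^sub>R ?e1) =
        frechet_derivative (\<lambda>y. frechet_derivative \<psi> (at y) ?e1) (at x) (u1 x *\<^sub>R ?e2)" for x
      using linear_cmul[OF C1_derivD(3)[OF test_functionD(1)[OF t1]]] linear_cmul[OF C1_derivD(3)[OF test_functionD(1)[OF t2]]] sym B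
      by (simp add: symmetric_hessian_def)
    have "frechet_derivative \<psi> (at x) (J (G1 x)) + 0 * \<psi> x =
        (G1 x \<bullet> ?e1) * frechet_derivative \<psi> (at x) ?e2 - (G1 x \<bullet> ?e2) * frechet_derivative \<psi> (at x) ?e1" for x
      unfolding J linear_add[OF lin] linear_cmul[OF lin] by (simp add: inner_axis)
    then have "(LINT x|lborel. frechet_derivative \<psi> (at x) (J (G1 x)) + 0 * \<psi> x) =
        (LINT x|lborel. (G1 x \<bullet> ?e1) * frechet_derivative \<psi> (at x) ?e2) - (LINT x|lborel. (G1 x \<bullet> ?e2) * frechet_derivative \<psi> (at x) ?e1)"
      using Bochner_Integration.integral_diff[OF a(2) b(2)] by simp
    also have "\<dots> = 0" using a(3) b(3) unfolding e by linarith
    finally show ?thesis .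
  qed
  define N where "N z = norm (W1 (plane z))" for z
  define b where "b z = W1 (plane z) \<bullet> G1 (plane z)" for z
  define Gc where "Gc z = unplane (G1 (plane z))" for z
  have nnH: "(\<integral>\<^sup>+z. H (plane z) \<partial>lborel) \<le> 1"
    using H0(2) nn_integral_plane[of "\<lambda>x. ennreal (H x)"] by simp
  \<comment> \<open>The common route for all three identities: extend from smooth to
    \<open>C^1\<close> test functions in the plane, then change variables.\<close>
  have trans: "(LINT z|lborel. \<phi>' z (unplane (V (plane z))) + Q (plane z) * \<phi> z) = 0"
    if \<phi>: "C1_deriv \<phi> \<phi>'" "compact S" "S \<subseteq> - cball 0 1" "\<And>z. z \<notin> S \<Longrightarrow> \<phi> z = 0"
      and V: "V \<in> borel_measurable borel" "Q \<in> borel_measurable borel"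
      and Vi: "\<And>K. compact K \<Longrightarrow> K \<subseteq> \<Omega> \<Longrightarrow> set_integrable lborel K V"
      and Qi: "\<And>K. compact K \<Longrightarrow> K \<subseteq> \<Omega> \<Longrightarrow> set_integrable lborel K Q"
      and test: "\<And>\<psi>. test_function \<Omega> \<psi> \<Longrightarrow> symmetric_hessian \<psi> \<Longrightarrow>
      (LINT x|lborel. frechet_derivative \<psi> (at x) (V x) + Q x * \<psi> x) = 0"
    for \<phi> :: "complex \<Rightarrow> real" and \<phi>' S and V :: "real^2 \<Rightarrow> real^2" and Q
  proof -
    have cS: "compact (plane ` S)" by (intro compact_continuous_image plane_continuous \<phi>(2))
    have S\<Omega>: "plane ` S \<subseteq> \<Omega>" using \<phi>(3) by (auto simp: \<Omega>_def)
    have z: "\<phi> (unplane x) = 0" if "x \<notin> plane ` S" for x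
      using that \<phi>(4)[of "unplane x"] by (metis imageI plane_unplane)
    have W: "integrable lborel (\<lambda>x. \<phi>' (unplane x) (unplane (V x)) + Q x * \<phi> (unplane x))"
      "(LINT x|lborel. \<phi>' (unplane x) (unplane (V x)) + Q x * \<phi> (unplane x)) = 0"
      by (rule weak_identity_C1[OF \<Omega>(1) V _ _ _ C1_unplane[OF \<phi>(1)] cS S\<Omega>]; (rule Vi Qi test z; assumption))+
    have m: "(\<lambda>x. \<phi>' (unplane x) (unplane (V x)) + Q x * \<phi> (unplane x)) \<in> borel_measurable borel"
      using borel_measurable_integrable[OF W(1)] by (simp only: measurable_lborel2)
    show ?thesis
      using W(2) unfolding integral_plane[OF m] unplane_plane .
  qed
  have "weak_solution N (\<lambda>z. H (plane z)) (conj_exponent p) (\<lambda>z. u1 (plane z)) b Gc"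
  proof
    show "N \<in> borel_measurable borel" "b \<in> borel_measurable borel" "Gc \<in> borel_measurable borel"
      unfolding N_def b_def Gc_def by measurable
    show "(\<lambda>z. H (plane z)) \<in> borel_measurable borel" "(\<lambda>z. u1 (plane z)) \<in> borel_measurable borel" by measurable
    show "N z * t \<le> t + H (plane z) + (if 1 < t then t powr conj_exponent p else 0)" if "0 \<le> t" for t z
      unfolding N_def by (rule young[OF that])
    show "0 \<le> H (plane z)" for z by (rule H0(1))
    show "(\<integral>\<^sup>+z. H (plane z) \<partial>lborel) \<le> 1" by (rule nnH)
    show "norm (Gc z) \<le> 1" for z by (simp add: Gc_def G1b)
    show "\<bar>b z\<bar> \<le> N z * norm (Gc z)" for z using Wle(1) by (simp add: b_def N_def Gc_def)
    show "0 \<le> N z" for z by (simp add: N_def)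
    fix \<phi> \<phi>' S
    assume \<phi>: "C1_deriv \<phi> \<phi>'" "compact S" "S \<subseteq> - cball (0::complex) 1" "\<And>z. z \<notin> S \<Longrightarrow> \<phi> z = (0::real)"
    note lin = C1_derivD(3)[OF \<phi>(1)]
    show "(LINT z|lborel. u1 (plane z) * \<phi>' z h + (Gc z \<bullet> h) * \<phi> z) = 0" for h
    proof -
      have "(LINT z|lborel. \<phi>' z (unplane (u1 (plane z) *\<^sub>R plane h)) + (G1 (plane z) \<bullet> plane h) * \<phi> z) = 0"
      proof (rule trans[OF \<phi>, of "\<lambda>x. u1 x *\<^sub>R plane h" "\<lambda>x. G1 x \<bullet> plane h"])
        show "set_integrable lborel K (\<lambda>x. u1 x *\<^sub>R plane h)" "set_integrable lborel K (\<lambda>x. G1 x \<bullet> plane h)"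
          if "compact K" "K \<subseteq> \<Omega>" for K
          by (rule Vi[OF that], rule qi[OF that])
        show "(LINT x|lborel. frechet_derivative \<psi> (at x) (u1 x *\<^sub>R plane h) + (G1 x \<bullet> plane h) * \<psi> x) = 0"
          if "test_function \<Omega> \<psi>" for \<psi> using tg[OF that, of "plane h"] by simp
      qed measurable
      then show ?thesis
        by (simp add: linear_cmul[OF linear_unplane] linear_cmul[OF lin] Gc_def inner_unplane)
    qed
    show "(LINT z|lborel. \<phi>' z (Gc z) + b z * \<phi> z) = 0"
      unfolding Gc_def b_def
    proof (rule trans[OF \<phi>, of G1 "\<lambda>x. W1 x \<bullet> G1 x"])
      show "set_integrable lborel K G1" "set_integrable lborel K (\<lambda>x. W1 x \<bullet> G1 x)" if "compact K" "K \<subseteq> \<Omega>" for K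
        by (rule Gi[OF that], rule bi[OF that(1)])
    qed (measurable, rule div_test)
    have "(LINT z|lborel. \<phi>' z (unplane (J (G1 (plane z)))) + 0 * \<phi> z) = 0"
    proof (rule trans[OF \<phi>, of "\<lambda>x. J (G1 x)" "\<lambda>x. 0"])
      show "set_integrable lborel K (\<lambda>x. J (G1 x))" if "compact K" "K \<subseteq> \<Omega>" for K by (rule JGi[OF that])
      show "set_integrable lborel K (\<lambda>x. 0 :: real)" for K :: "(real^2) set" by (simp add: set_integrable_def)
    qed (measurable, rule curl_test)
    then show "(LINT z|lborel. \<phi>' z (\<i> * Gc z)) = 0" by (simp add: J_def Gc_def)
  qed
  moreover have "\<forall>z\<in>ball (unplane x0) 1. \<bar>u1 (plane z)\<bar> \<le> s"
    using u1b dist_plane[of "unplane x0"] by (auto simp del: dist_plane)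
  moreover have "(LINT z|lborel. indicator (ball 3 1) z * (norm (Gc z))\<^sup>2) = (LINT x:ball (plane 3) 1|lebesgue. (norm (G x))\<^sup>2)"
  proof -
    have B\<Omega>: "ball (plane 3) 1 \<subseteq> \<Omega>"
    proof
      fix x assume "x \<in> ball (plane 3) 1"
      then have "norm (plane 3 - x) < 1" by (simp add: dist_norm)
      then show "x \<in> \<Omega>" using norm_triangle_sub[of "plane 3" x] by (simp add: \<Omega>_def)
    qed
    have [measurable]: "ball (plane 3) 1 \<in> sets borel" by simp
    have "(LINT x:ball (plane 3) 1|lebesgue. (norm (G x))\<^sup>2) = (LINT x|lborel. indicator (ball (plane 3) 1) x * (norm (G1 x))\<^sup>2)"
    proof (rule set_integral_representative(2))
      show "AE x in lborel. x \<in> ball (plane 3) 1 \<longrightarrow> (norm (G x))\<^sup>2 = indicator (ball (plane 3) 1) x * (norm (G1 x))\<^sup>2"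
        using aeG by eventually_elim (use B\<Omega> in auto)
    qed auto
    also have "\<dots> = (LINT z|lborel. indicator (ball (plane 3) 1) (plane z) * (norm (G1 (plane z)))\<^sup>2)"
      by (rule integral_plane) measurable
    also have "\<dots> = (LINT z|lborel. indicator (ball 3 1) z * (norm (Gc z))\<^sup>2)"
      by (intro Bochner_Integration.integral_cong) (auto simp: Gc_def indicator_def)
    finally show ?thesis by simp
  qed
  ultimately show ?thesis by blast
qed

section \<open>Combining the growth and the energy estimate\<close>

theorem theorem1p2:
  fixes p :: ennreal and C0 :: real
  assumes "2 < p" and "C0 > 0"
  shows "\<exists>C1 C2 :: real. C1 > 0 \<and> C2 > 0 \<and>
    (\<forall>\<^sub>F R in at_top. \<forall>(W :: real^2 \<Rightarrow> real^2) (u :: real^2 \<Rightarrow> real) (G :: real^2 \<Rightarrow> real^2).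
       W \<in> borel_measurable (lebesgue_on (- ball 0 1)) \<and>
       Lp_norm p (lebesgue_on (- ball 0 1)) W \<le> 1 \<and>
       weak_drift_solution (interior (- ball 0 1)) W u G \<and>
       Lp_norm \<infinity> (lebesgue_on (- ball 0 1)) G \<le> 1 \<and>
       (INF z0\<in>sphere 0 3. LINT x:ball z0 1|lebesgue. (norm (G x))\<^sup>2) \<ge> C0
       \<longrightarrow>
       (INF z0\<in>sphere 0 R. SUP z\<in>ball z0 1. ennreal \<bar>u z\<bar>)
         \<ge> ennreal (C2 * exp (- C1 * R * (ln R)\<^sup>2)))"
proof -
  obtain C R0 where C: "C \<ge> 0" "R0 \<ge> 24"
    "\<forall>f a N H R z0. drift_system N H (conj_exponent p) f a \<longrightarrow>
       (LINT z|lborel. indicator (ball 3 1) z * (norm (f z))\<^sup>2) \<ge> C0 \<longrightarrow> R \<ge> R0 \<longrightarrow> norm (z0 :: complex) = R \<longrightarrow>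
       (LINT z|lborel. indicator (cball z0 (1/2)) z * norm (f z)) \<ge> exp (- C * R * (ln R)\<^sup>2)"
    using growth_estimate[OF conj_exponent_bounds[OF assms(1)] assms(2)] by blast
  have cut: "C1_deriv (cutoff (1/2) (5/8)) (cutoff' (1/2) (5/8))" by (rule cutoff_C1) auto
  have cut0: "cutoff (1/2) (5/8) z = 0" if "z \<notin> cball 0 (5/8)" for z
    using that by (intro cutoff_eq) auto
  have cut'0: "cutoff' (1/2) (5/8) z h = 0" if "z \<notin> cball 0 (5/8)" for z h
    by (rule has_derivative_zero_outside[OF C1_derivD(1)[OF cut] closed_cball cut0 that])
  obtain B1 where B1: "B1 \<ge> 0" "\<And>z. norm (cutoff' (1/2) (5/8) z 1) \<le> B1"
    using continuous_compact_support_bounded[OF C1_derivD(2)[OF cut] compact_cball cut'0] by metis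
  obtain B2 where B2: "B2 \<ge> 0" "\<And>z. norm (cutoff' (1/2) (5/8) z \<i>) \<le> B2"
    using continuous_compact_support_bounded[OF C1_derivD(2)[OF cut] compact_cball cut'0] by metis
  define B where "B = max B1 B2"
  have B: "\<bar>cutoff' (1/2) (5/8) z 1\<bar> \<le> B" "\<bar>cutoff' (1/2) (5/8) z \<i>\<bar> \<le> B" "B \<ge> 0" for z
    using B1(1) B1(2)[of z] B2(2)[of z] by (auto simp: B_def)
  define V where "V = measure lborel (ball (0::complex) 1)"
  have V: "measure lborel (ball z 1) = V" "measure lborel (cball z (1/2)) \<le> V" for z :: complex
  proof -
    show *: "measure lborel (ball z 1) = V" for z :: complex by (simp add: V_def content_ball)
    have "measure lborel (cball z (1/2)) \<le> measure lborel (ball z 1)"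
      using emeasure_lborel_ball_finite[of z 1] by (intro measure_mono_fmeasurable) (auto simp: fmeasurable_def)
    then show "measure lborel (cball z (1/2)) \<le> V" by (simp only: *)
  qed
  have V0: "V > 0" unfolding V_def using content_ball_pos[of 1 "0::complex"] by simp
  define K where "K = (2 * B + 1) * V + 1"
  have K: "K > 0" using B(3) V0 by (simp add: K_def add_nonneg_pos)
  \<comment> \<open>Read off from \<open>e\<^sup>2 / (4 * V) \<le> K * s\<close> at the end of
    \<open>main\<close>.\<close>
  define C2 where "C2 = 1 / (4 * V * K)"
  have C2: "C2 > 0" using K V0 by (simp add: C2_def)
  have main: "ennreal (C2 * exp (- (2 * C + 1) * R * (ln R)\<^sup>2)) \<le> (SUP x\<in>ball x0 1. ennreal \<bar>u x\<bar>)"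
    if R: "R \<ge> R0" and Wm: "W \<in> borel_measurable (lebesgue_on (- ball 0 1))"
      and Wp: "Lp_norm p (lebesgue_on (- ball 0 1)) W \<le> 1"
      and sol: "weak_drift_solution (interior (- ball 0 1)) W u G"
      and Gp: "Lp_norm \<infinity> (lebesgue_on (- ball 0 1)) G \<le> 1"
      and low: "(INF z0\<in>sphere 0 3. LINT x:ball z0 1|lebesgue. (norm (G x))\<^sup>2) \<ge> C0" and x0: "norm x0 = R"
    for R and W G :: "real^2 \<Rightarrow> real^2" and u x0
  proof (cases "(SUP x\<in>ball x0 1. ennreal \<bar>u x\<bar>) = \<infinity>")
    case False
    then obtain s where s: "s \<ge> 0" "(SUP x\<in>ball x0 1. ennreal \<bar>u x\<bar>) = ennreal s"
      by (cases "SUP x\<in>ball x0 1. ennreal \<bar>u x\<bar>") auto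
    have us: "\<bar>u x\<bar> \<le> s" if "x \<in> ball x0 1" for x
    proof -
      have "ennreal \<bar>u x\<bar> \<le> ennreal s" unfolding s(2)[symmetric] using that by (rule SUP_upper)
      then show ?thesis using s(1) by simp
    qed
    obtain N H u' b G' where ws: "weak_solution N H (conj_exponent p) u' b G'"
      and u': "\<forall>z\<in>ball (unplane x0) 1. \<bar>u' z\<bar> \<le> s"
      and G': "(LINT z|lborel. indicator (ball 3 1) z * (norm (G' z))\<^sup>2) = (LINT x:ball (plane 3) 1|lebesgue. (norm (G x))\<^sup>2)"
      using plane_weak_solution[OF assms(1) Wm Wp sol Gp s(1) us] by blast
    interpret weak_solution N H "conj_exponent p" u' b G' by fact
    define z0 where "z0 = unplane x0"
    have z0: "norm z0 = R" using x0 by (simp add: z0_def)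
    \<comment> \<open>The infimum is used only at the single centre \<open>plane 3\<close>. It is an
      infimum of reals, so boundedness below has to be supplied.\<close>
    have "C0 \<le> (LINT x:ball (plane 3) 1|lebesgue. (norm (G x))\<^sup>2)"
    proof (rule order_trans[OF low cINF_lower])
      show "bdd_below ((\<lambda>z0. LINT x:ball z0 1|lebesgue. (norm (G x))\<^sup>2) ` sphere 0 3)"
        by (intro bdd_belowI2[of _ 0]) (simp add: set_lebesgue_integral_def)
    qed simp
    then have "exp (- C * R * (ln R)\<^sup>2) \<le> (LINT z|lborel. indicator (cball z0 (1/2)) z * norm (cnj (G' z)))"
      using C(3)[rule_format, OF drift_system _ R z0] G' by simp
    then have low1: "exp (- C * R * (ln R)\<^sup>2) \<le> (LINT z|lborel. indicator (cball z0 (1/2)) z * norm (G' z))" by simp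
    have "norm z0 \<ge> 3" using z0 R C(2) by simp
    then have up: "(LINT z|lborel. indicator (cball z0 (1/2)) z * (norm (G' z))\<^sup>2) \<le> K * s"
      using energy_estimate[OF _ _ B(1,2), of z0 s] u' by (simp add: z0_def K_def V)
    define e where "e = exp (- C * R * (ln R)\<^sup>2)"
    \<comment> \<open>In \<open>norm (G' z) \<le> \<tau> + (norm (G' z))\<^sup>2 / \<tau>\<close>
      the first term integrates to at most \<open>\<tau> * V = e / 2\<close>, which is absorbed on
      the left; the second is controlled by the energy estimate.\<close>
    define \<tau> where "\<tau> = e / (2 * V)"
    have \<tau>: "\<tau> > 0" using V0 by (simp add: \<tau>_def e_def)
    have [measurable]: "cball z0 (1/2) \<in> sets borel" by simp
    have ic: "integrable lborel (\<lambda>z. indicator (cball z0 (1/2)) z :: real)"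
      using emeasure_lborel_cball_finite[of z0 "1/2"] by (simp add: integrable_indicator_iff)
    have i1: "integrable lborel (\<lambda>z. indicator (cball z0 (1/2)) z * norm (G' z))"
      by (rule Bochner_Integration.integrable_bound[OF ic]) (use G_bound in \<open>auto simp: indicator_def\<close>)
    have i2: "integrable lborel (\<lambda>z. indicator (cball z0 (1/2)) z * (norm (G' z))\<^sup>2)"
      by (rule Bochner_Integration.integrable_bound[OF ic]) (use G_bound in \<open>auto simp: indicator_def power_le_one\<close>)
    have "(LINT z|lborel. indicator (cball z0 (1/2)) z * norm (G' z)) \<le>
        (LINT z|lborel. \<tau> * indicator (cball z0 (1/2)) z + (1 / \<tau>) * (indicator (cball z0 (1/2)) z * (norm (G' z))\<^sup>2))"
    proof (rule integral_mono[OF i1])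
      show "integrable lborel (\<lambda>z. \<tau> * indicator (cball z0 (1/2)) z + (1 / \<tau>) * (indicator (cball z0 (1/2)) z * (norm (G' z))\<^sup>2))"
        by (intro Bochner_Integration.integrable_add integrable_mult_right ic i2)
      fix z
      have "norm (G' z) \<le> \<tau> + (1 / \<tau>) * (norm (G' z))\<^sup>2"
      proof (cases "norm (G' z) \<le> \<tau>")
        case True
        then show ?thesis using \<tau> by (intro order_trans[OF True]) simp
      next
        case False
        then have "norm (G' z) * \<tau> \<le> norm (G' z) * norm (G' z)" by (intro mult_left_mono) auto
        then have "norm (G' z) \<le> (1 / \<tau>) * (norm (G' z))\<^sup>2"
          using \<tau> by (simp add: power2_eq_square pos_le_divide_eq)
        then show ?thesis using \<tau> by linarith
      qed
      then show "indicator (cball z0 (1/2)) z * norm (G' z) \<le> \<tau> * indicator (cball z0 (1/2)) z + (1 / \<tau>) * (indicator (cball z0 (1/2)) z * (norm (G' z))\<^sup>2)"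
        by (simp add: indicator_def)
    qed
    also have "\<dots> = \<tau> * measure lborel (cball z0 (1/2)) + (1 / \<tau>) * (LINT z|lborel. indicator (cball z0 (1/2)) z * (norm (G' z))\<^sup>2)"
      using ic i2 by simp
    also have "\<dots> \<le> \<tau> * V + (1 / \<tau>) * (K * s)"
      using \<tau> by (intro add_mono mult_left_mono V up) auto
    finally have "e \<le> \<tau> * V + (1 / \<tau>) * (K * s)" using low1 by (simp add: e_def)
    moreover have "\<tau> * V = e / 2" using V0 by (simp add: \<tau>_def)
    ultimately have "e / 2 \<le> (1 / \<tau>) * (K * s)" by linarith
    then have "e / 2 * \<tau> \<le> K * s" using \<tau> by (simp add: pos_le_divide_eq)
    then have "e\<^sup>2 / (4 * V) \<le> K * s" by (simp add: \<tau>_def power2_eq_square)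
    then have "C2 * e\<^sup>2 \<le> s"
      using K V0 by (simp add: C2_def field_simps)
    moreover have "C2 * exp (- (2 * C + 1) * R * (ln R)\<^sup>2) \<le> C2 * e\<^sup>2"
    proof (rule mult_left_mono)
      have "e\<^sup>2 = exp (2 * (- C * R * (ln R)\<^sup>2))" by (simp only: e_def exp_double)
      moreover have "- (2 * C + 1) * R * (ln R)\<^sup>2 \<le> 2 * (- C * R * (ln R)\<^sup>2)"
      proof -
        have "0 \<le> R * (ln R)\<^sup>2" using R C(2) by simp
        then show ?thesis by (simp add: algebra_simps)
      qed
      ultimately show "exp (- (2 * C + 1) * R * (ln R)\<^sup>2) \<le> e\<^sup>2" by (simp only: exp_le_cancel_iff)
    qed (use C2 in simp)
    ultimately show ?thesis unfolding s(2) by (intro ennreal_leI) linarith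
  next
    case True
    show ?thesis unfolding True by simp
  qed
  show ?thesis
  proof (intro exI conjI)
    \<comment> \<open>The 2 comes from \<open>e\<^sup>2\<close>; the 1 ensures positivity, since
      \<open>C\<close> may be 0.\<close>
    show "2 * C + 1 > 0" using C by simp
    show "C2 > 0" by fact
    show "\<forall>\<^sub>F R in at_top. \<forall>(W :: real^2 \<Rightarrow> real^2) (u :: real^2 \<Rightarrow> real) (G :: real^2 \<Rightarrow> real^2).
       W \<in> borel_measurable (lebesgue_on (- ball 0 1)) \<and>
       Lp_norm p (lebesgue_on (- ball 0 1)) W \<le> 1 \<and>
       weak_drift_solution (interior (- ball 0 1)) W u G \<and>
       Lp_norm \<infinity> (lebesgue_on (- ball 0 1)) G \<le> 1 \<and>
       (INF z0\<in>sphere 0 3. LINT x:ball z0 1|lebesgue. (norm (G x))\<^sup>2) \<ge> C0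
       \<longrightarrow>
       (INF z0\<in>sphere 0 R. SUP z\<in>ball z0 1. ennreal \<bar>u z\<bar>)
         \<ge> ennreal (C2 * exp (- (2 * C + 1) * R * (ln R)\<^sup>2))"
      using eventually_ge_at_top[of R0]
    proof eventually_elim
      case (elim R)
      show ?case
      proof (intro allI impI INF_greatest, elim conjE)
        fix W G :: "real^2 \<Rightarrow> real^2" and u and x0 :: "real^2"
        assume "W \<in> borel_measurable (lebesgue_on (- ball 0 1))" "Lp_norm p (lebesgue_on (- ball 0 1)) W \<le> 1"
          "weak_drift_solution (interior (- ball 0 1)) W u G" "Lp_norm \<infinity> (lebesgue_on (- ball 0 1)) G \<le> 1"
          "C0 \<le> (INF z0\<in>sphere 0 3. LINT x:ball z0 1|lebesgue. (norm (G x))\<^sup>2)" "x0 \<in> sphere 0 R"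
        then show "ennreal (C2 * exp (- (2 * C + 1) * R * (ln R)\<^sup>2)) \<le> (SUP z\<in>ball x0 1. ennreal \<bar>u z\<bar>)"
          using main[OF elim] by (simp only: mem_sphere_0)
      qed
    qed
  qed
qed

end
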